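(* Let $n>2$. Any simple linearly compact generalized $n$-Nambu-Poisson algebra over $\mathbb{F}$ is gauge equivalent either to the $n$-Nambu algebra, i.e. $\mathbb{F}[[x_1,\dots,x_n]]$ with the $n$-ary bracket $$\{f_1,\dots,f_n\}=\det\left(\frac{\partial f_i}{\partial x_j}\right)_{i,j=1}^n,$$ or to the $n$-Dzhumadildaev algebra, i.e. $\mathbb{F}[[x_1,\dots,x_{n-1}]]$ with the $n$-ary bracket $$\{f_1,\dots,f_n\}=\det\begin{pmatrix} f_1&\dots&f_n\\ \frac{\partial f_1}{\partial x_1}&\dots&\frac{\partial f_n}{\partial x_1}\\ \dots&\dots&\dots\\ \frac{\partial f_1}{\partial x_{n-1}}&\dots&\frac{\partial f_n}{\partial x_{n-1}}\end{pmatrix}$$ (in both cases with the usual commutative associative product of formal power series).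
   Context: The base field $\mathbb{F}$ is algebraically closed of characteristic $0$. An $n$-Lie algebra is a vector space with an $n$-linear skew-symmetric bracket $\{\cdot,\dots,\cdot\}$ satisfying the Filippov-Jacobi identity $\{a_1,\dots,a_{n-1},\{b_1,\dots,b_n\}\}=\sum_{i=1}^n\{b_1,\dots,b_{i-1},\{a_1,\dots,a_{n-1},b_i\},b_{i+1},\dots,b_n\}$. A generalized $n$-Nambu-Poisson algebra is a triple $(\mathcal{N},\{\cdot,\dots,\cdot\},\cdot)$ such that $(\mathcal{N},\cdot)$ is a unital commutative associative algebra, $(\mathcal{N},\{\cdot,\dots,\cdot\})$ is an $n$-Lie algebra, and the generalized Leibniz rule $$\{a_1,\dots,a_{n-1},bc\}=\{a_1,\dots,a_{n-1},b\}c+b\{a_1,\dots,a_{n-1},c\}-\{a_1,\dots,a_{n-1},1\}bc$$ holds. Gauge equivalence: for an invertible element $\varphi\in\mathcal{N}$ put $\{f_1,\dots,f_n\}^{\varphi}=\varphi^{-1}\{\varphi f_1,\dots,\varphi f_n\}$; then $\mathcal{N}^{\varphi}=(\mathcal{N},\{\cdot,\dots,\cdot\}^{\varphi},\cdot)$ is again a generalized $n$-Nambu-Poisson algebra, and $\mathcal{N}$ and $\mathcal{N}^{\varphi}$ are called gauge equivalent. As usual algebras are considered up to isomorphism, so an algebra $\mathcal{M}$ is gauge equivalent to $\mathcal{N}$ if $\mathcal{M}\cong\mathcal{N}^{\varphi}$ for some invertible $\varphi\in\mathcal{N}$. Simple means: the bracket is not identically zero and the only subspaces $I$ with $\mathcal{N}\cdot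 I\subseteq I$ and $\{I,\mathcal{N},\dots,\mathcal{N}\}\subseteq I$ are $0$ and $\mathcal{N}$. Linearly compact means: $\mathcal{N}$ is a topological algebra (product and bracket continuous) whose underlying topological vector space is linearly compact, i.e. isomorphic to a topological product of finite-dimensional discrete vector spaces ($\mathbb{F}$ being discrete). *)

theory Defs
  imports
    "HOL-Analysis.Analysis"
    "HOL-Library.Poly_Mapping"
    "HOL-Combinatorics.Permutations"
    "Jordan_Normal_Form.Determinant"
begin

section \<open>Formal power series in the variables \<open>x\<^sub>0, x\<^sub>1, x\<^sub>2, \<dots>\<close>\<close>

text \<open>
  A monomial is a finitely supported exponent function \<open>nat \<Rightarrow>\<^sub>0 nat\<close>, and a power series is an
  arbitrary family of coefficients.  The ring \<open>\<bbbF>[[x\<^sub>0,\<dots>,x\<^bsub>m-1\<^esub>]]\<close> is the subring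
  \<open>mps_vars m\<close> below; this allows the number of variables to be an ordinary natural number.
\<close>

typedef 'k mps = "UNIV :: ((nat \<Rightarrow>\<^sub>0 nat) \<Rightarrow> 'k) set"
  morphisms mps_coeff Abs_mps ..

setup_lifting type_definition_mps

lemma mps_eqI: "(\<And>e. mps_coeff f e = mps_coeff g e) \<Longrightarrow> f = g"
  by (metis ext mps_coeff_inject)

definition splits :: "(nat \<Rightarrow>\<^sub>0 nat) \<Rightarrow> ((nat \<Rightarrow>\<^sub>0 nat) \<times> (nat \<Rightarrow>\<^sub>0 nat)) set" where
  "splits e = {(a, b). a + b = e}"

lemma finite_splits [simp]: "finite (splits e)"
proof -
  let ?S = "{f :: nat \<Rightarrow> nat. \<forall>x. (x \<in> Poly_Mapping.keys e \<longrightarrow> f x \<in> {..Poly_Mapping.lookup e x}) \<and> (x \<notin> Poly_Mapping.keys e \<longrightarrow> f x = 0)}"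
  have fin: "finite ?S"
    by (intro finite_set_of_finite_funs[of "Poly_Mapping.keys e" "\<Union>x\<in>Poly_Mapping.keys e. {..Poly_Mapping.lookup e x}" 0, THEN finite_subset[rotated]])
       auto
  have le: "Poly_Mapping.lookup a x \<le> Poly_Mapping.lookup e x" "Poly_Mapping.lookup b x \<le> Poly_Mapping.lookup e x" if "a + b = e" for a b x
    using that by (auto simp: lookup_add)
  have mem: "Poly_Mapping.lookup c \<in> ?S" if "\<And>x. Poly_Mapping.lookup c x \<le> Poly_Mapping.lookup e x" for c
    using that by (auto simp: in_keys_iff) (metis le_zero_eq)
  have "Poly_Mapping.lookup ` fst ` splits e \<subseteq> ?S" "Poly_Mapping.lookup ` snd ` splits e \<subseteq> ?S"
    by (intro image_subsetI; elim imageE; simp only:; rule mem;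
        use le in \<open>simp add: splits_def case_prod_beta\<close>)+
  then have "finite (Poly_Mapping.lookup ` fst ` splits e)" "finite (Poly_Mapping.lookup ` snd ` splits e)"
    using fin finite_subset by blast+
  moreover have "inj (Poly_Mapping.lookup :: (nat \<Rightarrow>\<^sub>0 nat) \<Rightarrow> _)"
    by (simp add: inj_def lookup_inject)
  ultimately have "finite (fst ` splits e)" "finite (snd ` splits e)"
    by (meson finite_imageD inj_on_subset subset_UNIV)+
  then have "finite (fst ` splits e \<times> snd ` splits e)" by blast
  then show ?thesis by (rule finite_subset[rotated]) (force simp: image_iff)
qed

instantiation mps :: (comm_ring_1) comm_ring_1
begin

lift_definition zero_mps :: "'a mps" is "\<lambda>_. 0" .
lift_definition one_mps :: "'a mps" is "\<lambda>e. if e = 0 then 1 else 0" .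
lift_definition plus_mps :: "'a mps \<Rightarrow> 'a mps \<Rightarrow> 'a mps" is "\<lambda>f g e. f e + g e" .
lift_definition minus_mps :: "'a mps \<Rightarrow> 'a mps \<Rightarrow> 'a mps" is "\<lambda>f g e. f e - g e" .
lift_definition uminus_mps :: "'a mps \<Rightarrow> 'a mps" is "\<lambda>f e. - f e" .
lift_definition times_mps :: "'a mps \<Rightarrow> 'a mps \<Rightarrow> 'a mps" is
  "\<lambda>f g e. \<Sum>(a, b)\<in>splits e. f a * g b" .

lemmas mps_coeff_simps =
  zero_mps.rep_eq plus_mps.rep_eq minus_mps.rep_eq uminus_mps.rep_eq

instance
proof
  fix f g h :: "'a mps"
  show "f * g * h = f * (g * h)"
  proof (rule mps_eqI)
    fix e
    let ?c = "mps_coeff f" and ?d = "mps_coeff g" and ?r = "mps_coeff h"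
    have "mps_coeff (f * g * h) e
        = (\<Sum>p\<in>splits e. \<Sum>q\<in>splits (fst p). ?c (fst q) * ?d (snd q) * ?r (snd p))"
      by (simp add: times_mps.rep_eq sum_distrib_right case_prod_beta)
    also have "\<dots> = (\<Sum>(p, q)\<in>Sigma (splits e) (\<lambda>p. splits (fst p)).
        ?c (fst q) * ?d (snd q) * ?r (snd p))"
      by (simp add: sum.Sigma)
    also have "\<dots> = (\<Sum>(p, q)\<in>Sigma (splits e) (\<lambda>p. splits (snd p)).
        ?c (fst p) * (?d (fst q) * ?r (snd q)))"
      by (rule sum.reindex_bij_witness[where
            i = "\<lambda>((a, bc), (b, c)). ((a + b, c), (a, b))" and
            j = "\<lambda>((ab, c), (a, b)). ((a, b + c), (b, c))"])
         (auto simp: splits_def add.assoc mult.assoc)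
    also have "\<dots> = (\<Sum>p\<in>splits e. \<Sum>q\<in>splits (snd p). ?c (fst p) * (?d (fst q) * ?r (snd q)))"
      by (simp add: sum.Sigma)
    also have "\<dots> = mps_coeff (f * (g * h)) e"
      by (simp add: times_mps.rep_eq sum_distrib_left case_prod_beta)
    finally show "mps_coeff (f * g * h) e = mps_coeff (f * (g * h)) e" .
  qed
  show "f * g = g * f"
  proof (rule mps_eqI)
    fix e
    show "mps_coeff (f * g) e = mps_coeff (g * f) e"
      unfolding times_mps.rep_eq
      by (rule sum.reindex_bij_witness[where i = prod.swap and j = prod.swap])
         (auto simp: splits_def add.commute mult.commute)
  qed
  show "1 * f = f"
  proof (rule mps_eqI)
    fix e
    have "mps_coeff (1 * f) e
        = (\<Sum>p\<in>splits e. if p = (0, e) then mps_coeff f e else 0)"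
      unfolding times_mps.rep_eq
      by (rule sum.cong) (auto simp: splits_def one_mps.rep_eq split: if_splits)
    also have "\<dots> = mps_coeff f e"
      using finite_splits[of e] by (subst sum.delta) (simp, simp add: splits_def)
    finally show "mps_coeff (1 * f) e = mps_coeff f e" .
  qed
  show "(f + g) * h = f * h + g * h"
    by (rule mps_eqI)
       (simp add: times_mps.rep_eq plus_mps.rep_eq distrib_right sum.distrib case_prod_beta)
  show "(0 :: 'a mps) \<noteq> 1"
    by (metis one_mps.rep_eq zero_mps.rep_eq zero_neq_one)
  show "f + g + h = f + (g + h)"
    by (rule mps_eqI) (simp add: mps_coeff_simps ac_simps)
  show "f + g = g + f"
    by (rule mps_eqI) (simp add: mps_coeff_simps ac_simps)
  show "0 + f = f"
    by (rule mps_eqI) (simp add: mps_coeff_simps ac_simps)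
  show "- f + f = 0"
    by (rule mps_eqI) (simp add: mps_coeff_simps ac_simps)
  show "f - g = f + - g"
    by (rule mps_eqI) (simp add: mps_coeff_simps ac_simps)
qed

end

lift_definition mps_scale :: "'k::comm_ring_1 \<Rightarrow> 'k mps \<Rightarrow> 'k mps" is
  "\<lambda>c f e. c * f e" .

lift_definition mps_deriv :: "nat \<Rightarrow> 'k::comm_ring_1 mps \<Rightarrow> 'k mps" is
  "\<lambda>j f e. of_nat (Poly_Mapping.lookup e j + 1) * f (e + Poly_Mapping.single j 1)" .

definition mps_vars :: "nat \<Rightarrow> 'k::comm_ring_1 mps set" where
  "mps_vars m = {f. \<forall>e. mps_coeff f e \<noteq> 0 \<longrightarrow> Poly_Mapping.keys e \<subseteq> {..<m}}"

text \<open>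
  The topology of coefficientwise convergence, the coefficient field being discrete; on
  \<open>mps_vars m\<close> it is the \<open>(x\<^sub>0,\<dots>,x\<^bsub>m-1\<^esub>)\<close>-adic topology.
\<close>
definition mps_topology :: "nat \<Rightarrow> 'k::comm_ring_1 mps topology" where
  "mps_topology m = pullback_topology (mps_vars m) mps_coeff
     (product_topology (\<lambda>_. discrete_topology UNIV) UNIV)"


section \<open>Generalized \<open>n\<close>-Nambu-Poisson algebras\<close>

text \<open>
  The space is a subset of a commutative ring type and inherits its addition, multiplication and
  unit; an algebra on a whole type has \<open>space\<close> equal to \<open>UNIV\<close>.  The \<open>n\<close>-ary bracket is applied to
  lists of length \<open>n\<close>, its values on other lists are irrelevant.
\<close>
record ('k, 'a) np_struct =
  np_space :: "'a set"
  np_scale :: "'k \<Rightarrow> 'a \<Rightarrow> 'a"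
  np_bracket :: "'a list \<Rightarrow> 'a"
  np_topology :: "'a topology"

definition np_args :: "nat \<Rightarrow> ('k, 'a) np_struct \<Rightarrow> 'a list set" where
  "np_args n N = {xs. length xs = n \<and> set xs \<subseteq> np_space N}"

definition commutative_algebra :: "('k::field, 'a::comm_ring_1) np_struct \<Rightarrow> bool" where
  "commutative_algebra N \<longleftrightarrow>
     vector_space (np_scale N) \<and>
     module.subspace (np_scale N) (np_space N) \<and>
     1 \<in> np_space N \<and>
     (\<forall>x\<in>np_space N. \<forall>y\<in>np_space N. x * y \<in> np_space N) \<and>
     (\<forall>c. \<forall>x\<in>np_space N. \<forall>y\<in>np_space N. np_scale N c (x * y) = np_scale N c x * y)"

definition n_lie_algebra :: "nat \<Rightarrow> ('k::field, 'a::comm_ring_1) np_struct \<Rightarrow> bool" where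
  "n_lie_algebra n N \<longleftrightarrow>
     vector_space (np_scale N) \<and>
     module.subspace (np_scale N) (np_space N) \<and>
     (\<forall>xs\<in>np_args n N. np_bracket N xs \<in> np_space N) \<and>
     (\<forall>xs\<in>np_args n N. \<forall>i<n. \<forall>x\<in>np_space N. \<forall>y\<in>np_space N.
        np_bracket N (xs[i := x + y]) = np_bracket N (xs[i := x]) + np_bracket N (xs[i := y])) \<and>
     (\<forall>xs\<in>np_args n N. \<forall>i<n. \<forall>c. \<forall>x\<in>np_space N.
        np_bracket N (xs[i := np_scale N c x]) = np_scale N c (np_bracket N (xs[i := x]))) \<and>
     (\<forall>xs\<in>np_args n N. \<forall>p. p permutes {..<n} \<longrightarrow>
        np_bracket N (permute_list p xs) = of_int (sign p) * np_bracket N xs) \<and>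
     (\<forall>as\<in>np_args (n - 1) N. \<forall>bs\<in>np_args n N.
        np_bracket N (as @ [np_bracket N bs]) =
          (\<Sum>i<n. np_bracket N (bs[i := np_bracket N (as @ [bs ! i])])))"

definition gen_nambu_poisson_algebra :: "nat \<Rightarrow> ('k::field, 'a::comm_ring_1) np_struct \<Rightarrow> bool" where
  "gen_nambu_poisson_algebra n N \<longleftrightarrow>
     commutative_algebra N \<and> n_lie_algebra n N \<and>
     (\<forall>as\<in>np_args (n - 1) N. \<forall>b\<in>np_space N. \<forall>c\<in>np_space N.
        np_bracket N (as @ [b * c]) =
          np_bracket N (as @ [b]) * c + b * np_bracket N (as @ [c])
          - np_bracket N (as @ [1]) * b * c)"

definition np_simple :: "nat \<Rightarrow> ('k::field, 'a::comm_ring_1) np_struct \<Rightarrow> bool" where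
  "np_simple n N \<longleftrightarrow>
     (\<exists>xs\<in>np_args n N. np_bracket N xs \<noteq> 0) \<and>
     (\<forall>I. I \<subseteq> np_space N \<and> module.subspace (np_scale N) I \<and>
          (\<forall>a\<in>np_space N. \<forall>x\<in>I. a * x \<in> I) \<and>
          (\<forall>x\<in>I. \<forall>as\<in>np_args (n - 1) N. np_bracket N (x # as) \<in> I)
        \<longrightarrow> I = {0} \<or> I = np_space N)"


subsection \<open>Linear compactness\<close>

text \<open>
  The factors and the index set are taken inside the space itself.  This is no restriction, since a
  factor of a product embeds in the product, and the nontrivial factors can be indexed by nonzero
  vectors chosen from them; the lemma \<open>linearly_compactI\<close> makes this precise.
\<close>
definition linearly_compact ::
  "('k::field \<Rightarrow> 'a::ab_group_add \<Rightarrow> 'a) \<Rightarrow> 'a topology \<Rightarrow> bool" where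
  "linearly_compact sc T \<longleftrightarrow>
     (\<exists>(I :: 'a set) (V :: 'a \<Rightarrow> 'a set) h.
        (\<forall>i\<in>I. \<exists>B. finite B \<and> V i = module.span sc B) \<and>
        homeomorphic_map T (product_topology (\<lambda>i. discrete_topology (V i)) I) h \<and>
        (\<forall>x\<in>topspace T. \<forall>y\<in>topspace T. \<forall>i\<in>I. h (x + y) i = h x i + h y i) \<and>
        (\<forall>c. \<forall>x\<in>topspace T. \<forall>i\<in>I. h (sc c x) i = sc c (h x i)))"

lemma linearly_compactI:
  fixes sc :: "'k::field \<Rightarrow> 'a::ab_group_add \<Rightarrow> 'a"
    and vsc :: "'k \<Rightarrow> 'v::ab_group_add \<Rightarrow> 'v"
    and I :: "'i set" and V :: "'i \<Rightarrow> 'v set"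
  assumes vs: "vector_space sc" and sub: "module.subspace sc (topspace T)"
    and vv: "vector_space vsc"
    and fd: "\<And>i. i \<in> I \<Longrightarrow> \<exists>B. finite B \<and> V i = module.span vsc B"
    and hom: "homeomorphic_map T (product_topology (\<lambda>i. discrete_topology (V i)) I) h"
    and hadd: "\<And>x y i. x \<in> topspace T \<Longrightarrow> y \<in> topspace T \<Longrightarrow> i \<in> I \<Longrightarrow> h (x + y) i = h x i + h y i"
    and scl: "\<And>c x i. x \<in> topspace T \<Longrightarrow> i \<in> I \<Longrightarrow> h (sc c x) i = vsc c (h x i)"
  shows "linearly_compact sc T"
proof -
  interpret A: vector_space sc by (rule vs)
  interpret W: vector_space vsc by (rule vv)
  let ?P = "product_topology (\<lambda>i. discrete_topology (V i)) I"
  let ?X = "topspace T"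
  have subV: "W.subspace (V i)" if "i \<in> I" for i
    using fd[OF that] W.subspace_span by auto
  have V0: "0 \<in> V i" if "i \<in> I" for i
    using subV[OF that] W.subspace_0 by blast
  obtain g where g: "homeomorphic_maps T ?P h g"
    using hom homeomorphic_map_maps by blast
  have tP: "topspace ?P = Pi\<^sub>E I V" by simp
  have gX: "g f \<in> ?X" and hg: "h (g f) = f" if "f \<in> Pi\<^sub>E I V" for f
    using g that by (auto simp: homeomorphic_maps_def continuous_map_def)
  have hX: "h x \<in> Pi\<^sub>E I V" and gh: "g (h x) = x" if "x \<in> ?X" for x
    using g that unfolding homeomorphic_maps_def continuous_map_def by auto
  have X_add: "x + y \<in> ?X" if "x \<in> ?X" "y \<in> ?X" for x y
    using sub that A.subspace_add by blast
  have X_scl: "sc c x \<in> ?X" if "x \<in> ?X" for x c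
    using sub that A.subspace_scale by blast
  define s where "s i v = (\<lambda>k\<in>I. if k = i then v else 0)" for i and v :: 'v
  define e where "e i v = g (s i v)" for i v
  have sP: "s i v \<in> Pi\<^sub>E I V" if "i \<in> I" "v \<in> V i" for i v
    using that V0 by (auto simp: s_def)
  have eX: "e i v \<in> ?X" and he: "h (e i v) = s i v" if "i \<in> I" "v \<in> V i" for i v
    using sP[OF that] gX hg by (auto simp: e_def)
  have hei: "h (e i v) i = v" if "i \<in> I" "v \<in> V i" for i v
    using he[OF that] that by (simp add: s_def)
  have h_inj: "x = y" if "x \<in> ?X" "y \<in> ?X" "\<And>k. k \<in> I \<Longrightarrow> h x k = h y k" for x y
  proof -
    have "h x = h y" using that hX[of x] hX[of y] by (intro PiE_ext[where k = I and s = V]) auto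
    then show ?thesis using gh that by metis
  qed
  have e_add: "e i (v + w) = e i v + e i w" if "i \<in> I" "v \<in> V i" "w \<in> V i" for i v w
  proof (rule h_inj)
    have vw: "v + w \<in> V i" using subV that W.subspace_add by blast
    show "e i (v + w) \<in> ?X" "e i v + e i w \<in> ?X" using eX that vw X_add by auto
    show "h (e i (v + w)) k = h (e i v + e i w) k" if "k \<in> I" for k
      using that \<open>i \<in> I\<close> \<open>v \<in> V i\<close> \<open>w \<in> V i\<close> vw by (simp add: hadd eX he) (simp add: s_def)
  qed
  have e_scl: "e i (vsc c v) = sc c (e i v)" if "i \<in> I" "v \<in> V i" for i v c
  proof (rule h_inj)
    have vw: "vsc c v \<in> V i" using subV that W.subspace_scale by blast
    show "e i (vsc c v) \<in> ?X" "sc c (e i v) \<in> ?X" using eX that vw X_scl by auto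
    show "h (e i (vsc c v)) k = h (sc c (e i v)) k" if "k \<in> I" for k
      using that \<open>i \<in> I\<close> \<open>v \<in> V i\<close> vw by (simp add: scl eX he) (simp add: s_def)
  qed
  have e_0: "e i 0 = 0" if "i \<in> I" for i
    using e_add[OF that V0[OF that] V0[OF that]] by simp
  have span_e: "e i ` W.span B = A.span (e i ` B)" if i: "i \<in> I" and B: "V i = W.span B" for i B
  proof
    have "v \<in> V i \<and> e i v \<in> A.span (e i ` B)" if "v \<in> W.span B" for v
      using that
    proof (induction rule: W.span_induct_alt)
      case base
      then show ?case by (simp add: e_0[OF i] V0[OF i] A.span_zero)
    next
      case (step c x y)
      have x: "x \<in> V i" using step(1) B W.span_base by simp
      then have cx: "vsc c x \<in> V i" using W.subspace_scale[OF subV[OF i]] by blast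
      have y: "y \<in> V i" "e i y \<in> A.span (e i ` B)" using step by auto
      have "vsc c x + y \<in> V i" using W.subspace_add[OF subV[OF i]] cx y by blast
      moreover have "e i (vsc c x + y) = sc c (e i x) + e i y"
        by (simp only: e_add[OF i cx y(1)] e_scl[OF i x])
      moreover have "sc c (e i x) \<in> A.span (e i ` B)"
        using step by (intro A.span_scale A.span_base imageI)
      ultimately show ?case using A.span_add y(2) by simp
    qed
    then show "e i ` W.span B \<subseteq> A.span (e i ` B)" by blast
    have "A.subspace (e i ` V i)"
    proof (rule A.subspaceI)
      show "0 \<in> e i ` V i" using e_0 V0 i by (metis image_eqI)
      show "x + y \<in> e i ` V i" if xy: "x \<in> e i ` V i" "y \<in> e i ` V i" for x y
      proof -
        obtain v w where "v \<in> V i" "w \<in> V i" "x = e i v" "y = e i w" using xy by blast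
        then have "x + y = e i (v + w)" "v + w \<in> V i"
          using e_add[OF i] W.subspace_add[OF subV[OF i]] by auto
        then show ?thesis by blast
      qed
      show "sc c x \<in> e i ` V i" if x: "x \<in> e i ` V i" for c x
      proof -
        obtain v where "v \<in> V i" "x = e i v" using x by blast
        then have "sc c x = e i (vsc c v)" "vsc c v \<in> V i"
          using e_scl[OF i] W.subspace_scale[OF subV[OF i]] by auto
        then show ?thesis by blast
      qed
    qed
    then show "A.span (e i ` B) \<subseteq> e i ` W.span B"
      by (intro A.span_minimal) (auto simp: B intro: W.span_base)
  qed
  define K where "K = {i\<in>I. V i \<noteq> {0}}"
  define v where "v i = (SOME v. v \<in> V i \<and> v \<noteq> 0)" for i
  have v: "v i \<in> V i" "v i \<noteq> 0" if "i \<in> K" for i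
  proof -
    have "\<exists>v. v \<in> V i \<and> v \<noteq> 0" using that V0[of i] by (auto simp: K_def)
    then show "v i \<in> V i" "v i \<noteq> 0" unfolding v_def by (metis (mono_tags, lifting) someI_ex)+
  qed
  define u where "u i = e i (v i)" for i
  have KI: "i \<in> I" if "i \<in> K" for i using that by (simp add: K_def)
  have u_inj: "inj_on u K"
  proof (rule inj_onI)
    fix i k assume ik: "i \<in> K" "k \<in> K" "u i = u k"
    then have "s i (v i) = s k (v k)" using he v KI by (metis u_def)
    then have "s i (v i) i = s k (v k) i" by simp
    then show "i = k" using ik v KI by (auto simp: s_def split: if_splits)
  qed
  define J where "J = u ` K"
  define q where "q = inv_into K u"
  have qK: "q j \<in> K" and uq: "u (q j) = j" if "j \<in> J" for j
    using that by (auto simp: J_def q_def inv_into_into f_inv_into_f)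
  have qI: "q j \<in> I" if "j \<in> J" for j using qK[OF that] KI by blast
  have qu: "q (u i) = i" and uJ: "u i \<in> J" if "i \<in> K" for i
    using that u_inj by (auto simp: q_def J_def)
  define V' where "V' j = e (q j) ` V (q j)" for j
  let ?Q = "product_topology (\<lambda>j. discrete_topology (V' j)) J"
  define m where "m f = (\<lambda>j\<in>J. e (q j) (f (q j)))" for f
  define m' where "m' f = (\<lambda>i\<in>I. if i \<in> K then h (f (u i)) i else 0)" for f
  have m: "homeomorphic_map ?P ?Q m"
  proof (rule homeomorphic_maps_imp_map[of _ _ _ m'])
    have 1: "continuous_map ?P ?Q m"
      unfolding continuous_map_componentwise
    proof (intro conjI ballI)
      show "m ` topspace ?P \<subseteq> extensional J" by (auto simp: m_def)
      fix j assume j: "j \<in> J"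
      have "continuous_map ?P (discrete_topology (V (q j))) (\<lambda>f. f (q j))"
        by (rule continuous_map_product_projection) (rule qI[OF j])
      moreover have "continuous_map (discrete_topology (V (q j))) (discrete_topology (V' j)) (e (q j))"
        by (auto simp: V'_def)
      ultimately have "continuous_map ?P (discrete_topology (V' j)) (e (q j) \<circ> (\<lambda>f. f (q j)))"
        by (rule continuous_map_compose)
      then show "continuous_map ?P (discrete_topology (V' j)) (\<lambda>f. m f j)"
        using j by (simp add: m_def o_def)
    qed
    have 2: "continuous_map ?Q ?P m'"
      unfolding continuous_map_componentwise
    proof (intro conjI ballI)
      show "m' ` topspace ?Q \<subseteq> extensional I" by (auto simp: m'_def)
      fix i assume i: "i \<in> I"
      show "continuous_map ?Q (discrete_topology (V i)) (\<lambda>f. m' f i)"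
      proof (cases "i \<in> K")
        case False
        then show ?thesis using i V0 by (simp add: m'_def)
      next
        case True
        have "continuous_map ?Q (discrete_topology (V' (u i))) (\<lambda>f. f (u i))"
          by (rule continuous_map_product_projection) (rule uJ[OF True])
        moreover have "continuous_map (discrete_topology (V' (u i))) (discrete_topology (V i))
            (\<lambda>x. h x i)"
          using hei i by (auto simp: V'_def qu[OF True])
        ultimately have "continuous_map ?Q (discrete_topology (V i)) ((\<lambda>x. h x i) \<circ> (\<lambda>f. f (u i)))"
          by (rule continuous_map_compose)
        then show ?thesis using i True by (simp add: m'_def o_def)
      qed
    qed
    have 3: "m' (m f) = f" if "f \<in> Pi\<^sub>E I V" for f
    proof (rule extensionalityI)
      show "m' (m f) \<in> extensional I" by (simp add: m'_def)
      show "f \<in> extensional I" using that by (simp add: PiE_iff)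
      fix i assume i: "i \<in> I"
      then have fi: "f i \<in> V i" using that by auto
      show "m' (m f) i = f i"
      proof (cases "i \<in> K")
        case True
        then show ?thesis using i fi by (simp add: m'_def m_def qu uJ hei)
      next
        case False
        then have "f i = 0" using i fi by (auto simp: K_def)
        then show ?thesis using i False by (simp add: m'_def)
      qed
    qed
    have 4: "m (m' f) = f" if f: "f \<in> Pi\<^sub>E J V'" for f
    proof (rule extensionalityI)
      show "m (m' f) \<in> extensional J" by (simp add: m_def)
      show "f \<in> extensional J" using that by (simp add: PiE_iff)
      fix j assume j: "j \<in> J"
      then have "f j \<in> V' j" using f by auto
      then obtain w where w: "w \<in> V (q j)" "f j = e (q j) w" by (auto simp: V'_def)
      then show "m (m' f) j = f j"
        using j qI[OF j] qK[OF j] by (simp add: m'_def m_def uq hei)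
    qed
    show "homeomorphic_maps ?P ?Q m m'"
      using 1 2 3 4 by (simp add: homeomorphic_maps_def)
  qed
  have r1: "homeomorphic_map T ?Q (m \<circ> h)"
    using hom m by (rule homeomorphic_map_compose)
  have r2: "\<exists>B. finite B \<and> V' j = A.span B" if j: "j \<in> J" for j
  proof -
    obtain B where B: "finite B" "V (q j) = W.span B" using fd[OF qI[OF j]] by blast
    then have "V' j = A.span (e (q j) ` B)" using span_e[OF qI[OF j]] by (simp add: V'_def)
    then show ?thesis using B by blast
  qed
  have r3: "(m \<circ> h) (x + y) j = (m \<circ> h) x j + (m \<circ> h) y j"
    if "x \<in> ?X" "y \<in> ?X" "j \<in> J" for x y j
  proof -
    have "h x (q j) \<in> V (q j)" "h y (q j) \<in> V (q j)"
      using that hX qI by (blast dest: PiE_mem)+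
    then show ?thesis using that qI by (simp add: m_def hadd e_add)
  qed
  have r4: "(m \<circ> h) (sc c x) j = sc c ((m \<circ> h) x j)" if "x \<in> ?X" "j \<in> J" for c x j
  proof -
    have "h x (q j) \<in> V (q j)" using that hX qI by (blast dest: PiE_mem)
    then show ?thesis using that qI by (simp add: m_def scl e_scl)
  qed
  show ?thesis
    unfolding linearly_compact_def
    by (intro exI[of _ J] exI[of _ V'] exI[of _ "m \<circ> h"] conjI ballI allI r1 r2 r3 r4)
qed

definition np_linearly_compact :: "nat \<Rightarrow> ('k::field, 'a::comm_ring_1) np_struct \<Rightarrow> bool" where
  "np_linearly_compact n N \<longleftrightarrow>
     topspace (np_topology N) = np_space N \<and>
     linearly_compact (np_scale N) (np_topology N) \<and>
     continuous_map (prod_topology (np_topology N) (np_topology N)) (np_topology N)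
       (\<lambda>(x, y). x * y) \<and>
     continuous_map (product_topology (\<lambda>_. np_topology N) {..<n}) (np_topology N)
       (\<lambda>f. np_bracket N (map f [0..<n]))"


subsection \<open>Isomorphism and gauge equivalence\<close>

text \<open>
  Isomorphisms are required to be homeomorphisms, as is usual for linearly compact algebras;
  the bracket is the only part of the structure changed by a gauge transformation.
\<close>
definition np_isomorphic ::
  "nat \<Rightarrow> ('k::field, 'a::comm_ring_1) np_struct \<Rightarrow> ('k, 'b::comm_ring_1) np_struct \<Rightarrow> bool" where
  "np_isomorphic n M N \<longleftrightarrow>
     (\<exists>h. bij_betw h (np_space M) (np_space N) \<and>
        homeomorphic_map (np_topology M) (np_topology N) h \<and>
        h 1 = 1 \<and>
        (\<forall>x\<in>np_space M. \<forall>y\<in>np_space M. h (x + y) = h x + h y \<and> h (x * y) = h x * h y) \<and>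
        (\<forall>c. \<forall>x\<in>np_space M. h (np_scale M c x) = np_scale N c (h x)) \<and>
        (\<forall>xs\<in>np_args n M. h (np_bracket M xs) = np_bracket N (map h xs)))"

definition np_units :: "('k, 'a::comm_ring_1) np_struct \<Rightarrow> 'a set" where
  "np_units N = {\<phi>\<in>np_space N. \<exists>\<psi>\<in>np_space N. \<phi> * \<psi> = 1}"

definition np_gauge :: "'a::comm_ring_1 \<Rightarrow> ('k, 'a) np_struct \<Rightarrow> ('k, 'a) np_struct" where
  "np_gauge \<phi> N =
     N\<lparr>np_bracket := \<lambda>fs. (THE \<psi>. \<phi> * \<psi> = 1) * np_bracket N (map (\<lambda>f. \<phi> * f) fs)\<rparr>"

definition gauge_equivalent ::
  "nat \<Rightarrow> ('k::field, 'a::comm_ring_1) np_struct \<Rightarrow> ('k, 'b::comm_ring_1) np_struct \<Rightarrow> bool" where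
  "gauge_equivalent n M N \<longleftrightarrow> (\<exists>\<phi>\<in>np_units N. np_isomorphic n M (np_gauge \<phi> N))"


subsection \<open>The two examples\<close>

definition nambu_algebra :: "nat \<Rightarrow> ('k::field, 'k mps) np_struct" where
  "nambu_algebra n = \<lparr>
     np_space = mps_vars n,
     np_scale = mps_scale,
     np_bracket = (\<lambda>fs. Determinant.det (Matrix.mat n n (\<lambda>(i, j). mps_deriv j (fs ! i)))),
     np_topology = mps_topology n\<rparr>"

definition dzhumadildaev_algebra :: "nat \<Rightarrow> ('k::field, 'k mps) np_struct" where
  "dzhumadildaev_algebra n = \<lparr>
     np_space = mps_vars (n - 1),
     np_scale = mps_scale,
     np_bracket = (\<lambda>fs. Determinant.det
       (Matrix.mat n n (\<lambda>(i, j). if i = 0 then fs ! j else mps_deriv (i - 1) (fs ! j)))),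
     np_topology = mps_topology (n - 1)\<rparr>"

end

theory Submission
  imports Defs
begin

text \<open>
  By linear compactness the Fitting idempotents of an element modulo the open ideals lift to the
  algebra \<open>A\<close>.  An idempotent generates a stable ideal, so by simplicity it is \<open>0\<close> or \<open>1\<close>, and \<open>A\<close> is
  local with residue field \<open>\<bbbF>\<close>.

  After a gauge transformation there are nonunits \<open>x\<^sub>1, \<dots>, x\<^bsub>n-1\<^esub>\<close> with \<open>{1, x\<^sub>1, \<dots>, x\<^bsub>n-1\<^esub>} = 1\<close>.
  Put \<open>x\<^sub>0 = 1\<close> and let \<open>d\<^sub>k f\<close> be this bracket with \<open>x\<^sub>k\<close> replaced by \<open>f\<close>.  The second-order symbol of
  the Filippov identity is a relation of Pluecker type; for \<open>n > 2\<close> it shows, together with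
  simplicity, that the bracket is the determinant of the \<open>d\<^sub>k\<close>.  Equivalently, it is
  \<open>(1 + E) \<and> d\<^sub>1 \<and> \<dots> \<and> d\<^bsub>n-1\<^esub>\<close> with \<open>1 + E = \<Sum>k. x\<^sub>k d\<^sub>k\<close> and commuting derivations \<open>E, d\<^sub>1, \<dots>, d\<^bsub>n-1\<^esub>\<close>.

  If \<open>E\<close> takes no unit value then \<open>E = 0\<close>, which is the Dzhumadildaev bracket.  Otherwise there is a
  unit \<open>\<phi>\<close> with \<open>E \<phi> = - \<phi>\<close> and \<open>d\<^sub>i \<phi> = 0\<close>, and the gauge transformation by \<open>\<phi>\<close> yields a wedge product of
  \<open>n\<close> commuting derivations, which is the Nambu bracket.  In both cases Taylor expansion with respect to
  the commuting derivations is injective by simplicity and surjective by completeness.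
\<close>

section \<open>Skew brackets on a subring\<close>

text \<open>No coordinates are available at the outset. By the generalized Leibniz rule each slot of
  the bracket is a first-order operator, but \<open>A\<close> is not yet known to be a power series
  ring, so nothing says that n functions capture all first-order data; the frame elements have to
  play that part. The obstacle is the remainder \<open>R\<close>, the bracket minus the determinant,
  which vanishes on the frame but might survive elsewhere. For n = 2 it does: a symplectic bracket
  in four variables is simple and is no 2 x 2 determinant. For n > 2 two successive symbols can be
  taken, in slots 2 and 1; they leave in slot 0 an operator with value 1 at 1, and this makes the
  resulting relation solvable for \<open>R\<close>.

  All gauge factors come from one device. If a continuous operator \<open>D\<close> satisfies
  \<open>[D, x] = 1\<close> with a nonunit \<open>x\<close>, then \<open>x\<close> is topologically
  nilpotent, and the series of \<open>(- x)^k / k!\<close> times \<open>D^k\<close> maps into the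
  kernel of \<open>D\<close> without changing residues. Each equation for a factor is brought to
  this form, if necessary after division by a unit.\<close>

locale carrier_ring =
  fixes A :: "'a::comm_ring_1 set"
  assumes one_closed [simp, intro]: "1 \<in> A"
    and add_closed [simp, intro]: "x \<in> A \<Longrightarrow> y \<in> A \<Longrightarrow> x + y \<in> A"
    and uminus_closed [simp, intro]: "x \<in> A \<Longrightarrow> - x \<in> A"
    and mult_closed [simp, intro]: "x \<in> A \<Longrightarrow> y \<in> A \<Longrightarrow> x * y \<in> A"
begin

lemma zero_closed [simp, intro]: "0 \<in> A"
  using add_closed[OF one_closed uminus_closed[OF one_closed]] by simp

lemma diff_closed [simp, intro]: "x \<in> A \<Longrightarrow> y \<in> A \<Longrightarrow> x - y \<in> A"
  using add_closed[OF _ uminus_closed] by (metis diff_conv_add_uminus)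

lemma sum_closed [intro]: "(\<And>i. i \<in> S \<Longrightarrow> f i \<in> A) \<Longrightarrow> sum f S \<in> A"
  by (induction S rule: infinite_finite_induct) auto

lemma prod_closed [intro]: "(\<And>i. i \<in> S \<Longrightarrow> f i \<in> A) \<Longrightarrow> prod f S \<in> A"
  by (induction S rule: infinite_finite_induct) auto

lemma power_closed [simp, intro]: "x \<in> A \<Longrightarrow> x ^ k \<in> A"
  by (induction k) auto

lemma of_nat_closed [simp, intro]: "of_nat k \<in> A"
  by (induction k) auto

lemma of_int_sign_closed [simp, intro]: "of_int (sign p) \<in> A"
  by (auto simp: sign_def)

definition ideal :: "'a set \<Rightarrow> bool" where
  "ideal I \<longleftrightarrow> I \<subseteq> A \<and> 0 \<in> I \<and> (\<forall>x\<in>I. \<forall>y\<in>I. x + y \<in> I) \<and> (\<forall>a\<in>A. \<forall>x\<in>I. a * x \<in> I)"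

lemma ideal_subset: "ideal I \<Longrightarrow> x \<in> I \<Longrightarrow> x \<in> A"
  and ideal_zero: "ideal I \<Longrightarrow> 0 \<in> I"
  and ideal_add: "ideal I \<Longrightarrow> x \<in> I \<Longrightarrow> y \<in> I \<Longrightarrow> x + y \<in> I"
  and ideal_mult: "ideal I \<Longrightarrow> a \<in> A \<Longrightarrow> x \<in> I \<Longrightarrow> a * x \<in> I"
  by (auto simp: ideal_def)

lemma ideal_uminus: "ideal I \<Longrightarrow> x \<in> I \<Longrightarrow> - x \<in> I"
  using ideal_mult[of I "-1" x] by auto

lemma ideal_diff: "ideal I \<Longrightarrow> x \<in> I \<Longrightarrow> y \<in> I \<Longrightarrow> x - y \<in> I"
  using ideal_add[of I x "- y"] ideal_uminus[of I y] by simp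

lemma ideal_mult_right: "ideal I \<Longrightarrow> a \<in> A \<Longrightarrow> x \<in> I \<Longrightarrow> x * a \<in> I"
  using ideal_mult[of I a x] by (simp add: mult.commute)

lemma ideal_sum: "ideal I \<Longrightarrow> (\<And>i. i \<in> S \<Longrightarrow> f i \<in> I) \<Longrightarrow> sum f S \<in> I"
  by (induction S rule: infinite_finite_induct) (auto intro: ideal_zero ideal_add)

end

text \<open>
  Brackets are evaluated on functions \<open>g\<close>, of which only \<open>g 0, \<dots>, g (n - 1)\<close> matter;
  an update \<open>g(k := x)\<close> then puts \<open>x\<close> into slot \<open>k\<close>.
\<close>
locale slots = carrier_ring A for A :: "'a::comm_ring_1 set" +
  fixes n :: nat
  assumes torsion_free: "x \<in> A \<Longrightarrow> of_nat (Suc k) * x = 0 \<Longrightarrow> x = 0"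
begin

definition args :: "(nat \<Rightarrow> 'a) \<Rightarrow> bool" where
  "args g \<longleftrightarrow> (\<forall>i<n. g i \<in> A)"

lemma argsD [intro]: "args g \<Longrightarrow> i < n \<Longrightarrow> g i \<in> A"
  by (simp add: args_def)

lemma args_upd [simp, intro]: "args g \<Longrightarrow> x \<in> A \<Longrightarrow> args (g(k := x))"
  by (simp add: args_def)

text \<open>Additivity is left out, because comparing values on rearranged arguments, as in
  \<open>skew_one_free\<close>, only needs signs.\<close>

definition skew :: "((nat \<Rightarrow> 'a) \<Rightarrow> 'a) \<Rightarrow> bool" where
  "skew F \<longleftrightarrow> (\<forall>g h. (\<forall>i<n. g i = h i) \<longrightarrow> F g = F h) \<and> (\<forall>g. args g \<longrightarrow> F g \<in> A) \<and>
     (\<forall>g p. args g \<longrightarrow> p permutes {..<n} \<longrightarrow> F (g \<circ> p) = of_int (sign p) * F g)"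

lemma skew_cong: "skew F \<Longrightarrow> (\<And>i. i < n \<Longrightarrow> g i = h i) \<Longrightarrow> F g = F h"
  by (simp add: skew_def)

lemma skew_closed: "skew F \<Longrightarrow> args g \<Longrightarrow> F g \<in> A"
  by (simp add: skew_def)

lemma skew_perm: "skew F \<Longrightarrow> args g \<Longrightarrow> p permutes {..<n} \<Longrightarrow> F (g \<circ> p) = of_int (sign p) * F g"
  by (simp add: skew_def)

lemma skew_swap:
  assumes "skew F" "args g" "i < n" "j < n" "i \<noteq> j"
  shows "F (g(i := g j, j := g i)) = - F g"
proof -
  have "g(i := g j, j := g i) = g \<circ> Transposition.transpose i j"
    by (auto simp: fun_eq_iff Transposition.transpose_def)
  moreover have "Transposition.transpose i j permutes {..<n}"
    using assms by (intro permutes_swap_id) auto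
  ultimately show ?thesis
    using skew_perm[OF assms(1,2)] assms(5) by (simp add: sign_swap_id)
qed

lemma skew_dup:
  assumes "skew F" "args g" "i < n" "j < n" "i \<noteq> j" "g i = g j"
  shows "F g = 0"
proof -
  have "g(i := g j, j := g i) = g" using assms(6) by auto
  then have "F g = - F g" using skew_swap[OF assms(1-5)] by simp
  \<comment> \<open>Skewness is only a sign rule; equal entries kill the value because 2 can be
    cancelled.\<close>
  then have "of_nat (Suc 1) * F g = 0" by (simp add: eq_neg_iff_add_eq_0)
  then show ?thesis using torsion_free skew_closed assms by blast
qed

lemma skew_diff:
  assumes "skew F" "skew G"
  shows "skew (\<lambda>g. F g - G g)"
  unfolding skew_def
proof (intro conjI allI impI)
  show "F g - G g = F h - G h" if "\<forall>i<n. g i = h i" for g h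
    using skew_cong[OF assms(1), of g h] skew_cong[OF assms(2), of g h] that by simp
  show "F g - G g \<in> A" if "args g" for g
    using skew_closed assms that by auto
  show "F (g \<circ> p) - G (g \<circ> p) = of_int (sign p) * (F g - G g)"
    if "args g" "p permutes {..<n}" for g p
    using skew_perm[OF assms(1) that] skew_perm[OF assms(2) that] by (simp add: right_diff_distrib)
qed

text \<open>Either two frame entries outside slot \<open>k\<close> coincide and both sides vanish,
  or these n - 1 entries miss exactly one index \<open>j\<close> and the arguments are a permutation
  of \<open>e(j := b)\<close>.\<close>

lemma skew_one_free:
  assumes F: "skew F" and G: "skew G" and e: "args e" and b: "b \<in> A"
    and eq: "\<And>j. j < n \<Longrightarrow> F (e(j := b)) = G (e(j := b))"
    and s: "\<And>i. i < n \<Longrightarrow> s i < n" and k: "k < n"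
  shows "F ((e \<circ> s)(k := b)) = G ((e \<circ> s)(k := b))"
proof (cases "inj_on s ({..<n} - {k})")
  case False
  then obtain i j where ij: "i < n" "j < n" "i \<noteq> k" "j \<noteq> k" "i \<noteq> j" "s i = s j"
    by (auto simp: inj_on_def)
  have "args ((e \<circ> s)(k := b))" using e b s by (auto simp: args_def)
  moreover have "((e \<circ> s)(k := b)) i = ((e \<circ> s)(k := b)) j" using ij by simp
  ultimately show ?thesis
    using skew_dup[OF F _ ij(1,2,5)] skew_dup[OF G _ ij(1,2,5)] by presburger
next
  case True
  let ?S = "{..<n} - {k}"
  have "card (s ` ?S) < card {..<n}"
    using card_image[OF True] k by simp
  moreover have "s ` ?S \<subseteq> {..<n}" using s by auto
  ultimately have "s ` ?S \<subset> {..<n}" by auto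
  then obtain j where j: "j < n" "j \<notin> s ` ?S" by blast
  \<comment> \<open>Completes \<open>s\<close> to a permutation by sending the free slot to the
    missing index.\<close>
  define t where "t i = (if i < n then if i = k then j else s i else i)" for i
  have inj: "inj_on t {..<n}"
  proof (rule inj_onI)
    fix x y assume xy: "x \<in> {..<n}" "y \<in> {..<n}" "t x = t y"
    show "x = y"
    proof (cases "x = k \<or> y = k")
      case True
      then show ?thesis using xy j by (auto simp: t_def split: if_splits)
    next
      case False
      then have "s x = s y" using xy by (simp add: t_def)
      then show ?thesis using \<open>inj_on s ?S\<close> xy False by (auto dest: inj_onD)
    qed
  qed
  have "t ` {..<n} \<subseteq> {..<n}" using j s by (auto simp: t_def)
  then have "bij_betw t {..<n} {..<n}"
    using inj by (simp add: bij_betw_def endo_inj_surj)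
  then have t: "t permutes {..<n}"
    by (rule bij_imp_permutes) (simp add: t_def)
  have eqn: "((e \<circ> s)(k := b)) i = ((e(j := b)) \<circ> t) i" if "i < n" for i
    using j that by (auto simp: t_def)
  have "H ((e \<circ> s)(k := b)) = of_int (sign t) * H (e(j := b))" if "skew H" for H
  proof -
    have "H ((e \<circ> s)(k := b)) = H ((e(j := b)) \<circ> t)"
      using eqn by (rule skew_cong[OF that])
    also have "\<dots> = of_int (sign t) * H (e(j := b))"
      by (rule skew_perm[OF that args_upd[OF e b] t])
    finally show ?thesis .
  qed
  from this[OF F] this[OF G] eq[OF j(1)] show ?thesis by presburger
qed

text \<open>The entry in slot 0 is treated as the free one: \<open>e(j := e (s 0))\<close> either
  has a repeated entry or is \<open>e\<close> itself.\<close>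

lemma skew_frame:
  assumes F: "skew F" and G: "skew G" and e: "args e" and eq: "F e = G e"
    and s: "\<And>i. i < n \<Longrightarrow> s i < n"
  shows "F (e \<circ> s) = G (e \<circ> s)"
proof (cases "n = 0")
  case True
  then show ?thesis using skew_cong[OF F, of "e \<circ> s" e] skew_cong[OF G, of "e \<circ> s" e] eq by simp
next
  case False
  then have 0: "0 < n" by simp
  have "(e \<circ> s)(0 := e (s 0)) = e \<circ> s" by auto
  moreover have "F ((e \<circ> s)(0 := e (s 0))) = G ((e \<circ> s)(0 := e (s 0)))"
  proof (rule skew_one_free[OF F G e _ _ s 0])
    show "e (s 0) \<in> A" using argsD[OF e s[OF 0]] .
    fix j assume j: "j < n"
    show "F (e(j := e (s 0))) = G (e(j := e (s 0)))"
    proof (cases "j = s 0")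
      case True
      then have "e(j := e (s 0)) = e" by simp
      then show ?thesis using eq by simp
    next
      case False
      have "args (e(j := e (s 0)))" using e s[OF 0] by auto
      moreover have "(e(j := e (s 0))) j = (e(j := e (s 0))) (s 0)" using False by simp
      ultimately show ?thesis
        using skew_dup[OF F _ j s[OF 0] False] skew_dup[OF G _ j s[OF 0] False] by presburger
    qed
  qed
  ultimately show ?thesis by simp
qed

end

section \<open>Filippov brackets with the generalized Leibniz rule\<close>

locale filippov = slots A n for A :: "'a::comm_ring_1 set" and n +
  fixes B :: "(nat \<Rightarrow> 'a) \<Rightarrow> 'a"
  assumes n_gt_2: "2 < n"
    and skew_B: "skew B"
    and B_add: "args g \<Longrightarrow> k < n \<Longrightarrow> x \<in> A \<Longrightarrow> y \<in> A \<Longrightarrow>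
      B (g(k := x + y)) = B (g(k := x)) + B (g(k := y))"
    and B_leibniz: "args g \<Longrightarrow> k < n \<Longrightarrow> x \<in> A \<Longrightarrow> y \<in> A \<Longrightarrow>
      B (g(k := x * y)) = B (g(k := x)) * y + x * B (g(k := y)) - B (g(k := 1)) * x * y"
    and B_jacobi: "args g \<Longrightarrow> args h \<Longrightarrow> k < n \<Longrightarrow>
      B (g(k := B h)) = (\<Sum>j<n. B (h(j := B (g(k := h j)))))"
begin

lemma B_closed [simp, intro]: "args g \<Longrightarrow> B g \<in> A"
  using skew_B by (rule skew_closed)

lemma B_zero: "args g \<Longrightarrow> k < n \<Longrightarrow> B (g(k := 0)) = 0"
  using B_add[of g k 0 0] by simp

lemma B_uminus: "args g \<Longrightarrow> k < n \<Longrightarrow> x \<in> A \<Longrightarrow> B (g(k := - x)) = - B (g(k := x))"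
  using B_add[of g k x "- x"] B_zero[of g k] by (simp add: eq_neg_iff_add_eq_0 add.commute)

lemma B_diff: "args g \<Longrightarrow> k < n \<Longrightarrow> x \<in> A \<Longrightarrow> y \<in> A \<Longrightarrow>
    B (g(k := x - y)) = B (g(k := x)) - B (g(k := y))"
  using B_add[of g k x "- y"] B_uminus[of g k y] by simp

lemma B_sum: "args g \<Longrightarrow> k < n \<Longrightarrow> (\<And>i. i \<in> S \<Longrightarrow> f i \<in> A) \<Longrightarrow>
    B (g(k := sum f S)) = (\<Sum>i\<in>S. B (g(k := f i)))"
proof (induction S rule: infinite_finite_induct)
  case (insert x F)
  have "sum f F \<in> A" "f x \<in> A" using insert.prems by (auto intro!: sum_closed)
  then have "B (g(k := f x + sum f F)) = B (g(k := f x)) + B (g(k := sum f F))"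
    using insert.prems by (simp only: B_add)
  moreover have "B (g(k := sum f F)) = (\<Sum>i\<in>F. B (g(k := f i)))"
    using insert.IH insert.prems by blast
  ultimately show ?case by (simp only: sum.insert[OF insert.hyps])
qed (auto simp: B_zero)

text \<open>
  The second-order symbol of the Filippov identity: apply it to \<open>b * c\<close>, \<open>b\<close>, \<open>c\<close> and \<open>1\<close> in
  slot \<open>p\<close>, and cancel.
\<close>
lemma symbol_identity:
  assumes g: "args g" and h: "args h" and pq: "p < n" "q < n" "p \<noteq> q" and b: "b \<in> A" and c: "c \<in> A"
  shows "(\<Sum>k<n.
      (B (g(p := c, q := h k)) - c * B (g(p := 1, q := h k))) * (B (h(k := b)) - b * B (h(k := 1)))
    + (B (g(p := b, q := h k)) - b * B (g(p := 1, q := h k))) * (B (h(k := c)) - c * B (h(k := 1)))) = 0"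
    (is "(\<Sum>k<n. ?X k) = 0")
proof -
  define L where "L u v = B (g(p := u, q := v))" for u v
  have L_cl: "L u v \<in> A" if "u \<in> A" "v \<in> A" for u v using that g by (simp add: L_def)
  have hk: "h k \<in> A" if "k < n" for k using h that by blast
  have L_eq: "L u v = B ((g(q := v))(p := u))" for u v
    using pq by (simp add: L_def fun_upd_twist)
  have Lbc: "L (b * c) v = b * L c v + c * L b v - b * c * L 1 v" if "v \<in> A" for v
    unfolding L_eq using B_leibniz[of "g(q := v)" p b c] that g pq b c
    by (simp add: algebra_simps)
  have jac: "L u (B h) = (\<Sum>k<n. B (h(k := L u (h k))))" if "u \<in> A" for u
    unfolding L_def using B_jacobi[of "g(p := u)" h q] that g h pq by simp
  \<comment> \<open>Leibniz in slot \<open>p\<close> of the inner bracket, then in slot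
    \<open>k\<close> of the outer one. The terms other than \<open>?X k\<close> reassemble to the
    Leibniz expansion of the left-hand side, so the \<open>?X k\<close> must sum to 0.\<close>
  have step: "B (h(k := L (b * c) (h k)))
      = b * B (h(k := L c (h k))) + c * B (h(k := L b (h k))) - b * c * B (h(k := L 1 (h k))) + ?X k"
    if k: "k < n" for k
  proof -
    define u v t where "u = L c (h k)" and "v = L b (h k)" and "t = L 1 (h k)"
    have uvt: "u \<in> A" "v \<in> A" "t \<in> A" unfolding u_def v_def t_def using L_cl hk k b c by auto
    have "L (b * c) (h k) = (b * u + c * v) - (b * c) * t"
      using Lbc[OF hk[OF k]] by (simp add: u_def v_def t_def)
    then have 0: "B (h(k := L (b * c) (h k)))
        = B (h(k := b * u)) + B (h(k := c * v)) - B (h(k := (b * c) * t))"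
      using h k b c uvt by (simp add: B_add B_diff)
    have 1: "B (h(k := b * u)) = B (h(k := b)) * u + b * B (h(k := u)) - B (h(k := 1)) * b * u"
      "B (h(k := c * v)) = B (h(k := c)) * v + c * B (h(k := v)) - B (h(k := 1)) * c * v"
      "B (h(k := (b * c) * t))
        = B (h(k := b * c)) * t + (b * c) * B (h(k := t)) - B (h(k := 1)) * (b * c) * t"
      "B (h(k := b * c)) = B (h(k := b)) * c + b * B (h(k := c)) - B (h(k := 1)) * b * c"
      by (rule B_leibniz; use h k b c uvt in simp)+
    have "?X k = (u - c * t) * (B (h(k := b)) - b * B (h(k := 1)))
      + (v - b * t) * (B (h(k := c)) - c * B (h(k := 1)))"
      by (simp add: u_def v_def t_def L_def)
    then show ?thesis
      unfolding u_def[symmetric] v_def[symmetric] t_def[symmetric] 0 1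
      by (simp add: algebra_simps)
  qed
  have "L (b * c) (B h) = (\<Sum>k<n. B (h(k := L (b * c) (h k))))" using jac b c by simp
  also have "\<dots> = (\<Sum>k<n. b * B (h(k := L c (h k))) + c * B (h(k := L b (h k)))
      - b * c * B (h(k := L 1 (h k))) + ?X k)"
    using step by simp
  also have "\<dots> = b * L c (B h) + c * L b (B h) - b * c * L 1 (B h) + (\<Sum>k<n. ?X k)"
    by (simp add: jac b c sum.distrib sum_subtractf sum_distrib_left)
  finally show ?thesis using Lbc[OF B_closed[OF h]] by simp
qed

end

section \<open>Frames, jets and determinants\<close>

text \<open>Arguments index the rows and operators the columns, as in \<open>nambu_algebra\<close>;
  the matrix in \<open>dzhumadildaev_algebra\<close> is the transpose.\<close>

definition det_op :: "nat \<Rightarrow> (nat \<Rightarrow> 'a \<Rightarrow> 'a) \<Rightarrow> (nat \<Rightarrow> 'a) \<Rightarrow> 'a::comm_ring_1" where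
  "det_op n F g = Determinant.det (Matrix.mat n n (\<lambda>(i, j). F j (g i)))"

lemma det_op_sum:
  "det_op n F g = (\<Sum>s | s permutes {..<n}. of_int (sign s) * (\<Prod>i<n. F (s i) (g i)))"
proof -
  have "det_op n F g = (\<Sum>s | s permutes {0..<n}. of_int (sign s) *
      (\<Prod>i = 0..<n. Matrix.mat n n (\<lambda>(i, j). F j (g i)) $$ (i, s i)))"
    unfolding det_op_def by (subst det_def'[of _ n]) auto
  also have "\<dots> = (\<Sum>s | s permutes {0..<n}. of_int (sign s) * (\<Prod>i = 0..<n. F (s i) (g i)))"
  proof (rule sum.cong[OF refl])
    fix s assume "s \<in> {s. s permutes {0..<n}}"
    then have "s i < n" if "i < n" for i
      using permutes_in_image[of s "{0..<n}" i] that by auto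
    then show "of_int (sign s) * (\<Prod>i = 0..<n. Matrix.mat n n (\<lambda>(i, j). F j (g i)) $$ (i, s i)) =
        of_int (sign s) * (\<Prod>i = 0..<n. F (s i) (g i))"
      by simp
  qed
  finally show ?thesis by (simp add: atLeast0LessThan)
qed

lemma det_op_cong:
  assumes "\<And>i j. i < n \<Longrightarrow> j < n \<Longrightarrow> F j (g i) = F' j (h i)"
  shows "det_op n F g = det_op n F' h"
  unfolding det_op_def by (intro arg_cong[of _ _ Determinant.det] eq_matI) (use assms in auto)

lemma det_op_permute:
  assumes "s permutes {..<n}"
  shows "det_op n F (g \<circ> s) = of_int (sign s) * det_op n F g"
proof -
  have s: "s permutes {0..<n}" using assms by (simp add: atLeast0LessThan)
  have "s i < n" if "i < n" for i using permutes_in_image[OF s, of i] that by auto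
  then have "Matrix.mat n n (\<lambda>(i, j). F j ((g \<circ> s) i))
      = Matrix.mat n n (\<lambda>(i, j). Matrix.mat n n (\<lambda>(i, j). F j (g i)) $$ (s i, j))"
    by (intro eq_matI) auto
  then show ?thesis
    unfolding det_op_def using det_permute_rows[OF mat_carrier s] by simp
qed

text \<open>Isolates the dependence on one argument: the second factor of each term does not involve
  \<open>f\<close>.\<close>

lemma det_op_upd:
  assumes p: "p < n"
  shows "det_op n F (g(p := f)) =
    (\<Sum>s | s permutes {..<n}. F (s p) f * (of_int (sign s) * (\<Prod>i\<in>{..<n} - {p}. F (s i) (g i))))"
proof -
  have "(\<Prod>i<n. F (s i) ((g(p := f)) i)) = F (s p) f * (\<Prod>i\<in>{..<n} - {p}. F (s i) (g i))" for s
    by (subst prod.remove[of _ p]) (use p in auto)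
  then show ?thesis by (simp add: det_op_sum mult_ac)
qed

section \<open>Frames, their operators, and dependence on 1-jets\<close>

locale nambu_frame = filippov A n B for A :: "'a::comm_ring_1 set" and n B +
  fixes e :: "nat \<Rightarrow> 'a"
  assumes args_e: "args e" and e_0: "e 0 = 1" and B_e: "B e = 1"
begin

definition d :: "nat \<Rightarrow> 'a \<Rightarrow> 'a" where
  "d k f = B (e(k := f))"

lemma e_closed [simp, intro]: "k < n \<Longrightarrow> e k \<in> A"
  using args_e by blast

lemma n_pos [simp]: "0 < n" "Suc 0 < n" "2 < n"
  using n_gt_2 by auto

lemma d_closed [simp, intro]: "f \<in> A \<Longrightarrow> d k f \<in> A"
  unfolding d_def by (intro B_closed args_upd args_e)

lemma d_add: "k < n \<Longrightarrow> x \<in> A \<Longrightarrow> y \<in> A \<Longrightarrow> d k (x + y) = d k x + d k y"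
  and d_diff: "k < n \<Longrightarrow> x \<in> A \<Longrightarrow> y \<in> A \<Longrightarrow> d k (x - y) = d k x - d k y"
  and d_zero [simp]: "k < n \<Longrightarrow> d k 0 = 0"
  and d_sum: "k < n \<Longrightarrow> (\<And>i. i \<in> S \<Longrightarrow> \<phi> i \<in> A) \<Longrightarrow> d k (sum \<phi> S) = (\<Sum>i\<in>S. d k (\<phi> i))"
  unfolding d_def by (auto simp: B_add B_diff B_zero B_sum args_e)

lemma d_e: "j < n \<Longrightarrow> k < n \<Longrightarrow> d k (e j) = (if j = k then 1 else 0)"
proof (cases "j = k")
  case False
  assume jk: "j < n" "k < n"
  have "(e(k := e j)) j = (e(k := e j)) k" using False by simp
  then have "B (e(k := e j)) = 0"
    using skew_dup[OF skew_B args_upd[OF args_e e_closed[OF jk(1)]] jk False] by blast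
  then show ?thesis using False by (simp add: d_def)
qed (simp add: d_def B_e)

lemma d_1: "k < n \<Longrightarrow> d k 1 = (if k = 0 then 1 else 0)"
  using d_e[of 0 k] by (auto simp: e_0)

lemma d_mult: "k < n \<Longrightarrow> x \<in> A \<Longrightarrow> y \<in> A \<Longrightarrow> d k (x * y) = d k x * y + x * d k y - d k 1 * x * y"
  unfolding d_def by (rule B_leibniz[OF args_e])

lemma d_deriv: "0 < k \<Longrightarrow> k < n \<Longrightarrow> x \<in> A \<Longrightarrow> y \<in> A \<Longrightarrow> d k (x * y) = d k x * y + x * d k y"
  using d_mult[of k x y] by (simp add: d_1)

lemma d_jacobi: "k < n \<Longrightarrow> args h \<Longrightarrow> d k (B h) = (\<Sum>j<n. B (h(j := d k (h j))))"
  unfolding d_def by (rule B_jacobi[OF args_e])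

text \<open>In the Filippov identity for \<open>B (e(k := f))\<close> the operator
  \<open>d i\<close> sends frame entries to 0 or 1, so besides \<open>l = k\<close> only
  \<open>l = i\<close> survives. Its entry 1 in slot \<open>i\<close> duplicates
  \<open>e 0 = 1\<close> unless \<open>i\<close> or \<open>k\<close> is 0.\<close>

lemma d_commutator:
  assumes i: "i < n" and k: "k < n" and f: "f \<in> A"
  shows "d i (d k f) = d k (d i f) + (if i = 0 then d k f else 0) - (if k = 0 then d i f else 0)"
proof -
  have "d i (d k f) = (\<Sum>l<n. B ((e(k := f))(l := d i ((e(k := f)) l))))"
    unfolding d_def[of k] by (rule d_jacobi[OF i args_upd[OF args_e f]])
  also have "\<dots> = B (e(k := d i f)) + (\<Sum>l\<in>{..<n} - {k}. B ((e(k := f))(l := d i ((e(k := f)) l))))"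
    by (subst sum.remove[of _ k]) (use k in auto)
  also have "(\<Sum>l\<in>{..<n} - {k}. B ((e(k := f))(l := d i ((e(k := f)) l)))) =
      (\<Sum>l\<in>{..<n} - {k}. if l = i then B (e(k := f, i := 1)) else 0)"
  proof (rule sum.cong[OF refl])
    fix l assume l: "l \<in> {..<n} - {k}"
    then have "d i ((e(k := f)) l) = (if l = i then 1 else 0)" using i by (simp add: d_e)
    then show "B ((e(k := f))(l := d i ((e(k := f)) l))) = (if l = i then B (e(k := f, i := 1)) else 0)"
      using B_zero[OF args_upd[OF args_e f], of l k] l by auto
  qed
  also have "\<dots> = (if i \<noteq> k then B (e(k := f, i := 1)) else 0)"
    using i by (simp add: sum.delta)
  also have "B (e(k := d i f)) = d k (d i f)" by (rule d_def[symmetric])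
  finally have 1: "d i (d k f) = d k (d i f) + (if i \<noteq> k then B (e(k := f, i := 1)) else 0)" .
  consider "i = k" | "i \<noteq> k" "i = 0" | "i \<noteq> k" "k = 0" | "i \<noteq> k" "i \<noteq> 0" "k \<noteq> 0" by blast
  then show ?thesis
  proof cases
    case 2
    then have "e(k := f, i := 1) = e(k := f)" using e_0 by auto
    then show ?thesis using 1 2 by (simp add: d_def)
  next
    case 3
    have "(e(i := f))(i := (e(i := f)) k, k := (e(i := f)) i) = e(k := f, i := 1)"
      using 3 e_0 by (auto simp: fun_eq_iff)
    then have "B (e(k := f, i := 1)) = - d i f"
      using skew_swap[OF skew_B args_upd[OF args_e f] i k 3(1), of i] by (simp only: d_def)
    then show ?thesis using 1 3 by simp
  next
    case 4
    have "(e(k := f, i := 1)) 0 = (e(k := f, i := 1)) i" using 4 e_0 by simp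
    moreover have "args (e(k := f, i := 1))" using args_e f by auto
    moreover have "0 \<noteq> i" using 4 by simp
    ultimately have "B (e(k := f, i := 1)) = 0"
      using skew_dup[OF skew_B _ n_pos(1) i, of "e(k := f, i := 1)"] by blast
    then show ?thesis using 1 4 by simp
  qed (use 1 in simp)
qed

text \<open>The values \<open>d 0 f, \<dots>, d (n - 1) f\<close> serve as coordinates of the 1-jet of \<open>f\<close>.\<close>
definition jet :: "((nat \<Rightarrow> 'a) \<Rightarrow> 'a) \<Rightarrow> nat \<Rightarrow> bool" where
  "jet F p \<longleftrightarrow> (\<forall>g f. args g \<longrightarrow> f \<in> A \<longrightarrow> F (g(p := f)) = (\<Sum>k<n. d k f * F (g(p := e k))))"

lemma jetD: "jet F p \<Longrightarrow> args g \<Longrightarrow> f \<in> A \<Longrightarrow> F (g(p := f)) = (\<Sum>k<n. d k f * F (g(p := e k)))"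
  by (simp add: jet_def)

lemma jet_diff: "jet F p \<Longrightarrow> jet G p \<Longrightarrow> jet (\<lambda>g. F g - G g) p"
  unfolding jet_def by (simp add: right_diff_distrib sum_subtractf)

text \<open>Expanding the slots in \<open>S\<close> one after another in the frame turns
  \<open>F g\<close> into a combination of values with frame entries in \<open>S\<close>.\<close>

lemma jet_zero:
  assumes "finite S" "S \<subseteq> {..<n}" "args g" "\<And>p. p \<in> S \<Longrightarrow> jet F p"
    and "\<And>h. args h \<Longrightarrow> (\<forall>p\<in>S. h p \<in> e ` {..<n}) \<Longrightarrow> (\<forall>i. i \<notin> S \<longrightarrow> h i = g i) \<Longrightarrow> F h = 0"
  shows "F g = 0"
  using assms
proof (induction S arbitrary: g rule: finite_induct)
  case empty
  show ?case by (rule empty.prems(4)) (use empty.prems in auto)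
next
  case (insert p S)
  have p: "p < n" using insert.prems by simp
  have gp: "g p \<in> A" using insert.prems(2) p by blast
  have "F (g(p := e k)) = 0" if k: "k < n" for k
  proof (rule insert.IH)
    show "S \<subseteq> {..<n}" using insert.prems by simp
    show "args (g(p := e k))" using insert.prems(2) k by auto
    show "jet F q" if "q \<in> S" for q using that insert.prems by simp
    fix h assume h: "args h" "\<forall>q\<in>S. h q \<in> e ` {..<n}" "\<forall>i. i \<notin> S \<longrightarrow> h i = (g(p := e k)) i"
    have "h p = e k" using h(3) insert.hyps by simp
    then show "F h = 0" using insert.prems(4)[of h] h k by auto
  qed
  then have "(\<Sum>k<n. d k (g p) * F (g(p := e k))) = 0"
    by (intro sum.neutral) simp
  then have "F (g(p := g p)) = 0"
    using jetD[OF insert.prems(3)[OF insertI1] insert.prems(2) gp] by presburger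
  then show ?case by simp
qed

lemma frame_choice:
  assumes "\<forall>i<n. h i \<in> e ` {..<n}"
  obtains s where "\<And>i. i < n \<Longrightarrow> s i < n" "\<And>i. i < n \<Longrightarrow> h i = (e \<circ> s) i"
proof -
  have "\<forall>i\<in>{..<n}. \<exists>j. j < n \<and> h i = e j" using assms by auto
  then obtain s where "\<forall>i\<in>{..<n}. s i < n \<and> h i = e (s i)" by metis
  then show thesis using that by (auto simp: comp_def)
qed

text \<open>Expansion reduces the difference to arrangements of the frame, and skewness reduces
  these to \<open>e\<close>.\<close>

lemma skew_jet_unique:
  assumes F: "skew F" "\<And>p. p < n \<Longrightarrow> jet F p" and G: "skew G" "\<And>p. p < n \<Longrightarrow> jet G p"
    and eq: "F e = G e" and g: "args g"
  shows "F g = G g"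
proof -
  have "F g - G g = 0"
  proof (rule jet_zero[where S = "{..<n}" and F = "\<lambda>g. F g - G g"])
    show "jet (\<lambda>g. F g - G g) p" if "p \<in> {..<n}" for p using that F G by (auto intro: jet_diff)
    fix h assume "args h" "\<forall>p\<in>{..<n}. h p \<in> e ` {..<n}"
    then obtain s where s: "\<And>i. i < n \<Longrightarrow> s i < n" "\<And>i. i < n \<Longrightarrow> h i = (e \<circ> s) i"
      using frame_choice[of h] by auto
    then show "F h - G h = 0"
      using skew_cong[OF F(1) s(2)] skew_cong[OF G(1) s(2)] skew_frame[OF F(1) G(1) args_e eq s(1)]
      by simp
  qed (use g in auto)
  then show ?thesis by simp
qed

lemma det_op_skew:
  assumes "\<And>i f. i < n \<Longrightarrow> f \<in> A \<Longrightarrow> F i f \<in> A"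
  shows "skew (det_op n F)"
  unfolding skew_def
proof (intro conjI allI impI)
  show "det_op n F g = det_op n F h" if "\<forall>i<n. g i = h i" for g h
    using that by (intro det_op_cong) auto
  show "det_op n F g \<in> A" if "args g" for g
    unfolding det_op_sum
  proof (rule sum_closed)
    fix s assume "s \<in> {s. s permutes {..<n}}"
    then have "s i < n" if "i < n" for i
      using permutes_in_image[of s "{..<n}" i] that by auto
    then show "of_int (sign s) * (\<Prod>i<n. F (s i) (g i)) \<in> A"
      using argsD[OF \<open>args g\<close>] by (intro mult_closed prod_closed assms) auto
  qed
  show "det_op n F (g \<circ> p) = of_int (sign p) * det_op n F g" if "p permutes {..<n}" for g p
    using that by (rule det_op_permute)
qed

lemma det_op_jet:
  assumes F: "\<And>i f. i < n \<Longrightarrow> f \<in> A \<Longrightarrow> F i f = (\<Sum>k<n. d k f * F i (e k))" and p: "p < n"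
  shows "jet (det_op n F) p"
  unfolding jet_def
proof (intro allI impI)
  fix g f assume "args g" and f: "f \<in> A"
  let ?R = "\<lambda>s. of_int (sign s) * (\<Prod>i\<in>{..<n} - {p}. F (s i) (g i))"
  have sp: "s p < n" if "s permutes {..<n}" for s
    using permutes_in_image[OF that, of p] p by auto
  have "det_op n F (g(p := f)) = (\<Sum>s | s permutes {..<n}. F (s p) f * ?R s)"
    by (rule det_op_upd[OF p])
  also have "\<dots> = (\<Sum>s | s permutes {..<n}. \<Sum>k<n. d k f * (F (s p) (e k) * ?R s))"
  proof (rule sum.cong[OF refl])
    fix s assume "s \<in> {s. s permutes {..<n}}"
    then have "F (s p) f = (\<Sum>k<n. d k f * F (s p) (e k))" using F[OF sp f] by blast
    then show "F (s p) f * ?R s = (\<Sum>k<n. d k f * (F (s p) (e k) * ?R s))"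
      by (simp only: sum_distrib_right mult.assoc)
  qed
  also have "\<dots> = (\<Sum>k<n. d k f * det_op n F (g(p := e k)))"
    unfolding det_op_upd[OF p] by (subst sum.swap) (simp add: sum_distrib_left)
  finally show "det_op n F (g(p := f)) = (\<Sum>k<n. d k f * det_op n F (g(p := e k)))" .
qed

definition D :: "(nat \<Rightarrow> 'a) \<Rightarrow> 'a" where
  "D = det_op n d"

lemma skew_D: "skew D"
  unfolding D_def by (rule det_op_skew) auto

lemma sum_d_delta: "k < n \<Longrightarrow> (\<Sum>j<n. x j * d k (e j)) = x k"
  by (simp add: d_e if_distrib cong: if_cong) 

lemma jet_D: "p < n \<Longrightarrow> jet D p"
  unfolding D_def by (rule det_op_jet) (simp_all add: sum_d_delta)

lemma D_e: "D e = 1"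
proof -
  have "Matrix.mat n n (\<lambda>(i, j). d j (e i)) = 1\<^sub>m n"
    by (intro eq_matI) (auto simp: d_e)
  then show ?thesis by (simp add: D_def det_op_def)
qed

lemma D_closed [simp, intro]: "args g \<Longrightarrow> D g \<in> A"
  using skew_D by (rule skew_closed)

lemma D_e_upd:
  assumes j: "j < n" and f: "f \<in> A"
  shows "D (e(j := f)) = d j f"
proof -
  have "D (e(j := e k)) = (if k = j then 1 else 0)" if k: "k < n" for k
  proof (cases "k = j")
    case False
    then have "(e(j := e k)) j = (e(j := e k)) k" by simp
    then have "D (e(j := e k)) = 0"
      using skew_dup[OF skew_D args_upd[OF args_e e_closed[OF k]] j k] False by blast
    then show ?thesis using False by simp
  qed (simp add: D_e)
  then have "(\<Sum>k<n. d k f * D (e(j := e k))) = (\<Sum>k<n. if k = j then d k f else 0)"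
    by (intro sum.cong) simp_all
  then have "(\<Sum>k<n. d k f * D (e(j := e k))) = d j f" using j by simp
  then show ?thesis using jetD[OF jet_D[OF j] args_e f] by simp
qed

section \<open>The remainder of the bracket beyond its determinantal part\<close>

definition R :: "(nat \<Rightarrow> 'a) \<Rightarrow> 'a" where
  "R g = B g - D g"

lemma skew_R: "skew R"
  unfolding R_def by (rule skew_diff[OF skew_B skew_D])

lemma R_closed [simp, intro]: "args g \<Longrightarrow> R g \<in> A"
  using skew_R by (rule skew_closed)

text \<open>\<open>B\<close> and \<open>D\<close> both have the value \<open>d j f\<close> at
  \<open>e(j := f)\<close>, and \<open>skew_one_free\<close> spreads this to all
  arrangements.\<close>

lemma R_frame_upd:
  assumes s: "\<And>i. i < n \<Longrightarrow> s i < n" and k: "k < n" and f: "f \<in> A"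
  shows "R ((e \<circ> s)(k := f)) = 0"
  using skew_one_free[OF skew_B skew_D args_e f _ s k] by (simp add: R_def D_e_upd f d_def)

lemma R_frame: "(\<And>i. i < n \<Longrightarrow> s i < n) \<Longrightarrow> R (e \<circ> s) = 0"
  using R_frame_upd[of s 0 "(e \<circ> s) 0"] by (simp add: fun_upd_idem)

text \<open>The symbol of \<open>F\<close> in slot \<open>q\<close> at \<open>e i\<close>: the
  commutator of \<open>F\<close> with multiplication by \<open>e i\<close>, applied to 1.\<close>

definition slot_defect :: "((nat \<Rightarrow> 'a) \<Rightarrow> 'a) \<Rightarrow> nat \<Rightarrow> nat \<Rightarrow> (nat \<Rightarrow> 'a) \<Rightarrow> 'a" where
  "slot_defect F i q g = F (g(q := e i)) - e i * F (g(q := 1))"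

lemma jet_slot_defect_D:
  assumes "p < n" "q < n" "i < n" "p \<noteq> q"
  shows "jet (slot_defect D i q) p"
  unfolding jet_def
proof (intro allI impI)
  fix g f assume g: "args g" and f: "f \<in> A"
  have tw: "g(p := x, q := y) = g(q := y, p := x)" for x y using assms(4) by (rule fun_upd_twist)
  have "D (g(p := f, q := y)) = (\<Sum>k<n. d k f * D (g(p := e k, q := y)))" if "y \<in> A" for y
    unfolding tw by (rule jetD[OF jet_D[OF assms(1)] args_upd[OF g that] f])
  from this[OF e_closed[OF assms(3)]] this[OF one_closed]
  show "slot_defect D i q (g(p := f)) = (\<Sum>k<n. d k f * slot_defect D i q (g(p := e k)))"
    unfolding slot_defect_def by (simp add: right_diff_distrib sum_subtractf sum_distrib_left mult_ac)
qed

text \<open>This is the symbol identity with \<open>h = e\<close>, \<open>b = f\<close>,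
  \<open>c = e i\<close>. On the frame the factors \<open>d k 1\<close> and \<open>d k (e i)\<close>
  are 0 or 1, and the surviving terms express the defect at \<open>f\<close> by its values at the
  frame.\<close>

lemma jet_slot_defect_B:
  assumes p: "p < n" and q: "q < n" and i: "i < n" "i \<noteq> 0" and pq: "p \<noteq> q"
  shows "jet (slot_defect B i q) p"
  unfolding jet_def
proof (intro allI impI)
  fix g f assume g: "args g" and f: "f \<in> A"
  define L where "L u v = B (g(p := u, q := v))" for u v
  have L_swap: "L v u = - L u v" if "u \<in> A" "v \<in> A" for u v
  proof -
    let ?g = "g(p := u, q := v)"
    have "?g(p := ?g q, q := ?g p) = g(p := v, q := u)" using pq by (auto simp: fun_eq_iff)
    moreover have "args ?g" using g that by simp
    ultimately show ?thesis using skew_swap[OF skew_B _ p q pq, of ?g] by (simp only: L_def)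
  qed
  have ei: "e i \<in> A" using i by simp
  have "L 1 1 = - L 1 1" by (rule L_swap) auto
  then have "of_nat (Suc 1) * L 1 1 = 0" by (simp add: eq_neg_iff_add_eq_0)
  then have L11: "L 1 1 = 0" using torsion_free[of "L 1 1" 1] g by (auto simp: L_def)
  have "0 = (\<Sum>k<n. (L (e i) (e k) - e i * L 1 (e k)) * (d k f - f * d k 1)
      + (L f (e k) - f * L 1 (e k)) * (d k (e i) - e i * d k 1))"
    unfolding L_def d_def using symbol_identity[OF g args_e p q pq f ei] by simp
  also have "\<dots> = (\<Sum>k<n. (L (e i) (e k) - e i * L 1 (e k)) * d k f)
      - (\<Sum>k<n. if k = 0 then (L (e i) (e k) - e i * L 1 (e k)) * f else 0)
      + (\<Sum>k<n. if k = i then L f (e k) - f * L 1 (e k) else 0)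
      - (\<Sum>k<n. if k = 0 then (L f (e k) - f * L 1 (e k)) * e i else 0)"
    unfolding sum.distrib[symmetric] sum_subtractf[symmetric]
    by (rule sum.cong[OF refl]) (use i in \<open>auto simp: d_1 d_e algebra_simps\<close>)
  also have "\<dots> = (\<Sum>k<n. (L (e i) (e k) - e i * L 1 (e k)) * d k f)
      - (L (e i) 1 - e i * L 1 1) * f + (L f (e i) - f * L 1 (e i)) - (L f 1 - f * L 1 1) * e i"
    using i by (simp add: e_0)
  also have "\<dots> = (\<Sum>k<n. (L (e i) (e k) - e i * L 1 (e k)) * d k f) + L f (e i) - e i * L f 1"
    unfolding L11 L_swap[OF ei one_closed] by (simp only: algebra_simps) simp
  also have "(\<Sum>k<n. (L (e i) (e k) - e i * L 1 (e k)) * d k f)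
      = - (\<Sum>k<n. d k f * (L (e k) (e i) - e i * L (e k) 1))"
    unfolding sum_negf[symmetric]
  proof (rule sum.cong[OF refl])
    fix k assume "k \<in> {..<n}"
    then have k: "e k \<in> A" by simp
    show "(L (e i) (e k) - e i * L 1 (e k)) * d k f = - (d k f * (L (e k) (e i) - e i * L (e k) 1))"
      unfolding L_swap[OF k ei] L_swap[OF k one_closed] by (simp add: algebra_simps)
  qed
  finally have "L f (e i) - e i * L f 1 = (\<Sum>k<n. d k f * (L (e k) (e i) - e i * L (e k) 1))"
    by (simp add: algebra_simps)
  then show "slot_defect B i q (g(p := f)) = (\<Sum>k<n. d k f * slot_defect B i q (g(p := e k)))"
    by (simp add: slot_defect_def L_def)
qed

text \<open>The symbols of \<open>B\<close> and \<open>D\<close> at \<open>e i\<close> depend only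
  on 1-jets in the other slots, and they agree once those slots hold frame elements.\<close>

lemma slot_defect_R:
  assumes g: "args g" and q: "q < n" and i: "i < n" "i \<noteq> 0"
  shows "R (g(q := e i)) = e i * R (g(q := 1))"
proof -
  let ?F = "\<lambda>g. slot_defect B i q g - slot_defect D i q g"
  have "?F g = 0"
  proof (rule jet_zero[where S = "{..<n} - {q}" and F = ?F])
    show "jet ?F p" if "p \<in> {..<n} - {q}" for p
      using that q i by (intro jet_diff jet_slot_defect_B jet_slot_defect_D) auto
    fix h assume h: "args h" "\<forall>p\<in>{..<n} - {q}. h p \<in> e ` {..<n}"
    have "R (h(q := e j)) = 0" if j: "j < n" for j
    proof -
      have "\<forall>i<n. (h(q := e j)) i \<in> e ` {..<n}" using h j by auto
      then obtain s where s: "\<And>i. i < n \<Longrightarrow> s i < n" "\<And>i. i < n \<Longrightarrow> (h(q := e j)) i = (e \<circ> s) i"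
        using frame_choice[of "h(q := e j)"] by blast
      show ?thesis using skew_cong[OF skew_R s(2)] R_frame[of s] s(1) by presburger
    qed
    from this[OF i(1)] this[of 0] have "R (h(q := e i)) = 0" "R (h(q := 1)) = 0"
      by (simp_all add: e_0)
    then show "?F h = 0" by (simp add: slot_defect_def R_def)
  qed (use g in auto)
  then show ?thesis by (simp add: slot_defect_def R_def algebra_simps)
qed

end

section \<open>The bracket is a determinant\<close>

context nambu_frame
begin

lemma D_zero: "args g \<Longrightarrow> p < n \<Longrightarrow> D (g(p := 0)) = 0"
  using jetD[OF jet_D, of p g 0] by simp

lemma D_add:
  assumes "args g" "p < n" "x \<in> A" "y \<in> A"
  shows "D (g(p := x + y)) = D (g(p := x)) + D (g(p := y))"
  unfolding jetD[OF jet_D[OF assms(2)] assms(1) assms(3)] jetD[OF jet_D[OF assms(2)] assms(1) assms(4)]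
    jetD[OF jet_D[OF assms(2)] assms(1) add_closed[OF assms(3,4)]] sum.distrib[symmetric]
  by (rule sum.cong[OF refl]) (use assms in \<open>simp add: d_add algebra_simps\<close>)

lemma D_leibniz:
  assumes "args g" "p < n" "x \<in> A" "y \<in> A"
  shows "D (g(p := x * y)) = D (g(p := x)) * y + x * D (g(p := y)) - D (g(p := 1)) * x * y"
  unfolding jetD[OF jet_D[OF assms(2)] assms(1) assms(3)] jetD[OF jet_D[OF assms(2)] assms(1) assms(4)]
    jetD[OF jet_D[OF assms(2)] assms(1) mult_closed[OF assms(3,4)]]
    jetD[OF jet_D[OF assms(2)] assms(1) one_closed]
    sum_distrib_left sum_distrib_right sum.distrib[symmetric] sum_subtractf[symmetric]
  by (rule sum.cong[OF refl]) (use assms in \<open>simp add: d_mult[of _ x y] algebra_simps\<close>)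

lemma R_add: "args g \<Longrightarrow> p < n \<Longrightarrow> x \<in> A \<Longrightarrow> y \<in> A \<Longrightarrow>
    R (g(p := x + y)) = R (g(p := x)) + R (g(p := y))"
  unfolding R_def by (simp only: B_add D_add) simp

lemma R_zero: "args g \<Longrightarrow> p < n \<Longrightarrow> R (g(p := 0)) = 0"
  by (simp add: R_def B_zero D_zero)

lemma R_sum: "args g \<Longrightarrow> k < n \<Longrightarrow> (\<And>i. i \<in> S \<Longrightarrow> f i \<in> A) \<Longrightarrow>
    R (g(k := sum f S)) = (\<Sum>i\<in>S. R (g(k := f i)))"
proof (induction S rule: infinite_finite_induct)
  case (insert x F)
  have "sum f F \<in> A" "f x \<in> A" using insert.prems by (auto intro!: sum_closed)
  then have "R (g(k := f x + sum f F)) = R (g(k := f x)) + R (g(k := sum f F))"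
    using insert.prems by (simp only: R_add)
  moreover have "R (g(k := sum f F)) = (\<Sum>i\<in>F. R (g(k := f i)))"
    using insert.IH insert.prems by blast
  ultimately show ?case by (simp only: sum.insert[OF insert.hyps])
qed (auto simp: R_zero)

lemma R_leibniz: "args g \<Longrightarrow> p < n \<Longrightarrow> x \<in> A \<Longrightarrow> y \<in> A \<Longrightarrow>
    R (g(p := x * y)) = R (g(p := x)) * y + x * R (g(p := y)) - R (g(p := 1)) * x * y"
  unfolding R_def by (simp only: B_leibniz D_leibniz) (simp add: algebra_simps)

text \<open>By the Leibniz rule, a vanishing symbol at \<open>e i\<close> amounts to linearity over
  \<open>e i\<close>.\<close>

lemma R_mult_e:
  assumes g: "args g" and p: "p < n" and i: "i < n" and x: "x \<in> A"
  shows "R (g(p := e i * x)) = e i * R (g(p := x))"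
proof (cases "i = 0")
  case False
  have "R (g(p := e i * x)) = R (g(p := e i)) * x + e i * R (g(p := x)) - R (g(p := 1)) * e i * x"
    using R_leibniz[OF g p e_closed[OF i] x] .
  also have "R (g(p := e i)) = e i * R (g(p := 1))"
    by (rule slot_defect_R[OF g p i False])
  also have "e i * R (g(p := 1)) * x + e i * R (g(p := x)) - R (g(p := 1)) * e i * x = e i * R (g(p := x))"
    by (simp only: mult.commute[of "R (g(p := 1))"] add_diff_cancel_left')
  finally show ?thesis .
qed (simp add: e_0)

text \<open>The defect of the identity depends only on 1-jets in every slot; on the frame
  \<open>D\<close> may be replaced by \<open>B\<close>, for which the identity is
  \<open>d_jacobi\<close>.\<close>

lemma D_jacobi:
  assumes i: "i < n" and g: "args g"
  shows "d i (D g) = (\<Sum>j<n. D (g(j := d i (g j))))"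
proof -
  let ?F = "\<lambda>g. d i (D g) - (\<Sum>j<n. D (g(j := d i (g j))))"
  have "?F g = 0"
  proof (rule jet_zero[where S = "{..<n}" and F = ?F])
    fix p assume "p \<in> {..<n}"
    then have p: "p < n" by simp
    show "jet ?F p"
      unfolding jet_def
    proof (intro allI impI)
      fix g f assume g: "args g" and f: "f \<in> A"
      define Dk where "Dk k = D (g(p := e k))" for k
      define T where "T x = (\<Sum>j\<in>{..<n} - {p}. D ((g(j := d i (g j)))(p := x)))" for x
      have Dk: "Dk k \<in> A" if "k < n" for k using g that by (simp add: Dk_def)
      have split: "(\<Sum>j<n. D ((g(p := x))(j := d i ((g(p := x)) j)))) = D (g(p := d i x)) + T x" for x
      proof -
        have "D ((g(p := x))(j := d i ((g(p := x)) j))) = D ((g(j := d i (g j)))(p := x))"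
          if "j \<in> {..<n} - {p}" for j
        proof -
          have "(g(p := x))(j := d i ((g(p := x)) j)) = (g(j := d i (g j)))(p := x)"
            using that by (auto simp: fun_eq_iff)
          then show ?thesis by (rule arg_cong)
        qed
        then have "(\<Sum>j\<in>{..<n} - {p}. D ((g(p := x))(j := d i ((g(p := x)) j)))) = T x"
          unfolding T_def by (rule sum.cong[OF refl])
        moreover have "D ((g(p := x))(p := d i ((g(p := x)) p))) = D (g(p := d i x))"
          by simp
        ultimately show ?thesis
          using sum.remove[of "{..<n}" p "\<lambda>j. D ((g(p := x))(j := d i ((g(p := x)) j)))"] p
          by simp
      qed
      have "T f = (\<Sum>j\<in>{..<n} - {p}. \<Sum>k<n. d k f * D ((g(j := d i (g j)))(p := e k)))"
        unfolding T_def
      proof (rule sum.cong[OF refl])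
        fix j assume "j \<in> {..<n} - {p}"
        then have "args (g(j := d i (g j)))" using g by auto
        then show "D ((g(j := d i (g j)))(p := f)) = (\<Sum>k<n. d k f * D ((g(j := d i (g j)))(p := e k)))"
          by (rule jetD[OF jet_D[OF p] _ f])
      qed
      then have T: "T f = (\<Sum>k<n. d k f * T (e k))"
        unfolding T_def sum_distrib_left by (subst (asm) sum.swap) simp
      have Df: "D (g(p := f)) = (\<Sum>k<n. d k f * Dk k)"
        unfolding Dk_def by (rule jetD[OF jet_D[OF p] g f])
      have Ddf: "D (g(p := d i f)) = (\<Sum>k<n. d k (d i f) * Dk k)"
        unfolding Dk_def by (rule jetD[OF jet_D[OF p] g d_closed[OF f]])
      have De: "D (g(p := d i (e k))) = (if k = i then Dk 0 else 0)" if "k < n" for k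
        using that i D_zero[OF g p] by (auto simp: d_e Dk_def e_0)
      have 1: "d i (D (g(p := f))) = (\<Sum>k<n. d i (d k f * Dk k))"
        unfolding Df using Dk f by (intro d_sum[OF i]) auto
      have "d i (D (g(p := f))) - (D (g(p := d i f)) + T f)
        = (\<Sum>k<n. d i (d k f * Dk k) - d k (d i f) * Dk k - d k f * T (e k))"
        unfolding 1 Ddf T by (simp add: sum_subtractf)
      \<comment> \<open>For \<open>i = 0\<close> the commutator term \<open>d k f\<close> cancels
        the correction that the Leibniz rule makes for \<open>d 0 1 = 1\<close>.\<close>
      also have "\<dots> = (\<Sum>k<n. d k f * (d i (Dk k) - T (e k)) - (if k = 0 then d i f * Dk 0 else 0))"
      proof (rule sum.cong[OF refl])
        fix k assume "k \<in> {..<n}"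
        then have k: "k < n" by simp
        have "d i (d k f * Dk k) = (d k (d i f) + (if i = 0 then d k f else 0) - (if k = 0 then d i f else 0)) * Dk k
            + d k f * d i (Dk k) - (if i = 0 then 1 else 0) * d k f * Dk k"
          using d_mult[OF i d_closed[OF f, of k] Dk[OF k]] unfolding d_1[OF i] d_commutator[OF i k f] .
        then show "d i (d k f * Dk k) - d k (d i f) * Dk k - d k f * T (e k)
            = d k f * (d i (Dk k) - T (e k)) - (if k = 0 then d i f * Dk 0 else 0)"
          by (cases "i = 0"; cases "k = 0") (simp_all add: algebra_simps)
      qed
      also have "\<dots> = (\<Sum>k<n. d k f * (d i (Dk k) - T (e k))) - d i f * Dk 0"
        by (simp add: sum_subtractf)
      \<comment> \<open>The surplus belongs to \<open>k = i\<close>, where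
        \<open>d i (e i) = 1 = e 0\<close>.\<close>
      also have "d i f * Dk 0 = (\<Sum>k<n. if k = i then d k f * Dk 0 else 0)"
        using i by simp
      also have "(\<Sum>k<n. d k f * (d i (Dk k) - T (e k))) - (\<Sum>k<n. if k = i then d k f * Dk 0 else 0)
        = (\<Sum>k<n. d k f * (d i (Dk k) - (D (g(p := d i (e k))) + T (e k))))"
        unfolding sum_subtractf[symmetric]
        by (rule sum.cong[OF refl]) (auto simp: De algebra_simps)
      finally show "d i (D (g(p := f))) - (\<Sum>j<n. D ((g(p := f))(j := d i ((g(p := f)) j))))
        = (\<Sum>k<n. d k f * (d i (D (g(p := e k)))
            - (\<Sum>j<n. D ((g(p := e k))(j := d i ((g(p := e k)) j))))))"
        unfolding split Dk_def .
    qed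
  next
    fix h assume h: "args h" "\<forall>p\<in>{..<n}. h p \<in> e ` {..<n}"
    then obtain s where s: "\<And>i. i < n \<Longrightarrow> s i < n" "\<And>i. i < n \<Longrightarrow> h i = (e \<circ> s) i"
      using frame_choice[of h] by auto
    have "R h = 0" using skew_cong[OF skew_R s(2)] R_frame[of s] s(1) by presburger
    moreover have "R (h(j := x)) = 0" if j: "j < n" and x: "x \<in> A" for j x
    proof -
      have "R (h(j := x)) = R ((e \<circ> s)(j := x))"
        by (rule skew_cong[OF skew_R]) (use s in auto)
      then show ?thesis using R_frame_upd[of s j x] s(1) j x by simp
    qed
    then have "D (h(j := d i (h j))) = B (h(j := d i (h j)))" if "j < n" for j
      using that argsD[OF h(1) that] by (simp add: R_def)
    ultimately show "?F h = 0"
      using d_jacobi[OF i h(1)] by (simp add: R_def)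
  qed (use g in auto)
  then show ?thesis by simp
qed

lemma R_jacobi: "i < n \<Longrightarrow> args g \<Longrightarrow> d i (R g) = (\<Sum>j<n. R (g(j := d i (g j))))"
  unfolding R_def by (simp add: d_diff d_jacobi D_jacobi sum_subtractf)

text \<open>Under the Euler operator a value of \<open>R\<close> has degree 1, while the n arguments
  contribute degree 1 each; comparison leaves \<open>(n - 1) * R g = 0\<close>.\<close>

lemma R_eq_0_if_euler:
  assumes eu: "\<And>f. f \<in> A \<Longrightarrow> (\<Sum>i<n. e i * d i f) = f" and g: "args g"
  shows "R g = 0"
proof -
  have cl: "e i * d i (g j) \<in> A" if "i < n" "j < n" for i j
    using that argsD[OF g] by simp
  have "R g = (\<Sum>i<n. e i * d i (R g))" using eu[OF R_closed[OF g]] by simp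
  also have "\<dots> = (\<Sum>i<n. \<Sum>j<n. e i * R (g(j := d i (g j))))"
    by (rule sum.cong[OF refl]) (simp only: lessThan_iff R_jacobi[OF _ g] sum_distrib_left)
  also have "\<dots> = (\<Sum>i<n. \<Sum>j<n. R (g(j := e i * d i (g j))))"
  proof (intro sum.cong[OF refl])
    fix i j assume "i \<in> {..<n}" "j \<in> {..<n}"
    then show "e i * R (g(j := d i (g j))) = R (g(j := e i * d i (g j)))"
      using R_mult_e[OF g, of j i "d i (g j)"] argsD[OF g, of j] by simp
  qed
  also have "\<dots> = (\<Sum>j<n. \<Sum>i<n. R (g(j := e i * d i (g j))))" by (rule sum.swap)
  also have "\<dots> = (\<Sum>j<n. R g)"
  proof (rule sum.cong[OF refl])
    fix j assume "j \<in> {..<n}"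
    then have j: "j < n" by simp
    have "(\<Sum>i<n. R (g(j := e i * d i (g j)))) = R (g(j := \<Sum>i<n. e i * d i (g j)))"
      using R_sum[OF g j, of "{..<n}" "\<lambda>i. e i * d i (g j)"] cl j by simp
    also have "\<dots> = R g" using eu[OF argsD[OF g j]] by simp
    finally show "(\<Sum>i<n. R (g(j := e i * d i (g j)))) = R g" .
  qed
  also have "\<dots> = of_nat n * R g" by simp
  finally have "R g = of_nat n * R g" .
  \<comment> \<open>Writes n - 1 as \<open>Suc (n - 2)\<close>, the shape that
    \<open>torsion_free\<close> cancels.\<close>
  moreover have "n = Suc (Suc (n - 2))" using n_gt_2 by arith
  then have "of_nat n = (1 :: 'a) + of_nat (Suc (n - 2))" by (metis of_nat_Suc)
  ultimately have "of_nat (Suc (n - 2)) * R g = 0" by (simp add: algebra_simps)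
  then show ?thesis using torsion_free R_closed[OF g] by blast
qed

text \<open>A truncated Euler operator. It is what remains in slot 0 after taking the symbols of
  \<open>B\<close> at the frame in slots 2 and 1, which are available because
  \<open>n > 2\<close>.\<close>

definition G :: "'a \<Rightarrow> 'a" where
  "G f = d 0 f + e 1 * d 1 f + e 2 * d 2 f"

lemma G_closed [simp, intro]: "f \<in> A \<Longrightarrow> G f \<in> A"
  by (simp add: G_def)

lemma G_1: "G 1 = 1"
  by (simp add: G_def d_1)

text \<open>Slot \<open>k\<close> enters only through \<open>c\<close> and the other slots only
  through \<open>U\<close>, so the product stays linear in the jet of each argument.\<close>

lemma jet_term:
  assumes c: "\<And>f. f \<in> A \<Longrightarrow> c f = (\<Sum>j<n. d j f * c (e j))"
    and U: "\<And>h x. U (h(k := x)) = U h" "\<And>p. p < n \<Longrightarrow> p \<noteq> k \<Longrightarrow> jet U p"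
    and p: "p < n"
  shows "jet (\<lambda>h. c (h k) * U h) p"
  unfolding jet_def
proof (intro allI impI)
  fix g f assume g: "args g" and f: "f \<in> A"
  show "c ((g(p := f)) k) * U (g(p := f)) = (\<Sum>j<n. d j f * (c ((g(p := e j)) k) * U (g(p := e j))))"
  proof (cases "p = k")
    case True
    then show ?thesis
      by (simp add: U(1)) (subst c[OF f], simp add: sum_distrib_right mult.assoc)
  next
    case False
    have "c (g k) * U (g(p := f)) = c (g k) * (\<Sum>j<n. d j f * U (g(p := e j)))"
      using jetD[OF U(2)[OF p False] g f] by (rule arg_cong)
    also have "\<dots> = (\<Sum>j<n. d j f * (c (g k) * U (g(p := e j))))"
      unfolding sum_distrib_left by (rule sum.cong[OF refl]) (simp only: mult.left_commute)
    finally show ?thesis using False by simp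
  qed
qed

lemma jet_add: "jet F p \<Longrightarrow> jet H p \<Longrightarrow> jet (\<lambda>g. F g + H g) p"
  unfolding jet_def by (simp add: distrib_left sum.distrib)

lemma jet_sum:
  assumes "\<And>k. k \<in> S \<Longrightarrow> jet (F k) p"
  shows "jet (\<lambda>g. \<Sum>k\<in>S. F k g) p"
  unfolding jet_def
proof (intro allI impI)
  fix g f assume g: "args g" and f: "f \<in> A"
  have "(\<Sum>k\<in>S. F k (g(p := f))) = (\<Sum>k\<in>S. \<Sum>j<n. d j f * F k (g(p := e j)))"
    by (rule sum.cong[OF refl]) (rule jetD[OF assms g f])
  also have "\<dots> = (\<Sum>j<n. d j f * (\<Sum>k\<in>S. F k (g(p := e j))))"
    unfolding sum_distrib_left by (rule sum.swap)
  finally show "(\<Sum>k\<in>S. F k (g(p := f))) = (\<Sum>j<n. d j f * (\<Sum>k\<in>S. F k (g(p := e j))))" .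
qed

lemma jet_D_diff:
  assumes "p < n" "p \<noteq> k" "b \<in> A" "c \<in> A"
  shows "jet (\<lambda>h. D (h(k := b)) - c * D (h(k := 1))) p"
  unfolding jet_def
proof (intro allI impI)
  fix g f assume g: "args g" and f: "f \<in> A"
  have tw: "g(p := x, k := y) = g(k := y, p := x)" for x y using assms(2) by (rule fun_upd_twist)
  have "D (g(p := f, k := y)) = (\<Sum>j<n. d j f * D (g(p := e j, k := y)))" if "y \<in> A" for y
    unfolding tw by (rule jetD[OF jet_D[OF assms(1)] args_upd[OF g that] f])
  from this[OF assms(3)] this[OF one_closed]
  show "D (g(p := f, k := b)) - c * D (g(p := f, k := 1)) =
      (\<Sum>j<n. d j f * (D (g(p := e j, k := b)) - c * D (g(p := e j, k := 1))))"
    by (simp only: right_diff_distrib sum_subtractf sum_distrib_left mult.left_commute)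
qed

text \<open>
  Subtract \<open>e 2\<close> times the symbol identity for \<open>e(2 := 1)\<close> from the one for \<open>e\<close>, with \<open>c = e 1\<close>.
  By \<open>slot_defect_R\<close> the remainder \<open>R\<close> survives only next to \<open>G\<close>; the determinantal part \<open>S D\<close>
  vanishes because it does so on the frame.
\<close>
lemma G_identity:
  assumes h: "args h" and b: "b \<in> A"
  shows "(\<Sum>k<n. G (h k) * (R (h(k := b)) - b * R (h(k := 1)))) = 0"
proof -
  \<comment> \<open>\<open>\<Lambda> u v\<close> is the symbol in slot 2 at \<open>e 2\<close>, with
    \<open>u\<close> in slot 1 and \<open>v\<close> in slot 0. A further symbol in slot 1 gives
    \<open>G\<close> at \<open>e 1\<close> and \<open>T\<close> at \<open>b\<close>.\<close>
  define \<Lambda> where "\<Lambda> u v = B (e(1 := u, 0 := v)) - e 2 * B (e(2 := 1, 1 := u, 0 := v))" for u v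
  define T where "T v = \<Lambda> b v - b * \<Lambda> 1 v" for v
  have e12 [simp]: "e (Suc 0) \<in> A" "e 1 \<in> A" "e 2 \<in> A" "e 0 \<in> A" by auto
  have \<Lambda>_sd: "\<Lambda> u v = slot_defect B 2 2 ((e(1 := u))(0 := v))" for u v
  proof -
    have "e(1 := u, 0 := v) = (e(1 := u, 0 := v))(2 := e 2)" by auto
    moreover have "e(2 := 1, 1 := u, 0 := v) = (e(1 := u, 0 := v))(2 := 1)" by auto
    ultimately show ?thesis unfolding \<Lambda>_def slot_defect_def by metis
  qed
  have \<Lambda>_jet: "\<Lambda> u v = (\<Sum>j<n. d j v * \<Lambda> u (e j))" if "u \<in> A" "v \<in> A" for u v
    unfolding \<Lambda>_sd using that
    by (intro jetD[OF jet_slot_defect_B]) (auto intro: args_e)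
  have T_jet: "T v = (\<Sum>j<n. d j v * T (e j))" if "v \<in> A" for v
    unfolding T_def \<Lambda>_jet[OF b that] \<Lambda>_jet[OF one_closed that]
    by (simp add: sum_subtractf right_diff_distrib sum_distrib_left mult.left_commute)
  have \<Lambda>_e1: "\<Lambda> (e 1) v = d 0 v + e 2 * d 2 v" if v: "v \<in> A" for v
  proof -
    have "(e(2 := v))(0 := (e(2 := v)) 2, 2 := (e(2 := v)) 0) = e(2 := 1, 1 := e 1, 0 := v)"
      by (auto simp: fun_eq_iff e_0)
    then have "B (e(2 := 1, 1 := e 1, 0 := v)) = - d 2 v"
      using skew_swap[OF skew_B args_upd[OF args_e v] n_pos(1,3), of 2] unfolding d_def by simp
    then show ?thesis unfolding \<Lambda>_def d_def by (simp add: fun_upd_idem)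
  qed
  have \<Lambda>_1: "\<Lambda> 1 v = - d 1 v" if v: "v \<in> A" for v
  proof -
    have "(e(1 := v))(0 := (e(1 := v)) 1, 1 := (e(1 := v)) 0) = e(1 := 1, 0 := v)"
      by (auto simp: fun_eq_iff e_0)
    then have "B (e(1 := 1, 0 := v)) = - d 1 v"
      using skew_swap[OF skew_B args_upd[OF args_e v] n_pos(1,2), of 1] unfolding d_def by simp
    moreover have "B (e(2 := 1, 1 := 1, 0 := v)) = 0"
      by (rule skew_dup[OF skew_B _ n_pos(2,3)]) (use v args_e in auto)
    ultimately show ?thesis unfolding \<Lambda>_def by simp
  qed
  have G_eq: "G v = \<Lambda> (e 1) v - e 1 * \<Lambda> 1 v" if "v \<in> A" for v
    unfolding \<Lambda>_e1[OF that] \<Lambda>_1[OF that] G_def by (simp add: algebra_simps)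
  have G_jet: "G v = (\<Sum>j<n. d j v * G (e j))" if "v \<in> A" for v
  proof -
    have "G v = (\<Sum>j<n. d j v * \<Lambda> (e 1) (e j)) - e 1 * (\<Sum>j<n. d j v * \<Lambda> 1 (e j))"
      unfolding G_eq[OF that] \<Lambda>_jet[OF e12(2) that, symmetric] \<Lambda>_jet[OF one_closed that, symmetric] ..
    also have "\<dots> = (\<Sum>j<n. d j v * (\<Lambda> (e 1) (e j) - e 1 * \<Lambda> 1 (e j)))"
      by (simp only: right_diff_distrib sum_subtractf sum_distrib_left mult.left_commute)
    also have "\<dots> = (\<Sum>j<n. d j v * G (e j))"
      by (rule sum.cong[OF refl]) (simp add: G_eq)
    finally show ?thesis .
  qed
  define S where "S F h = (\<Sum>k<n. G (h k) * (F (h(k := b)) - b * F (h(k := 1)))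
      + T (h k) * (F (h(k := e 1)) - e 1 * F (h(k := 1))))" for F and h :: "nat \<Rightarrow> 'a"
  have S_B: "S B h = 0" if h: "args h" for h
  proof -
    let ?X = "\<lambda>g k. (B (g(1 := e 1, 0 := h k)) - e 1 * B (g(1 := 1, 0 := h k))) * (B (h(k := b)) - b * B (h(k := 1)))
      + (B (g(1 := b, 0 := h k)) - b * B (g(1 := 1, 0 := h k))) * (B (h(k := e 1)) - e 1 * B (h(k := 1)))"
    have 1: "(\<Sum>k<n. ?X e k) = 0"
      by (rule symbol_identity[OF args_e h n_pos(2)[folded One_nat_def] n_pos(1) _ b e12(2)]) simp
    have 2: "(\<Sum>k<n. ?X (e(2 := 1)) k) = 0"
      by (rule symbol_identity[OF args_upd[OF args_e one_closed] h n_pos(2)[folded One_nat_def] n_pos(1) _ b e12(2)]) simp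
    have "S B h = (\<Sum>k<n. ?X e k - e 2 * ?X (e(2 := 1)) k)"
      unfolding S_def
    proof (rule sum.cong[OF refl])
      fix k assume "k \<in> {..<n}"
      then have "h k \<in> A" using argsD[OF h] by simp
      then show "G (h k) * (B (h(k := b)) - b * B (h(k := 1))) + T (h k) * (B (h(k := e 1)) - e 1 * B (h(k := 1)))
        = ?X e k - e 2 * ?X (e(2 := 1)) k"
        unfolding G_eq[OF \<open>h k \<in> A\<close>] T_def \<Lambda>_def by (simp only: algebra_simps)
    qed
    also have "\<dots> = (\<Sum>k<n. ?X e k) - e 2 * (\<Sum>k<n. ?X (e(2 := 1)) k)"
      by (simp only: sum_subtractf sum_distrib_left)
    finally show ?thesis unfolding 1 2 by simp
  qed
  have S_BDR: "S B h = S D h + (\<Sum>k<n. G (h k) * (R (h(k := b)) - b * R (h(k := 1))))" if h: "args h" for h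
    unfolding S_def sum.distrib[symmetric]
  proof (rule sum.cong[OF refl])
    fix k assume "k \<in> {..<n}"
    then have "R (h(k := e 1)) = e 1 * R (h(k := 1))"
      using slot_defect_R[OF h, of k 1] by simp
    then have *: "B (h(k := e 1)) - e 1 * B (h(k := 1)) = D (h(k := e 1)) - e 1 * D (h(k := 1))"
      unfolding R_def by (simp add: algebra_simps)
    have **: "B (h(k := b)) - b * B (h(k := 1)) =
        (D (h(k := b)) - b * D (h(k := 1))) + (R (h(k := b)) - b * R (h(k := 1)))"
      unfolding R_def by (simp only: algebra_simps)
    show "G (h k) * (B (h(k := b)) - b * B (h(k := 1))) + T (h k) * (B (h(k := e 1)) - e 1 * B (h(k := 1)))
      = G (h k) * (D (h(k := b)) - b * D (h(k := 1))) + T (h k) * (D (h(k := e 1)) - e 1 * D (h(k := 1)))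
        + G (h k) * (R (h(k := b)) - b * R (h(k := 1)))"
      unfolding * ** by (simp only: algebra_simps)
  qed
  have "S D h = 0"
  proof (rule jet_zero[where S = "{..<n}" and F = "S D"])
    fix p assume "p \<in> {..<n}"
    then have p: "p < n" by simp
    show "jet (S D) p"
      unfolding S_def
      by (intro jet_sum jet_add jet_term[OF G_jet _ _ p] jet_term[OF T_jet _ _ p] jet_D_diff)
        (auto simp: b)
  next
    fix h assume h: "args h" "\<forall>p\<in>{..<n}. h p \<in> e ` {..<n}"
    then obtain s where s: "\<And>i. i < n \<Longrightarrow> s i < n" "\<And>i. i < n \<Longrightarrow> h i = (e \<circ> s) i"
      using frame_choice[of h] by auto
    have "R (h(j := x)) = 0" if j: "j < n" and x: "x \<in> A" for j x
    proof -
      have "R (h(j := x)) = R ((e \<circ> s)(j := x))"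
        by (rule skew_cong[OF skew_R]) (use s in auto)
      then show ?thesis using R_frame_upd[of s j x] s(1) j x by simp
    qed
    then have "(\<Sum>k<n. G (h k) * (R (h(k := b)) - b * R (h(k := 1)))) = 0"
      by (intro sum.neutral) (simp add: b)
    then show "S D h = 0" using S_BDR[OF h(1)] S_B[OF h(1)] by simp
  qed (use h in auto)
  then show ?thesis using S_BDR[OF h] S_B[OF h] by simp
qed

lemma R_dup:
  assumes "args h" "i < n" "j < n" "i \<noteq> j" "h i = h j"
  shows "R h = 0"
  by (rule skew_dup[OF skew_R assms])

text \<open>In \<open>G_identity\<close> the term \<open>k = 0\<close> has the coefficient
  \<open>G 1 = 1\<close>, and for \<open>k > 0\<close> the entry 1 occurs twice in
  \<open>h(k := 1)\<close>. Thus every value of \<open>R\<close> is a combination of values with 1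
  in slot 0.\<close>

lemma R_expand:
  assumes h: "args h" and h0: "h 0 = 1" and b: "b \<in> A"
  shows "R (h(0 := b)) = b * R h - (\<Sum>k\<in>{1..<n}. G (h k) * R (h(k := b)))"
proof -
  have "(\<Sum>k\<in>{1..<n}. G (h k) * (R (h(k := b)) - b * R (h(k := 1)))) = (\<Sum>k\<in>{1..<n}. G (h k) * R (h(k := b)))"
  proof (rule sum.cong[OF refl])
    fix k assume k: "k \<in> {1..<n}"
    have "R (h(k := 1)) = 0"
      by (rule R_dup[of _ 0 k]) (use h h0 k in auto)
    then show "G (h k) * (R (h(k := b)) - b * R (h(k := 1))) = G (h k) * R (h(k := b))" by simp
  qed
  moreover have "{..<n} = insert 0 {1..<n}" by auto
  ultimately have "(R (h(0 := b)) - b * R h) + (\<Sum>k\<in>{1..<n}. G (h k) * R (h(k := b))) = 0"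
    using G_identity[OF h b] h0 by (simp add: G_1 fun_upd_idem)
  then show ?thesis by (simp add: algebra_simps eq_neg_iff_add_eq_0)
qed

text \<open>For \<open>b = h 1\<close> in \<open>R_expand\<close> all repeated arguments drop out
  and only \<open>k = 1\<close> stays.\<close>

lemma G_R:
  assumes h: "args h" and h0: "h 0 = 1"
  shows "(G (h 1) - h 1) * R h = 0"
proof -
  have b: "h 1 \<in> A" using argsD[OF h, of 1] by simp
  have "R (h(0 := h 1)) = 0"
    by (rule R_dup[of _ 0 1]) (use h b in auto)
  moreover have "(\<Sum>k\<in>{1..<n}. G (h k) * R (h(k := h 1))) = (\<Sum>k\<in>{1..<n}. if k = 1 then G (h 1) * R h else 0)"
  proof (rule sum.cong[OF refl])
    fix k assume k: "k \<in> {1..<n}"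
    have "R (h(k := h 1)) = 0" if "k \<noteq> 1"
      by (rule R_dup[of _ 1 k]) (use h b k that in auto)
    then show "G (h k) * R (h(k := h 1)) = (if k = 1 then G (h 1) * R h else 0)" by (auto simp: fun_upd_idem)
  qed
  ultimately show ?thesis
    using R_expand[OF h h0 b] by (simp add: algebra_simps)
qed

text \<open>Polarization of \<open>G_R\<close> in slot 1: a single \<open>h\<close> with invertible
  \<open>R h\<close> then controls \<open>G\<close> on all of \<open>A\<close>.\<close>

lemma G_R_polarized:
  assumes h: "args h" and h0: "h 0 = 1" and c: "c \<in> A"
  shows "(G (h 1) - h 1) * R (h(1 := c)) + (G c - c) * R h = 0"
proof -
  have h1: "h 1 \<in> A" using argsD[OF h, of 1] by simp
  have 1: "(G (h 1) - h 1) * R h = 0" by (rule G_R[OF h h0])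
  have 2: "(G c - c) * R (h(1 := c)) = 0"
    using G_R[OF args_upd[OF h c, of 1]] h0 by simp
  have "(G (h 1 + c) - (h 1 + c)) * R (h(1 := h 1 + c)) = 0"
    using G_R[OF args_upd[OF h add_closed[OF h1 c], of 1]] h0 by simp
  moreover have "G (h 1 + c) = G (h 1) + G c"
    unfolding G_def using h1 c by (simp add: d_add algebra_simps)
  moreover have "R (h(1 := h 1 + c)) = R h + R (h(1 := c))"
    using R_add[OF h _ h1 c, of 1] by (simp add: fun_upd_idem)
  ultimately have "(G (h 1) - h 1 + (G c - c)) * (R h + R (h(1 := c))) = 0"
    by (simp add: algebra_simps)
  then show ?thesis using 1 2 by (simp only: distrib_left distrib_right) (simp add: add.commute)
qed

text \<open>
  The values of \<open>R\<close> generate a stable ideal.  If it is not \<open>0\<close>, then some \<open>R h\<close> with \<open>h 0 = 1\<close>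
  is a unit by \<open>R_expand\<close>, and \<open>G_R\<close> makes \<open>G\<close> the identity.  As \<open>G (e 3) = 0\<close>, this leaves
  \<open>n = 3\<close>, where \<open>G\<close> is the full Euler sum.
\<close>
theorem B_eq_D:
  assumes M: "ideal M" "1 \<notin> M" and local: "\<And>a. a \<in> A \<Longrightarrow> a \<notin> M \<Longrightarrow> \<exists>b\<in>A. a * b = 1"
    and simple: "\<And>I. ideal I \<Longrightarrow> (\<And>g. args g \<Longrightarrow> g 0 \<in> I \<Longrightarrow> B g \<in> I) \<Longrightarrow> I = {0} \<or> I = A"
    and g: "args g"
  shows "B g = D g"
proof -
  define J where "J = A \<inter> \<Inter>{I. ideal I \<and> (\<forall>h. args h \<longrightarrow> R h \<in> I)}"
  have J: "ideal J" unfolding J_def ideal_def by auto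
  have R_J: "R h \<in> J" if "args h" for h using that by (auto simp: J_def)
  have J_min: "J \<subseteq> I" if "ideal I" "\<And>h. args h \<Longrightarrow> R h \<in> I" for I
    using that by (auto simp: J_def)
  \<comment> \<open>By minimality of \<open>J\<close> it suffices that the elements of
    \<open>J\<close> whose derivatives stay in \<open>J\<close> form an ideal containing every
    \<open>R h\<close>; the latter is \<open>R_jacobi\<close>.\<close>
  have d_J: "d i x \<in> J" if i: "i < n" and x: "x \<in> J" for i x
  proof -
    let ?I = "{x\<in>J. \<forall>i<n. d i x \<in> J}"
    have "ideal ?I"
      unfolding ideal_def
    proof (intro conjI ballI)
      show "?I \<subseteq> A" using ideal_subset[OF J] by auto
      show "0 \<in> ?I" using ideal_zero[OF J] by simp
      show "x + y \<in> ?I" if "x \<in> ?I" "y \<in> ?I" for x y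
        using that ideal_subset[OF J] by (auto simp: d_add intro!: ideal_add[OF J])
      show "a * x \<in> ?I" if a: "a \<in> A" and x: "x \<in> ?I" for a x
      proof -
        have xA: "x \<in> A" using x ideal_subset[OF J] by simp
        have "d i (a * x) \<in> J" if i: "i < n" for i
          unfolding d_mult[OF i a xA]
          using x i a by (intro ideal_add[OF J] ideal_diff[OF J] ideal_mult[OF J]) auto
        then show ?thesis using ideal_mult[OF J a, of x] x by simp
      qed
    qed
    moreover have "R h \<in> ?I" if h: "args h" for h
    proof -
      have "d i (R h) \<in> J" if "i < n" for i
        unfolding R_jacobi[OF that h] using argsD[OF h] by (intro ideal_sum[OF J] R_J) (auto intro: h)
      then show ?thesis using R_J[OF h] by simp
    qed
    ultimately show ?thesis using J_min[of ?I] i x by auto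
  qed
  have "B h \<in> J" if h: "args h" and h0: "h 0 \<in> J" for h
  proof -
    have "D (h(0 := h 0)) \<in> J"
      unfolding jetD[OF jet_D[OF n_pos(1)] h ideal_subset[OF J h0]]
      using h h0 by (intro ideal_sum[OF J] ideal_mult_right[OF J] d_J) auto
    then have "D h + R h \<in> J" using R_J[OF h] by (intro ideal_add[OF J]) simp_all
    then show ?thesis by (simp add: R_def)
  qed
  then consider "J = {0}" | "J = A" using simple[OF J] by blast
  then have "R g = 0"
  proof cases
    case 1
    then show ?thesis using R_J[OF g] by simp
  next
    case 2
    have "\<exists>h. args h \<and> h 0 = 1 \<and> R h \<notin> M"
    proof (rule ccontr)
      assume "\<not> ?thesis"
      then have *: "R h \<in> M" if "args h" "h 0 = 1" for h using that by blast
      have "R h \<in> M" if h: "args h" for h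
      proof -
        have b: "h 0 \<in> A" using h by (rule argsD) simp
        let ?h = "h(0 := 1)"
        have h': "args ?h" using h by simp
        have "R (?h(0 := h 0)) = h 0 * R ?h - (\<Sum>k\<in>{1..<n}. G (?h k) * R (?h(k := h 0)))"
          by (rule R_expand[OF h' _ b]) simp
        also have "\<dots> \<in> M"
          using argsD[OF h] b by (intro ideal_diff[OF M(1)] ideal_mult[OF M(1)] ideal_sum[OF M(1)] *) (auto simp: h)
        finally show ?thesis by simp
      qed
      then have "J \<subseteq> M" by (rule J_min[OF M(1)])
      then show False using 2 M(2) one_closed by blast
    qed
    then obtain h where h: "args h" "h 0 = 1" "R h \<notin> M" by blast
    obtain u where u: "u \<in> A" "R h * u = 1" using local[OF R_closed[OF h(1)] h(3)] by blast
    have cancel: "x = 0" if "x * R h = 0" for x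
      using that u(2) by (metis mult.assoc mult.right_neutral mult_zero_left)
    have "G (h 1) - h 1 = 0" by (rule cancel[OF G_R[OF h(1,2)]])
    then have "(G c - c) * R h = 0" if "c \<in> A" for c
      using G_R_polarized[OF h(1,2) that] by simp
    then have G_id: "G c = c" if "c \<in> A" for c using cancel that by fastforce
    have "n = 3"
    proof (rule ccontr)
      assume "n \<noteq> 3"
      then have n: "3 < n" using n_gt_2 by linarith
      then have "e 3 = 0" using G_id[of "e 3"] by (simp add: G_def d_e)
      then have "(1 :: 'a) = 0" using d_e[of 3 3] n by simp
      then show False using M ideal_zero by metis
    qed
    show ?thesis
    proof (rule R_eq_0_if_euler[OF _ g])
      fix f assume "f \<in> A"
      then show "(\<Sum>i<n. e i * d i f) = f"
        using G_id[of f] \<open>n = 3\<close> by (simp add: G_def numeral_3_eq_3 numeral_2_eq_2 e_0)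
    qed
  qed
  then show ?thesis by (simp add: R_def)
qed

end

section \<open>Complete algebras without idempotents are local\<close>

text \<open>
  \<open>\<U>\<close> is a cofinal system of open ideals; the last two assumptions express completeness (a
  compatible system of cosets has a common point) and finite codimension of these ideals.
\<close>
locale complete_alg = carrier_ring A for A :: "'a::comm_ring_1 set" +
  fixes \<kappa> :: "'k::field_char_0 \<Rightarrow> 'a" and \<U> :: "'a set set"
  assumes \<kappa>_closed [simp, intro]: "\<kappa> c \<in> A"
    and \<kappa>_1 [simp]: "\<kappa> 1 = 1"
    and \<kappa>_add: "\<kappa> (a + b) = \<kappa> a + \<kappa> b"
    and \<kappa>_mult: "\<kappa> (a * b) = \<kappa> a * \<kappa> b"
    and ideal_\<U>: "U \<in> \<U> \<Longrightarrow> ideal U"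
    and Int_\<U>: "U \<in> \<U> \<Longrightarrow> V \<in> \<U> \<Longrightarrow> U \<inter> V \<in> \<U>"
    and A_\<U>: "A \<in> \<U>"
    and separated: "x \<in> A \<Longrightarrow> (\<And>U. U \<in> \<U> \<Longrightarrow> x \<in> U) \<Longrightarrow> x = 0"
    and complete: "(\<And>U. U \<in> \<U> \<Longrightarrow> z U \<in> A) \<Longrightarrow>
      (\<And>U V. U \<in> \<U> \<Longrightarrow> V \<in> \<U> \<Longrightarrow> V \<subseteq> U \<Longrightarrow> z V - z U \<in> U) \<Longrightarrow>
      \<exists>x\<in>A. \<forall>U\<in>\<U>. x - z U \<in> U"
    and finite_codim: "U \<in> \<U> \<Longrightarrow> (\<And>j. v j \<in> A) \<Longrightarrow>
      \<exists>(m::nat) c. (\<exists>j\<le>m. c j \<noteq> 0) \<and> (\<Sum>j\<le>m. \<kappa> (c j) * v j) \<in> U"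
begin

lemma \<kappa>_0 [simp]: "\<kappa> 0 = 0"
  using \<kappa>_add[of 0 0] by simp

lemma \<kappa>_uminus: "\<kappa> (- c) = - \<kappa> c"
  using \<kappa>_add[of c "- c"] by (simp add: eq_neg_iff_add_eq_0 add.commute)

lemma \<kappa>_diff: "\<kappa> (a - b) = \<kappa> a - \<kappa> b"
  using \<kappa>_add[of a "- b"] by (simp add: \<kappa>_uminus)

lemma \<kappa>_of_nat: "\<kappa> (of_nat m) = of_nat m"
  by (induction m) (simp_all add: \<kappa>_add)

lemma \<kappa>_unit: "c \<noteq> 0 \<Longrightarrow> \<kappa> c * \<kappa> (inverse c) = 1"
  by (simp flip: \<kappa>_mult)

lemma torsion_free: "of_nat (Suc k) * x = 0 \<Longrightarrow> x = (0 :: 'a)"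
proof -
  assume "of_nat (Suc k) * x = 0"
  then have "\<kappa> (inverse (of_nat (Suc k))) * (\<kappa> (of_nat (Suc k)) * x) = 0"
    by (simp only: \<kappa>_of_nat) simp
  moreover have "of_nat (Suc k) \<noteq> (0 :: 'k)" by (simp del: of_nat_Suc)
  ultimately show "x = 0"
    using \<kappa>_unit[of "of_nat (Suc k)"] by (metis mult.assoc mult.commute mult_1)
qed

text \<open>Topological nilpotency; for a single \<open>U\<close> it is nilpotency modulo
  \<open>U\<close>.\<close>

definition nil :: "'a \<Rightarrow> bool" where
  "nil a \<longleftrightarrow> a \<in> A \<and> (\<forall>U\<in>\<U>. \<exists>s. a ^ s \<in> U)"

lemma nil_closed: "nil a \<Longrightarrow> a \<in> A"
  by (simp add: nil_def)

lemma nilD: "nil a \<Longrightarrow> U \<in> \<U> \<Longrightarrow> \<exists>s. a ^ s \<in> U"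
  by (simp add: nil_def)

lemma ideal_power_le:
  assumes "ideal U" "a \<in> A" "a ^ s \<in> U" "s \<le> t"
  shows "a ^ t \<in> U"
  using ideal_mult[OF assms(1) power_closed[OF assms(2)] assms(3), of "t - s"] assms(4)
  by (simp flip: power_add)

lemma ideal_power_diff:
  assumes "ideal U" "x \<in> A" "y \<in> A" "x - y \<in> U"
  shows "x ^ k - y ^ k \<in> U"
proof (induction k)
  case (Suc k)
  have "x ^ Suc k - y ^ Suc k = x * (x ^ k - y ^ k) + (x - y) * y ^ k"
    by (simp add: algebra_simps)
  moreover have "x * (x ^ k - y ^ k) \<in> U" using ideal_mult assms Suc.IH by blast
  moreover have "(x - y) * y ^ k \<in> U" using ideal_mult_right assms by blast
  ultimately show ?case using ideal_add[OF assms(1)] by simp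
qed (use ideal_zero[OF assms(1)] in simp)

text \<open>
  Fitting idempotents: modulo \<open>U\<close>, the element \<open>a\<close> is nilpotent on the component cut out by \<open>p\<close>
  and invertible on the complementary one.
\<close>
definition fitting :: "'a \<Rightarrow> 'a set \<Rightarrow> 'a \<Rightarrow> bool" where
  "fitting a U p \<longleftrightarrow> p \<in> A \<and> p * p - p \<in> U \<and> (\<exists>s. a ^ s * p \<in> U) \<and> (\<exists>c\<in>A. 1 - p - a * c \<in> U)"

text \<open>By finite codimension the powers of \<open>a\<close> are linearly dependent modulo
  \<open>U\<close>. Dividing by the lowest coefficient gives \<open>a ^ s = a ^ s * (a * b)\<close>
  modulo \<open>U\<close>; iterating, \<open>q = a ^ t * b ^ t\<close> becomes idempotent and
  \<open>1 - q\<close> is the wanted element.\<close>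

lemma fitting_exists:
  assumes a: "a \<in> A" and U: "U \<in> \<U>"
  shows "\<exists>p. fitting a U p"
proof -
  note U' = ideal_\<U>[OF U]
  obtain m c where c: "\<exists>j\<le>m. c j \<noteq> 0" "(\<Sum>j\<le>m. \<kappa> (c j) * a ^ j) \<in> U"
    using finite_codim[OF U, of "\<lambda>j. a ^ j"] a by auto
  define s where "s = (LEAST j. c j \<noteq> 0)"
  have s: "c s \<noteq> 0" "s \<le> m" "\<And>j. j < s \<Longrightarrow> c j = 0"
  proof -
    obtain j where j: "j \<le> m" "c j \<noteq> 0" using c(1) by blast
    show "c s \<noteq> 0" unfolding s_def using j(2) by (rule LeastI)
    have "s \<le> j" unfolding s_def using j(2) by (rule Least_le)
    then show "s \<le> m" using j(1) by simp
    show "c j = 0" if "j < s" for j using not_less_Least that unfolding s_def by blast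
  qed
  define w where "w = (\<Sum>j\<in>{Suc s..m}. \<kappa> (c j) * a ^ (j - Suc s))"
  have wA: "w \<in> A" unfolding w_def using a by (intro sum_closed) auto
  have "(\<Sum>j\<le>m. \<kappa> (c j) * a ^ j) = (\<Sum>j\<in>{s..m}. \<kappa> (c j) * a ^ j)"
    by (rule sum.mono_neutral_right) (use s in auto)
  also have "\<dots> = \<kappa> (c s) * a ^ s + (\<Sum>j\<in>{Suc s..m}. \<kappa> (c j) * a ^ j)"
    using s(2) by (simp add: sum.atLeast_Suc_atMost)
  also have "(\<Sum>j\<in>{Suc s..m}. \<kappa> (c j) * a ^ j) = a ^ s * a * w"
    unfolding w_def sum_distrib_left
  proof (rule sum.cong[OF refl])
    fix j assume "j \<in> {Suc s..m}"
    then have "j = Suc s + (j - Suc s)" by simp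
    then have "a ^ j = a ^ Suc s * a ^ (j - Suc s)" by (metis power_add)
    then show "\<kappa> (c j) * a ^ j = a ^ s * a * (\<kappa> (c j) * a ^ (j - Suc s))" by (simp add: mult_ac)
  qed
  finally have 1: "\<kappa> (c s) * a ^ s + a ^ s * a * w \<in> U" using c(2) by simp
  define b where "b = - \<kappa> (inverse (c s)) * w"
  have bA: "b \<in> A" using wA by (simp add: b_def)
  \<comment> \<open>One more than \<open>s\<close>, so that \<open>a ^ t * b ^ t\<close> is
    divisible by \<open>a\<close> even for \<open>s = 0\<close>.\<close>
  define t where "t = Suc s"
  have "(a * \<kappa> (inverse (c s))) * (\<kappa> (c s) * a ^ s + a ^ s * a * w)
      = (\<kappa> (c s) * \<kappa> (inverse (c s))) * a ^ t - a ^ t * (a * b)"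
    by (simp add: t_def b_def algebra_simps)
  also have "\<dots> = a ^ t - a ^ t * (a * b)" using \<kappa>_unit[OF s(1)] by simp
  finally have 2: "a ^ t - a ^ t * (a * b) \<in> U"
    using ideal_mult[OF U' _ 1, of "a * \<kappa> (inverse (c s))"] a by simp
  have 3: "a ^ t - a ^ t * (a * b) ^ k \<in> U" for k
  proof (induction k)
    case (Suc k)
    have "(a * b) * (a ^ t - a ^ t * (a * b) ^ k) \<in> U"
      using ideal_mult[OF U' _ Suc.IH] a bA by simp
    from ideal_add[OF U' 2 this] show ?case by (simp add: algebra_simps)
  qed (use ideal_zero[OF U'] in simp)
  define q where "q = a ^ t * b ^ t"
  have qA: "q \<in> A" using a bA by (simp add: q_def)
  have 4: "a ^ t - a ^ t * q \<in> U" using 3[of t] by (simp add: q_def power_mult_distrib)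
  have "q - q * q = b ^ t * (a ^ t - a ^ t * q)" by (simp add: q_def algebra_simps)
  then have "q - q * q \<in> U" using ideal_mult[OF U' power_closed[OF bA] 4] by simp
  then have "- (q - q * q) \<in> U" by (rule ideal_uminus[OF U'])
  then have "(1 - q) * (1 - q) - (1 - q) \<in> U" by (simp add: algebra_simps)
  moreover have "a ^ t * (1 - q) \<in> U" using 4 by (simp add: algebra_simps)
  moreover have "1 - (1 - q) - a * (a ^ s * b ^ t) = 0" by (simp add: q_def t_def algebra_simps)
  then have "\<exists>c\<in>A. 1 - (1 - q) - a * c \<in> U" using a bA ideal_zero[OF U'] by (metis mult_closed power_closed)
  ultimately have "fitting a U (1 - q)" unfolding fitting_def using qA by blast
  then show ?thesis ..
qed

text \<open>On the overlap of \<open>p\<close> and \<open>1 - p'\<close> the element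
  \<open>a\<close> would be both nilpotent and invertible: modulo \<open>U\<close>,
  \<open>1 - p'\<close> equals a high power of \<open>a * c\<close>, which \<open>p\<close>
  annihilates.\<close>

lemma fitting_unique:
  assumes a: "a \<in> A" and U: "U \<in> \<U>" and p: "fitting a U p" and p': "fitting a U p'"
  shows "p - p' \<in> U"
proof -
  note U' = ideal_\<U>[OF U]
  have *: "p * (1 - p') \<in> U" if p: "fitting a U p" and p': "fitting a U p'" for p p'
  proof -
    obtain s where s: "a ^ s * p \<in> U" using p by (auto simp: fitting_def)
    obtain c where c: "c \<in> A" "1 - p' - a * c \<in> U" using p' by (auto simp: fitting_def)
    have pA: "p \<in> A" "p' \<in> A" using p p' by (auto simp: fitting_def)
    define y where "y = 1 - p'"
    have yA: "y \<in> A" using pA by (simp add: y_def)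
    have yy: "y - y * y \<in> U"
    proof -
      have "p' * p' - p' \<in> U" using p' by (simp add: fitting_def)
      then have "- (p' * p' - p') \<in> U" by (rule ideal_uminus[OF U'])
      then show ?thesis by (simp add: y_def algebra_simps)
    qed
    have yk: "y - y ^ Suc k \<in> U" for k
    proof (induction k)
      case (Suc k)
      have "(y - y * y) + y * (y - y ^ Suc k) \<in> U"
        by (rule ideal_add[OF U' yy ideal_mult[OF U' yA Suc.IH]])
      then show ?case by (simp add: algebra_simps)
    qed (use ideal_zero[OF U'] in simp)
    have "y ^ Suc s - (a * c) ^ Suc s \<in> U"
      by (rule ideal_power_diff[OF U' yA]) (use c a in \<open>auto simp: y_def\<close>)
    then have "(y - y ^ Suc s) + (y ^ Suc s - (a * c) ^ Suc s) \<in> U"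
      by (rule ideal_add[OF U' yk])
    then have "p * (y - (a * c) ^ Suc s) \<in> U" using ideal_mult[OF U' pA(1)] by simp
    moreover have "p * (a * c) ^ Suc s = (a * c ^ Suc s) * (a ^ s * p)"
      by (simp add: power_mult_distrib mult_ac)
    then have "p * (a * c) ^ Suc s \<in> U"
      using ideal_mult[OF U' _ s, of "a * c ^ Suc s"] a c(1) by simp
    ultimately have "p * (y - (a * c) ^ Suc s) + p * (a * c) ^ Suc s \<in> U"
      by (rule ideal_add[OF U'])
    then show ?thesis by (simp add: y_def algebra_simps)
  qed
  have "p - p' = p * (1 - p') - p' * (1 - p)" by (simp add: algebra_simps)
  then show ?thesis using *[OF p p'] *[OF p' p] ideal_diff[OF U'] by simp
qed

lemma fitting_mono: "fitting a V p \<Longrightarrow> V \<subseteq> U \<Longrightarrow> fitting a U p"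
  unfolding fitting_def by blast

text \<open>Uniqueness modulo each \<open>U\<close> makes the local idempotents a compatible system;
  completeness supplies the limit and separation makes it exactly idempotent.\<close>

lemma fitting_limit:
  assumes a: "a \<in> A"
  shows "\<exists>p. p * p = p \<and> (\<forall>U\<in>\<U>. fitting a U p)"
proof -
  define z where "z U = (SOME p. fitting a U p)" for U
  have z: "fitting a U (z U)" if "U \<in> \<U>" for U
    unfolding z_def using fitting_exists[OF a that] by (rule someI_ex)
  have zA: "z U \<in> A" if "U \<in> \<U>" for U using z[OF that] by (simp add: fitting_def)
  have "z V - z U \<in> U" if "U \<in> \<U>" "V \<in> \<U>" "V \<subseteq> U" for U V
    using fitting_unique[OF a that(1) fitting_mono[OF z[OF that(2)] that(3)] z[OF that(1)]] .
  then obtain p where p: "p \<in> A" "\<And>U. U \<in> \<U> \<Longrightarrow> p - z U \<in> U"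
    using complete[of z] zA by blast
  have fit: "fitting a U p" if U: "U \<in> \<U>" for U
  proof -
    note U' = ideal_\<U>[OF U] and pz = p(2)[OF U]
    obtain s c where zU: "z U * z U - z U \<in> U" "a ^ s * z U \<in> U" "c \<in> A" "1 - z U - a * c \<in> U"
      using z[OF U] by (auto simp: fitting_def)
    have "(p - z U) * (p + z U - 1) + (z U * z U - z U) \<in> U"
      using ideal_add[OF U' ideal_mult_right[OF U' _ pz] zU(1)] p(1) zA[OF U] by simp
    moreover have "(p - z U) * (p + z U - 1) + (z U * z U - z U) = p * p - p"
      by (simp add: algebra_simps)
    moreover have "a ^ s * (p - z U) + a ^ s * z U \<in> U"
      using ideal_add[OF U' ideal_mult[OF U' power_closed[OF a] pz] zU(2)] .
    moreover have "a ^ s * (p - z U) + a ^ s * z U = a ^ s * p" by (simp add: algebra_simps)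
    moreover have "(1 - z U - a * c) - (p - z U) \<in> U" using ideal_diff[OF U' zU(4) pz] .
    moreover have "(1 - z U - a * c) - (p - z U) = 1 - p - a * c" by simp
    ultimately show ?thesis unfolding fitting_def using p(1) zU(3) by metis
  qed
  have "p * p - p = 0"
    by (rule separated) (use p(1) fit in \<open>auto simp: fitting_def\<close>)
  then show ?thesis using fit by auto
qed

end

section \<open>Local algebras and the residue map\<close>

locale connected_alg = complete_alg A \<kappa> \<U>
  for A :: "'a::comm_ring_1 set" and \<kappa> :: "'k::{alg_closed_field, field_char_0} \<Rightarrow> 'a" and \<U> +
  assumes idempotents: "p \<in> A \<Longrightarrow> p * p = p \<Longrightarrow> p = 0 \<or> p = 1"
begin

text \<open>The limit of the Fitting idempotents is 0 or 1. For 0 the inverses modulo the ideals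
  glue, for 1 the element is topologically nilpotent.\<close>

lemma unit_or_nil:
  assumes a: "a \<in> A"
  shows "(\<exists>b\<in>A. a * b = 1) \<or> nil a"
proof -
  obtain p where p: "p * p = p" "\<And>U. U \<in> \<U> \<Longrightarrow> fitting a U p" using fitting_limit[OF a] by auto
  have "p \<in> A" using p(2)[OF A_\<U>] by (simp add: fitting_def)
  then consider "p = 0" | "p = 1" using idempotents p(1) by blast
  then show ?thesis
  proof cases
    case 1
    then have "\<forall>U\<in>\<U>. \<exists>c\<in>A. 1 - a * c \<in> U" using p(2) by (simp add: fitting_def)
    then obtain c where c: "\<And>U. U \<in> \<U> \<Longrightarrow> c U \<in> A" "\<And>U. U \<in> \<U> \<Longrightarrow> 1 - a * c U \<in> U" by metis
    have "c V - c U \<in> U" if UV: "U \<in> \<U>" "V \<in> \<U>" "V \<subseteq> U" for U V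
    proof -
      note U' = ideal_\<U>[OF UV(1)]
      \<comment> \<open>Inverses of \<open>a\<close> modulo \<open>U\<close> are unique: this
        combination equals their difference.\<close>
      have "c V * (1 - a * c U) - c U * (1 - a * c V) \<in> U"
        by (intro ideal_diff[OF U' ideal_mult[OF U' c(1)[OF UV(2)] c(2)[OF UV(1)]]]
            ideal_mult[OF U' c(1)[OF UV(1)]] subsetD[OF UV(3) c(2)[OF UV(2)]])
      then show ?thesis by (simp add: algebra_simps)
    qed
    then obtain b where b: "b \<in> A" "\<And>U. U \<in> \<U> \<Longrightarrow> b - c U \<in> U" using complete[of c] c(1) by blast
    have "1 - a * b = 0"
    proof (rule separated)
      fix U assume U: "U \<in> \<U>"
      note U' = ideal_\<U>[OF U]
      have "(1 - a * c U) - a * (b - c U) \<in> U"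
        by (intro ideal_diff[OF U' c(2)[OF U]] ideal_mult[OF U' a] b(2)[OF U])
      then show "1 - a * b \<in> U" by (simp add: algebra_simps)
    qed (use a b in simp)
    then show ?thesis using b(1) by auto
  next
    case 2
    then have "nil a" using p(2) a by (simp add: fitting_def nil_def)
    then show ?thesis ..
  qed
qed

lemma proper_ideal: "\<exists>U\<in>\<U>. 1 \<notin> U"
  using separated[of 1] by auto

lemma unit_not_nil:
  assumes "nil a" "b \<in> A"
  shows "a * b \<noteq> 1"
proof
  assume ab: "a * b = 1"
  obtain U where U: "U \<in> \<U>" "1 \<notin> U" using proper_ideal by blast
  obtain s where "a ^ s \<in> U" using nilD[OF assms(1) U(1)] by blast
  then have "a ^ s * b ^ s \<in> U" using ideal_mult_right[OF ideal_\<U>[OF U(1)]] assms(2) by simp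
  then show False using U(2) ab by (simp flip: power_mult_distrib)
qed

lemma nil_mult: "nil a \<Longrightarrow> b \<in> A \<Longrightarrow> nil (b * a)"
  unfolding nil_def by (metis ideal_\<U> ideal_mult mult_closed power_closed power_mult_distrib)

text \<open>Modulo a proper \<open>U\<close> containing \<open>a ^ s\<close> the geometric sum
  inverts \<open>1 - a\<close>, so no power of \<open>1 - a\<close> lies in
  \<open>U\<close>.\<close>

lemma not_nil_one_minus:
  assumes "nil a"
  shows "\<not> nil (1 - a)"
proof
  assume n: "nil (1 - a)"
  obtain U where U: "U \<in> \<U>" "1 \<notin> U" using proper_ideal by blast
  note U' = ideal_\<U>[OF U(1)] and aA = nil_closed[OF assms]
  obtain s where s: "a ^ s \<in> U" using nilD[OF assms U(1)] by blast
  obtain t where t: "(1 - a) ^ t \<in> U" using nilD[OF n U(1)] by blast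
  define w where "w = (\<Sum>i<s. a ^ i)"
  have w: "w \<in> A" unfolding w_def using aA by (intro sum_closed) auto
  have "1 - a ^ s = (1 - a) * w" unfolding w_def by (rule one_diff_power_eq)
  then have "(1 - a) * w = 1 - a ^ s" by (rule sym)
  then have "1 - (1 - a) * w \<in> U" using s by simp
  then have "1 ^ t - ((1 - a) * w) ^ t \<in> U" by (intro ideal_power_diff[OF U']) (use aA w in auto)
  moreover have "((1 - a) * w) ^ t \<in> U"
    unfolding power_mult_distrib using ideal_mult_right[OF U' power_closed[OF w] t] .
  ultimately have "(1 ^ t - ((1 - a) * w) ^ t) + ((1 - a) * w) ^ t \<in> U" by (rule ideal_add[OF U'])
  then show False using U(2) by simp
qed

text \<open>If \<open>a + b\<close> had an inverse \<open>u\<close>, then \<open>u * a\<close> and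
  \<open>1 - u * a = u * b\<close> would both be topologically nilpotent.\<close>

lemma nil_add:
  assumes "nil a" "nil b"
  shows "nil (a + b)"
proof (rule ccontr)
  assume "\<not> nil (a + b)"
  then obtain u where u: "u \<in> A" "(a + b) * u = 1"
    using unit_or_nil[of "a + b"] nil_closed assms by blast
  have "u * b = 1 - u * a" using u(2) by (simp add: algebra_simps eq_diff_eq)
  then show False using not_nil_one_minus[OF nil_mult[OF assms(1) u(1)]] nil_mult[OF assms(2) u(1)] by simp
qed

lemma nil_uminus: "nil a \<Longrightarrow> nil (- a)"
  using nil_mult[of a "-1"] by simp

lemma nil_0: "nil 0"
  unfolding nil_def using ideal_zero[OF ideal_\<U>] by (metis power_one_right zero_closed)

lemma \<kappa>_nil: "nil (\<kappa> c) \<Longrightarrow> c = 0"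
  using unit_not_nil \<kappa>_unit by (metis \<kappa>_closed)

text \<open>If all \<open>a - \<kappa> x\<close> were units, factoring into linear factors would
  make every nonzero polynomial in \<open>a\<close> a unit; but finite codimension puts one of them
  into a proper ideal.\<close>

lemma eigenvalue:
  assumes a: "a \<in> A"
  shows "\<exists>x. nil (a - \<kappa> x)"
proof (rule ccontr)
  assume no: "\<nexists>x. nil (a - \<kappa> x)"
  define E where "E p = poly (map_poly \<kappa> p) a" for p
  have E_add: "E (p + q) = E p + E q" for p q
  proof -
    have "map_poly \<kappa> (p + q) = map_poly \<kappa> p + map_poly \<kappa> q"
      by (rule poly_eqI) (simp add: coeff_map_poly \<kappa>_add)
    then show ?thesis by (simp add: E_def)
  qed
  have E_smult: "E (Polynomial.smult c p) = \<kappa> c * E p" for c p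
  proof -
    have "map_poly \<kappa> (Polynomial.smult c p) = Polynomial.smult (\<kappa> c) (map_poly \<kappa> p)"
      by (rule poly_eqI) (simp add: coeff_map_poly \<kappa>_mult)
    then show ?thesis by (simp add: E_def)
  qed
  have E_pCons: "E (pCons c p) = \<kappa> c + a * E p" for c p
    by (simp add: E_def map_poly_pCons)
  have E_0: "E 0 = 0" by (simp add: E_def)
  have unit: "\<exists>b\<in>A. E p * b = 1" if "p \<noteq> 0" for p
    using that
  proof (induction "degree p" arbitrary: p)
    case 0
    then obtain c where c: "p = [:c:]" "c \<noteq> 0" by (metis degree_eq_zeroE pCons_0_0)
    then show ?case using \<kappa>_unit[OF c(2)] by (auto simp: E_pCons E_0)
  next
    case (Suc m)
    then obtain x where "poly p x = 0" using alg_closed_imp_poly_has_root[of p] by auto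
    then obtain q where q: "p = [:- x, 1:] * q" by (auto simp: poly_eq_0_iff_dvd elim: dvdE)
    have "q \<noteq> 0" using q Suc.prems by auto
    moreover have "degree p = Suc (degree q)" using degree_mult_eq[of "[:- x, 1:]" q] q \<open>q \<noteq> 0\<close> by (simp del: mult_pCons_left)
    ultimately obtain b where b: "b \<in> A" "E q * b = 1" using Suc by auto
    obtain u where u: "u \<in> A" "(a - \<kappa> x) * u = 1"
      using unit_or_nil[of "a - \<kappa> x"] no a by blast
    have "p = pCons 0 q + Polynomial.smult (- x) q" unfolding q by simp
    then have "E p = (a - \<kappa> x) * E q"
      by (simp only: E_add E_smult E_pCons \<kappa>_uminus \<kappa>_0) (simp add: algebra_simps)
    then have "E p * (b * u) = ((a - \<kappa> x) * u) * (E q * b)" by (simp add: mult_ac)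
    then show ?case using b u by (metis mult_1 mult_closed)
  qed
  obtain U where U: "U \<in> \<U>" "1 \<notin> U" using proper_ideal by blast
  obtain m c where c: "\<exists>j\<le>m. c j \<noteq> 0" "(\<Sum>j\<le>m. \<kappa> (c j) * a ^ j) \<in> U"
    using finite_codim[OF U(1), of "\<lambda>j. a ^ j"] a by auto
  define P where "P = (\<Sum>j\<le>m. monom (c j) j)"
  have "coeff P j = (if j \<le> m then c j else 0)" for j
    by (simp add: P_def coeff_sum)
  then have "P \<noteq> 0" using c(1) by (metis coeff_0)
  have E_monom: "E (monom c j) = \<kappa> c * a ^ j" for c j
    by (induction j) (simp_all add: monom_0 monom_Suc E_pCons E_0 mult_ac)
  have "E (\<Sum>j\<in>S. monom (c j) j) = (\<Sum>j\<in>S. \<kappa> (c j) * a ^ j)" for S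
    by (induction S rule: infinite_finite_induct) (simp_all add: E_0 E_add E_monom)
  then have "E P \<in> U" using c(2) by (simp add: P_def)
  moreover obtain b where "b \<in> A" "E P * b = 1" using unit[OF \<open>P \<noteq> 0\<close>] by blast
  ultimately show False using ideal_mult_right[OF ideal_\<U>[OF U(1)]] U(2) by metis
qed

definition ev :: "'a \<Rightarrow> 'k" where
  "ev a = (THE x. nil (a - \<kappa> x))"

lemma ev_unique: "nil (a - \<kappa> x) \<Longrightarrow> ev a = x"
  unfolding ev_def
proof (rule the_equality)
  fix y assume 1: "nil (a - \<kappa> x)" and "nil (a - \<kappa> y)"
  then have "nil ((a - \<kappa> x) + - (a - \<kappa> y))" by (intro nil_add nil_uminus)
  then show "y = x" using \<kappa>_nil[of "y - x"] by (simp add: \<kappa>_diff)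
qed

lemma nil_ev: "a \<in> A \<Longrightarrow> nil (a - \<kappa> (ev a))"
  using eigenvalue ev_unique by blast

lemma ev_\<kappa> [simp]: "ev (\<kappa> c) = c"
  by (rule ev_unique) (simp add: nil_0)

lemma ev_1 [simp]: "ev 1 = 1" and ev_0 [simp]: "ev 0 = 0"
  using ev_\<kappa>[of 1] ev_\<kappa>[of 0] by simp_all

lemma ev_add: "a \<in> A \<Longrightarrow> b \<in> A \<Longrightarrow> ev (a + b) = ev a + ev b"
  using nil_add[OF nil_ev[of a] nil_ev[of b]] by (intro ev_unique) (simp add: \<kappa>_add algebra_simps)

lemma ev_mult:
  assumes "a \<in> A" "b \<in> A"
  shows "ev (a * b) = ev a * ev b"
proof (rule ev_unique)
  have "nil (b * (a - \<kappa> (ev a)) + \<kappa> (ev a) * (b - \<kappa> (ev b)))"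
    using assms by (intro nil_add nil_mult nil_ev) auto
  then show "nil (a * b - \<kappa> (ev a * ev b))" by (simp add: \<kappa>_mult algebra_simps)
qed

lemma ev_uminus: "a \<in> A \<Longrightarrow> ev (- a) = - ev a"
  using ev_add[of a "- a"] by (simp add: eq_neg_iff_add_eq_0 add.commute)

lemma ev_diff: "a \<in> A \<Longrightarrow> b \<in> A \<Longrightarrow> ev (a - b) = ev a - ev b"
  using ev_add[of a "- b"] by (simp add: ev_uminus)

lemma ev_power: "a \<in> A \<Longrightarrow> ev (a ^ k) = ev a ^ k"
  by (induction k) (simp_all add: ev_mult)

lemma ev_sum: "(\<And>i. i \<in> S \<Longrightarrow> f i \<in> A) \<Longrightarrow> ev (sum f S) = (\<Sum>i\<in>S. ev (f i))"
  by (induction S rule: infinite_finite_induct) (simp_all add: ev_add sum_closed)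

lemma ev_eq_0_iff: "a \<in> A \<Longrightarrow> ev a = 0 \<longleftrightarrow> nil a"
  using nil_ev[of a] ev_unique[of a 0] by auto

lemma ev_unit: "a \<in> A \<Longrightarrow> ev a \<noteq> 0 \<Longrightarrow> \<exists>b\<in>A. a * b = 1"
  using unit_or_nil ev_eq_0_iff by blast

text \<open>Elements with nonzero residue are units, and a proper ideal contains none.\<close>

lemma ev_open: "\<exists>U\<in>\<U>. \<forall>a\<in>U. ev a = 0"
proof -
  obtain U where U: "U \<in> \<U>" "1 \<notin> U" using proper_ideal by blast
  have "ev a = 0" if a: "a \<in> U" for a
  proof (rule ccontr)
    assume "ev a \<noteq> 0"
    then obtain b where "b \<in> A" "a * b = 1"
      using ev_unit ideal_subset[OF ideal_\<U>[OF U(1)] a] by blast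
    then show False using ideal_mult_right[OF ideal_\<U>[OF U(1)] _ a] U(2) by metis
  qed
  then show ?thesis using U(1) by blast
qed

lemma ideal_ev: "ideal {a\<in>A. ev a = 0}"
  unfolding ideal_def by (auto simp: ev_add ev_mult)

section \<open>Convergent series and continuous operators\<close>

definition tends :: "(nat \<Rightarrow> 'a) \<Rightarrow> 'a \<Rightarrow> bool" where
  "tends s x \<longleftrightarrow> (\<forall>U\<in>\<U>. \<exists>r0. \<forall>r\<ge>r0. x - s r \<in> U)"

lemma tends_eventually_0: "tends s x \<Longrightarrow> x \<in> A \<Longrightarrow> (\<And>U. U \<in> \<U> \<Longrightarrow> \<exists>r0. \<forall>r\<ge>r0. s r \<in> U) \<Longrightarrow> x = 0"
proof (rule separated)
  fix U assume *: "tends s x" "\<And>U. U \<in> \<U> \<Longrightarrow> \<exists>r0. \<forall>r\<ge>r0. s r \<in> U" and U: "U \<in> \<U>"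
  obtain r1 r2 where r: "\<And>r. r \<ge> r1 \<Longrightarrow> x - s r \<in> U" "\<And>r. r \<ge> r2 \<Longrightarrow> s r \<in> U"
    using * U unfolding tends_def by meson
  have "(x - s (max r1 r2)) + s (max r1 r2) \<in> U"
    by (intro ideal_add[OF ideal_\<U>[OF U]] r) auto
  then show "x \<in> U" by simp
qed

lemma partial_sums_diff:
  fixes t :: "nat \<Rightarrow> 'a"
  assumes "ideal U" "\<And>k. k \<ge> K \<Longrightarrow> t k \<in> U" "K \<le> r"
  shows "(\<Sum>k<r. t k) - (\<Sum>k<K. t k) \<in> U"
  using assms(3)
proof (induction r rule: dec_induct)
  case (step r)
  then show ?case using ideal_add[OF assms(1) step.IH assms(2)[OF step.hyps(1)]] by (simp add: algebra_simps)
qed (use ideal_zero[OF assms(1)] in simp)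

text \<open>The topology is given by ideals, so null terms suffice: tails stay inside an ideal, and
  the partial sums cut off at \<open>K U\<close> form a compatible system.\<close>

lemma series_converges:
  assumes t: "\<And>k. t k \<in> A" and null: "\<And>U. U \<in> \<U> \<Longrightarrow> \<exists>K. \<forall>k\<ge>K. t k \<in> U"
  shows "\<exists>x\<in>A. tends (\<lambda>r. \<Sum>k<r. t k) x"
proof -
  have "\<forall>U\<in>\<U>. \<exists>K. \<forall>k\<ge>K. t k \<in> U" using null by blast
  then obtain K where K: "\<And>U k. U \<in> \<U> \<Longrightarrow> k \<ge> K U \<Longrightarrow> t k \<in> U" by metis
  define z where "z U = (\<Sum>k<K U. t k)" for U
  have "z U \<in> A" for U unfolding z_def using t by (intro sum_closed)
  moreover have "z V - z U \<in> U" if UV: "U \<in> \<U>" "V \<in> \<U>" "V \<subseteq> U" for U V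
  proof -
    let ?m = "max (K U) (K V)"
    note U' = ideal_\<U>[OF UV(1)]
    have "(\<Sum>k<?m. t k) - z U \<in> U"
      unfolding z_def by (rule partial_sums_diff[OF U' K[OF UV(1)]]) auto
    moreover have "(\<Sum>k<?m. t k) - z V \<in> U"
      unfolding z_def by (rule partial_sums_diff[OF U' subsetD[OF UV(3) K[OF UV(2)]]]) auto
    ultimately have "((\<Sum>k<?m. t k) - z U) - ((\<Sum>k<?m. t k) - z V) \<in> U" by (rule ideal_diff[OF U'])
    then show ?thesis by simp
  qed
  ultimately obtain x where x: "x \<in> A" "\<And>U. U \<in> \<U> \<Longrightarrow> x - z U \<in> U" using complete[of z] by blast
  have "x - (\<Sum>k<r. t k) \<in> U" if U: "U \<in> \<U>" and r: "K U \<le> r" for U r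
  proof -
    note U' = ideal_\<U>[OF U]
    have "(x - z U) - ((\<Sum>k<r. t k) - z U) \<in> U"
      unfolding z_def by (intro ideal_diff[OF U'] x(2)[OF U, unfolded z_def] partial_sums_diff[OF U' K[OF U] r])
    then show ?thesis by simp
  qed
  then show ?thesis unfolding tends_def using x(1) by blast
qed

text \<open>Continuity is asked at 0 only, which is enough for additive maps.\<close>

definition linop :: "('a \<Rightarrow> 'a) \<Rightarrow> bool" where
  "linop F \<longleftrightarrow> (\<forall>x\<in>A. F x \<in> A) \<and> (\<forall>x\<in>A. \<forall>y\<in>A. F (x + y) = F x + F y) \<and>
    (\<forall>c. \<forall>x\<in>A. F (\<kappa> c * x) = \<kappa> c * F x) \<and> (\<forall>U\<in>\<U>. \<exists>V\<in>\<U>. \<forall>x\<in>V. F x \<in> U)"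

lemma linop_closed: "linop F \<Longrightarrow> x \<in> A \<Longrightarrow> F x \<in> A"
  and linop_add: "linop F \<Longrightarrow> x \<in> A \<Longrightarrow> y \<in> A \<Longrightarrow> F (x + y) = F x + F y"
  and linop_scale: "linop F \<Longrightarrow> x \<in> A \<Longrightarrow> F (\<kappa> c * x) = \<kappa> c * F x"
  and linop_cont: "linop F \<Longrightarrow> U \<in> \<U> \<Longrightarrow> \<exists>V\<in>\<U>. \<forall>x\<in>V. F x \<in> U"
  unfolding linop_def by blast+

lemma linop_0: "linop F \<Longrightarrow> F 0 = 0"
  using linop_add[of F 0 0] by simp

lemma linop_diff: "linop F \<Longrightarrow> x \<in> A \<Longrightarrow> y \<in> A \<Longrightarrow> F (x - y) = F x - F y"
  using linop_add[of F "x - y" y] by (simp add: algebra_simps)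

lemma linop_sum: "linop F \<Longrightarrow> (\<And>i. i \<in> S \<Longrightarrow> f i \<in> A) \<Longrightarrow> F (sum f S) = (\<Sum>i\<in>S. F (f i))"
  by (induction S rule: infinite_finite_induct) (simp_all add: linop_0 linop_add sum_closed)

lemma linop_funpow_closed: "linop F \<Longrightarrow> x \<in> A \<Longrightarrow> (F ^^ k) x \<in> A"
  by (induction k) (simp_all add: linop_closed)

lemma linop_compose:
  assumes F: "linop F" and H: "linop H"
  shows "linop (\<lambda>x. F (H x))"
  unfolding linop_def
proof (intro conjI ballI allI)
  fix U assume "U \<in> \<U>"
  then show "\<exists>V\<in>\<U>. \<forall>x\<in>V. F (H x) \<in> U" using linop_cont[OF F] linop_cont[OF H] by meson
qed (simp_all add: linop_closed linop_add linop_scale F H)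

lemma linop_mult: "a \<in> A \<Longrightarrow> linop (\<lambda>x. a * x)"
  unfolding linop_def
proof (intro conjI ballI allI)
  fix U assume "a \<in> A" "U \<in> \<U>"
  then show "\<exists>V\<in>\<U>. \<forall>x\<in>V. a * x \<in> U" using ideal_mult[OF ideal_\<U>] by blast
qed (simp_all add: distrib_left mult.left_commute)

lemma linop_plus:
  assumes F: "linop F" and H: "linop H"
  shows "linop (\<lambda>x. F x + H x)"
  unfolding linop_def
proof (intro conjI ballI allI)
  fix U assume U: "U \<in> \<U>"
  obtain V W where "V \<in> \<U>" "W \<in> \<U>" "\<forall>x\<in>V. F x \<in> U" "\<forall>x\<in>W. H x \<in> U"
    using linop_cont[OF F U] linop_cont[OF H U] by blast
  then show "\<exists>V\<in>\<U>. \<forall>x\<in>V. F x + H x \<in> U"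
    using ideal_add[OF ideal_\<U>[OF U]] Int_\<U> by (intro bexI[of _ "V \<inter> W"]) auto
qed (simp_all add: linop_closed linop_add linop_scale F H distrib_left)

lemma linop_id: "linop (\<lambda>x. x)"
  unfolding linop_def by auto

lemma linop_minus: "linop F \<Longrightarrow> linop H \<Longrightarrow> linop (\<lambda>x. F x - H x)"
  using linop_plus[of F "\<lambda>x. -1 * H x"] linop_compose[OF linop_mult[of "-1"], of H] by simp

lemma tends_linop:
  assumes F: "linop F" and s: "tends s x" "\<And>r. s r \<in> A" "x \<in> A"
  shows "tends (\<lambda>r. F (s r)) (F x)"
  unfolding tends_def
proof
  fix U assume U: "U \<in> \<U>"
  obtain V where V: "V \<in> \<U>" "\<And>x. x \<in> V \<Longrightarrow> F x \<in> U" using linop_cont[OF F U] by blast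
  obtain r0 where "\<And>r. r \<ge> r0 \<Longrightarrow> x - s r \<in> V" using s(1) V(1) unfolding tends_def by blast
  then show "\<exists>r0. \<forall>r\<ge>r0. F x - F (s r) \<in> U"
    using V(2) linop_diff[OF F s(3,2)] by metis
qed

text \<open>The witness is \<open>\<Sum>k. (- x)^k / k! * (D ^^ k) f\<close>, on which \<open>D\<close> telescopes.\<close>
lemma kernel_element:
  assumes D: "linop D" and x: "nil x" and Dx: "\<And>h. h \<in> A \<Longrightarrow> D (x * h) = h + x * D h" and f: "f \<in> A"
  obtains z where "z \<in> A" "D z = 0" "ev z = ev f"
    "\<And>H. linop H \<Longrightarrow> (\<And>h. h \<in> A \<Longrightarrow> H (x * h) = x * H h) \<Longrightarrow>
      (\<And>h. h \<in> A \<Longrightarrow> H (D h) = D (H h)) \<Longrightarrow> H f = 0 \<Longrightarrow> H z = 0"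
proof -
  define c :: "nat \<Rightarrow> 'k" where "c k = (-1) ^ k / fact k" for k
  define t where "t k = \<kappa> (c k) * (x ^ k * (D ^^ k) f)" for k
  have xA: "x \<in> A" using x by (rule nil_closed)
  have DkA: "(D ^^ k) f \<in> A" for k by (rule linop_funpow_closed[OF D f])
  have tA: "t k \<in> A" for k unfolding t_def using xA DkA by blast
  have t_U: "\<exists>K. \<forall>k\<ge>K. t k \<in> U" if U: "U \<in> \<U>" for U
  proof -
    note U' = ideal_\<U>[OF U]
    obtain s where s: "x ^ s \<in> U" using nilD[OF x U] by blast
    have "t k \<in> U" if "k \<ge> s" for k
      unfolding t_def
      by (intro ideal_mult[OF U' \<kappa>_closed] ideal_mult_right[OF U' DkA] ideal_power_le[OF U' xA s that])
    then show ?thesis by blast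
  qed
  obtain z where z: "z \<in> A" "tends (\<lambda>r. \<Sum>k<r. t k) z"
    using series_converges[of t] tA t_U by blast
  have sA: "(\<Sum>k<r. t k) \<in> A" for r using tA by (rule sum_closed)
  have Dpow: "D (x ^ k * h) = of_nat k * (x ^ (k - 1) * h) + x ^ k * D h" if "h \<in> A" for k h
    using that
  proof (induction k arbitrary: h)
    case (Suc k)
    have "D (x ^ Suc k * h) = x ^ k * h + x * D (x ^ k * h)"
      using Dx[of "x ^ k * h"] xA Suc.prems by (simp add: mult.assoc)
    also have "\<dots> = of_nat (Suc k) * (x ^ k * h) + x ^ Suc k * D h"
      unfolding Suc.IH[OF Suc.prems] by (cases k) (simp_all add: algebra_simps)
    finally show ?case by simp
  qed simp
  have c_Suc: "c (Suc k) * of_nat (Suc k) = - c k" for k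
    by (simp add: c_def field_simps del: of_nat_Suc)
  \<comment> \<open>Only the last term survives the telescoping, and its factor \<open>x ^ r\<close>
    tends to 0.\<close>
  have tele: "D (\<Sum>k<Suc r. t k) = \<kappa> (c r) * (x ^ r * (D ^^ Suc r) f)" for r
  proof (induction r)
    case (Suc r)
    have "D (t (Suc r)) = \<kappa> (c (Suc r)) * (of_nat (Suc r) * (x ^ r * (D ^^ Suc r) f) + x ^ Suc r * (D ^^ Suc (Suc r)) f)"
      unfolding t_def linop_scale[OF D mult_closed[OF power_closed[OF xA] DkA]] Dpow[OF DkA] by simp
    also have "\<dots> = \<kappa> (c (Suc r) * of_nat (Suc r)) * (x ^ r * (D ^^ Suc r) f)
        + \<kappa> (c (Suc r)) * (x ^ Suc r * (D ^^ Suc (Suc r)) f)"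
      by (simp only: \<kappa>_mult \<kappa>_of_nat distrib_left mult.assoc)
    finally show ?case
      using Suc linop_add[OF D sA tA, of "Suc r" "Suc r"] unfolding c_Suc \<kappa>_uminus
      by (simp only: sum.lessThan_Suc[of t "Suc r"]) simp
  next
    case 0
    then show ?case by (simp add: t_def c_def)
  qed
  have "D z = 0"
  proof (rule tends_eventually_0[OF tends_linop[OF D z(2) sA z(1)]])
    show "D z \<in> A" using D z(1) by (rule linop_closed)
    fix U assume U: "U \<in> \<U>"
    note U' = ideal_\<U>[OF U]
    obtain s where s: "x ^ s \<in> U" using nilD[OF x U] by blast
    have "D (\<Sum>k<r. t k) \<in> U" if r: "r \<ge> Suc s" for r
    proof -
      obtain r' where r': "r = Suc r'" "s \<le> r'" using r by (cases r) auto
      show ?thesis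
        unfolding r'(1) tele
        by (intro ideal_mult[OF U' \<kappa>_closed] ideal_mult_right[OF U' DkA] ideal_power_le[OF U' xA s r'(2)])
    qed
    then show "\<exists>r0. \<forall>r\<ge>r0. D (\<Sum>k<r. t k) \<in> U" by blast
  qed
  moreover have "ev z = ev f"
  proof -
    obtain U where U: "U \<in> \<U>" "\<And>a. a \<in> U \<Longrightarrow> ev a = 0" using ev_open by blast
    obtain r where r: "\<And>r'. r' \<ge> r \<Longrightarrow> z - (\<Sum>k<r'. t k) \<in> U" using z(2) U(1) unfolding tends_def by blast
    have "ev (z - (\<Sum>k<Suc r. t k)) = 0" by (rule U(2)[OF r]) simp
    then have "ev z = (\<Sum>k<Suc r. ev (t k))" 
      using ev_diff[OF z(1) sA[of "Suc r"]] ev_sum[of "{..<Suc r}" t] tA by (simp del: sum.lessThan_Suc)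
    \<comment> \<open>Terms with \<open>k > 0\<close> contain a power of \<open>x\<close>, whose
      residue is 0.\<close>
    also have "\<dots> = (\<Sum>k<Suc r. if k = 0 then ev f else 0)"
    proof (rule sum.cong[OF refl])
      fix k
      have "ev x = 0" using x ev_eq_0_iff[OF xA] by simp
      then have "ev (t k) = c k * (0 ^ k * ev ((D ^^ k) f))"
        unfolding t_def using xA DkA by (simp add: ev_mult ev_power)
      then show "ev (t k) = (if k = 0 then ev f else 0)" by (cases k) (simp_all add: c_def)
    qed
    finally show ?thesis by simp
  qed
  moreover have "H z = 0" if H: "linop H" and Hx: "\<And>h. h \<in> A \<Longrightarrow> H (x * h) = x * H h"
    and HD: "\<And>h. h \<in> A \<Longrightarrow> H (D h) = D (H h)" and Hf: "H f = 0" for H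
  proof (rule tends_eventually_0[OF tends_linop[OF H z(2) sA z(1)]])
    show "H z \<in> A" using H z(1) by (rule linop_closed)
    have Hxk: "H (x ^ k * h) = x ^ k * H h" if "h \<in> A" for k h
      using that
    proof (induction k arbitrary: h)
      case (Suc k)
      have "H (x ^ Suc k * h) = H (x * (x ^ k * h))" by (simp add: mult.assoc)
      also have "\<dots> = x * (x ^ k * H h)" using Hx[of "x ^ k * h"] Suc.IH[OF Suc.prems] xA Suc.prems by simp
      finally show ?case by (simp add: mult.assoc)
    qed simp
    have HDk: "H ((D ^^ k) f) = 0" for k
    proof (induction k)
      case (Suc k)
      then show ?case using HD[OF DkA] linop_0[OF D] by simp
    qed (simp add: Hf)
    have "H (t k) = 0" for k
      unfolding t_def linop_scale[OF H mult_closed[OF power_closed[OF xA] DkA]] Hxk[OF DkA] HDk by simp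
    then have "H (\<Sum>k<r. t k) = 0" for r using linop_sum[OF H, of "{..<r}" t] tA by simp
    then show "\<exists>r0. \<forall>r\<ge>r0. H (\<Sum>k<r. t k) \<in> U" if "U \<in> \<U>" for U
      using ideal_zero[OF ideal_\<U>[OF that]] by simp
  qed
  ultimately show thesis using that z(1) by blast
qed

end

section \<open>Taylor expansion\<close>

lemma mps_coeff_mult: "mps_coeff (f * g) e = (\<Sum>(a, b)\<in>splits e. mps_coeff f a * mps_coeff g b)"
  by (simp add: times_mps.rep_eq case_prod_beta)

lemma single_minus_add:
  fixes a :: "nat \<Rightarrow>\<^sub>0 nat"
  assumes "Poly_Mapping.lookup a j \<noteq> 0"
  shows "a - Poly_Mapping.single j 1 + Poly_Mapping.single j 1 = a"
  by (rule poly_mapping_eqI) (use assms in \<open>auto simp: lookup_add lookup_minus lookup_single when_def\<close>)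

text \<open>The exponent at \<open>j\<close> of \<open>e + ?s\<close> is the sum of the exponents of
  \<open>a\<close> and \<open>b\<close>, which splits the Cauchy product into two sums; lowering one
  exponent by \<open>?s\<close> identifies each of them.\<close>

lemma mps_deriv_mult:
  fixes f g :: "'k::comm_ring_1 mps"
  shows "mps_deriv j (f * g) = mps_deriv j f * g + f * mps_deriv j g"
proof (rule mps_eqI)
  fix e
  let ?s = "Poly_Mapping.single j (1 :: nat)"
  have part: "(\<Sum>(a, b)\<in>splits (e + ?s). of_nat (Poly_Mapping.lookup a j) * mps_coeff f a * mps_coeff g b)
      = mps_coeff (mps_deriv j f * g) e" for f g :: "'k mps"
  proof -
    have "(\<Sum>(a, b)\<in>splits (e + ?s). of_nat (Poly_Mapping.lookup a j) * mps_coeff f a * mps_coeff g b)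
        = (\<Sum>(a, b)\<in>{(a, b)\<in>splits (e + ?s). Poly_Mapping.lookup a j \<noteq> 0}.
            of_nat (Poly_Mapping.lookup a j) * mps_coeff f a * mps_coeff g b)"
      by (rule sum.mono_neutral_right) (auto intro!: gr0I)
    also have "\<dots> = (\<Sum>(a, b)\<in>splits e. of_nat (Poly_Mapping.lookup a j + 1) * mps_coeff f (a + ?s) * mps_coeff g b)"
    proof (rule sum.reindex_bij_witness[where i = "\<lambda>(a, b). (a + ?s, b)" and j = "\<lambda>(a, b). (a - ?s, b)"])
      fix p assume "p \<in> {(a, b)\<in>splits (e + ?s). Poly_Mapping.lookup a j \<noteq> 0}"
      then obtain a b where p: "p = (a, b)" "a + b = e + ?s" "Poly_Mapping.lookup a j \<noteq> 0"
        by (auto simp: splits_def)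
      note 1 = single_minus_add[OF p(3)]
      have "(a - ?s + b) + ?s = (a - ?s + ?s) + b" by (simp add: add_ac)
      also have "\<dots> = e + ?s" using p(2) by (simp only: 1)
      finally have 2: "a - ?s + b = e" by simp
      show "(case case p of (a, b) \<Rightarrow> (a - ?s, b) of (a, b) \<Rightarrow> (a + ?s, b)) = p"
        using 1 by (simp add: p(1))
      show "(case p of (a, b) \<Rightarrow> (a - ?s, b)) \<in> splits e"
        using 2 by (simp add: p(1) splits_def)
      have "Poly_Mapping.lookup (a - ?s) j + 1 = Poly_Mapping.lookup a j"
        using p(3) by (simp add: lookup_minus)
      then show "(case case p of (a, b) \<Rightarrow> (a - ?s, b) of
          (a, b) \<Rightarrow> of_nat (Poly_Mapping.lookup a j + 1) * mps_coeff f (a + ?s) * mps_coeff g b)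
        = (case p of (a, b) \<Rightarrow> of_nat (Poly_Mapping.lookup a j) * mps_coeff f a * mps_coeff g b)"
        using 1 by (simp only: p(1) prod.case)
    next
      fix p assume "p \<in> splits e"
      then show "(case case p of (a, b) \<Rightarrow> (a + ?s, b) of (a, b) \<Rightarrow> (a - ?s, b)) = p"
        "(case p of (a, b) \<Rightarrow> (a + ?s, b)) \<in> {(a, b)\<in>splits (e + ?s). Poly_Mapping.lookup a j \<noteq> 0}"
        by (auto simp: splits_def lookup_add add_ac)
    qed
    finally show ?thesis by (simp only: mps_coeff_mult mps_deriv.rep_eq)
  qed
  have "mps_coeff (mps_deriv j (f * g)) e
      = (\<Sum>(a, b)\<in>splits (e + ?s). of_nat (Poly_Mapping.lookup (e + ?s) j) * (mps_coeff f a * mps_coeff g b))"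
    by (simp add: mps_deriv.rep_eq mps_coeff_mult sum_distrib_left case_prod_beta lookup_add)
  also have "\<dots> = (\<Sum>(a, b)\<in>splits (e + ?s). of_nat (Poly_Mapping.lookup a j) * mps_coeff f a * mps_coeff g b
      + of_nat (Poly_Mapping.lookup b j) * mps_coeff g b * mps_coeff f a)"
  proof (rule sum.cong[OF refl])
    fix p assume "p \<in> splits (e + ?s)"
    then obtain a b where p: "p = (a, b)" "a + b = e + ?s" by (auto simp: splits_def)
    show "(case p of (a, b) \<Rightarrow> of_nat (Poly_Mapping.lookup (e + ?s) j) * (mps_coeff f a * mps_coeff g b))
      = (case p of (a, b) \<Rightarrow> of_nat (Poly_Mapping.lookup a j) * mps_coeff f a * mps_coeff g b
      + of_nat (Poly_Mapping.lookup b j) * mps_coeff g b * mps_coeff f a)"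
      unfolding p(1) prod.case p(2)[symmetric] lookup_add by (simp add: algebra_simps)
  qed
  also have "\<dots> = mps_coeff (mps_deriv j f * g) e
      + (\<Sum>(a, b)\<in>splits (e + ?s). of_nat (Poly_Mapping.lookup b j) * mps_coeff g b * mps_coeff f a)"
    by (simp add: case_prod_beta sum.distrib part[symmetric])
  also have "(\<Sum>(a, b)\<in>splits (e + ?s). of_nat (Poly_Mapping.lookup b j) * mps_coeff g b * mps_coeff f a)
      = (\<Sum>(a, b)\<in>splits (e + ?s). of_nat (Poly_Mapping.lookup a j) * mps_coeff g a * mps_coeff f b)"
    by (rule sum.reindex_bij_witness[where i = prod.swap and j = prod.swap])
       (auto simp: splits_def add.commute)
  also have "\<dots> = mps_coeff (f * mps_deriv j g) e"
    by (simp only: part mult.commute[of f])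
  finally show "mps_coeff (mps_deriv j (f * g)) e = mps_coeff (mps_deriv j f * g + f * mps_deriv j g) e"
    by (simp add: plus_mps.rep_eq)
qed

text \<open>Serves as induction step on exponents: in characteristic 0 the derivative determines
  every coefficient with a positive exponent at \<open>i\<close>.\<close>

lemma mps_coeff_add_single:
  fixes f :: "'k::field_char_0 mps"
  shows "mps_coeff f (k + Poly_Mapping.single i 1)
    = mps_coeff (mps_deriv i f) k / of_nat (Poly_Mapping.lookup k i + 1)"
proof -
  have "of_nat (Poly_Mapping.lookup k i + 1) \<noteq> (0 :: 'k)" by (simp del: of_nat_add of_nat_Suc)
  then show ?thesis by (simp add: mps_deriv.rep_eq del: of_nat_add of_nat_Suc)
qed

lemma mps_vars_coeff: "f \<in> mps_vars m \<Longrightarrow> \<not> Poly_Mapping.keys k \<subseteq> {..<m} \<Longrightarrow> mps_coeff f k = 0"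
  unfolding mps_vars_def by blast

lemma keys_add_nat: "Poly_Mapping.keys (a + b) = Poly_Mapping.keys a \<union> Poly_Mapping.keys (b :: nat \<Rightarrow>\<^sub>0 nat)"
  by (auto simp: in_keys_iff lookup_add)

lemma mps_vars_mult:
  assumes "f \<in> mps_vars m" "g \<in> mps_vars m"
  shows "f * g \<in> mps_vars m"
  unfolding mps_vars_def
proof (intro CollectI allI impI)
  fix e assume "mps_coeff (f * g) e \<noteq> 0"
  then obtain p where "p \<in> splits e" "(case p of (a, b) \<Rightarrow> mps_coeff f a * mps_coeff g b) \<noteq> 0"
    unfolding mps_coeff_mult by (meson sum.not_neutral_contains_not_neutral)
  then obtain a b where ab': "a + b = e" "mps_coeff f a * mps_coeff g b \<noteq> 0"
    by (auto simp: splits_def)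
  then have ab: "a + b = e" "mps_coeff f a \<noteq> 0" "mps_coeff g b \<noteq> 0" by auto
  then have "Poly_Mapping.keys a \<subseteq> {..<m}" "Poly_Mapping.keys b \<subseteq> {..<m}"
    using mps_vars_coeff assms by metis+
  then show "Poly_Mapping.keys e \<subseteq> {..<m}" using ab(1) keys_add_nat[of a b] by auto
qed

lemma mps_vars_diff:
  assumes "f \<in> mps_vars m" "g \<in> mps_vars m"
  shows "f - g \<in> mps_vars m"
  unfolding mps_vars_def
proof (intro CollectI allI impI, rule ccontr)
  fix k assume "mps_coeff (f - g) k \<noteq> 0" "\<not> Poly_Mapping.keys k \<subseteq> {..<m}"
  then show False
    using mps_vars_coeff[OF assms(1)] mps_vars_coeff[OF assms(2)] by (simp add: minus_mps.rep_eq)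
qed

lemma mps_coeff_mult_0: "mps_coeff (f * g) 0 = mps_coeff f 0 * mps_coeff g 0"
proof -
  have "splits 0 = {(0, 0)}"
  proof -
    have "a = 0 \<and> b = 0" if "a + b = (0 :: nat \<Rightarrow>\<^sub>0 nat)" for a b
    proof -
      have "Poly_Mapping.lookup a x + Poly_Mapping.lookup b x = 0" for x
        using arg_cong[OF that, of "\<lambda>c. Poly_Mapping.lookup c x"] by (simp add: lookup_add)
      then have "Poly_Mapping.lookup a x = 0" "Poly_Mapping.lookup b x = 0" for x
        unfolding add_is_0 by blast+
      then show ?thesis by (simp add: poly_mapping_eq_iff fun_eq_iff)
    qed
    then have "splits 0 \<subseteq> {(0, 0)}" unfolding splits_def by blast
    moreover have "(0, 0) \<in> splits 0" by (simp add: splits_def)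
    ultimately show ?thesis by blast
  qed
  then show ?thesis by (simp add: mps_coeff_mult)
qed

text \<open>The coefficients are discrete, so a basic neighbourhood fixes finitely many of
  them.\<close>

lemma openin_mps_topology:
  "openin (mps_topology m) V \<longleftrightarrow> V \<subseteq> mps_vars m \<and>
    (\<forall>f\<in>V. \<exists>K. finite K \<and> (\<forall>g\<in>mps_vars m. (\<forall>k\<in>K. mps_coeff g k = mps_coeff f k) \<longrightarrow> g \<in> V))"
    (is "_ \<longleftrightarrow> ?R")
proof
  assume "openin (mps_topology m) V"
  then obtain W where W: "openin (product_topology (\<lambda>_. discrete_topology UNIV) UNIV) W"
    "V = mps_coeff -` W \<inter> mps_vars m"
    unfolding mps_topology_def openin_pullback_topology by blast
  show ?R
  proof (intro conjI ballI)
    fix f assume "f \<in> V"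
    then have "mps_coeff f \<in> W" using W(2) by simp
    then obtain X where X: "finite {i. X i \<noteq> UNIV}" "mps_coeff f \<in> Pi\<^sub>E UNIV X" "Pi\<^sub>E UNIV X \<subseteq> W"
      using W(1) unfolding openin_product_topology_alt by (auto simp: Pi_iff PiE_iff)
    have "g \<in> V" if "g \<in> mps_vars m" "\<forall>k\<in>{i. X i \<noteq> UNIV}. mps_coeff g k = mps_coeff f k" for g
    proof -
      have "mps_coeff g i \<in> X i" for i
        using X(2) that(2) by (cases "X i = UNIV") (auto simp: PiE_iff)
      then show ?thesis using X(3) that(1) W(2) by (auto simp: PiE_iff)
    qed
    then show "\<exists>K. finite K \<and> (\<forall>g\<in>mps_vars m. (\<forall>k\<in>K. mps_coeff g k = mps_coeff f k) \<longrightarrow> g \<in> V)"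
      using X(1) by blast
  qed (use W(2) in auto)
next
  assume R: ?R
  define W where "W = \<Union>{Pi\<^sub>E UNIV X | X. finite {i. X i \<noteq> UNIV} \<and> mps_coeff -` (Pi\<^sub>E UNIV X) \<inter> mps_vars m \<subseteq> V}"
  have "openin (product_topology (\<lambda>_. discrete_topology UNIV) UNIV) W"
    unfolding W_def
  proof (rule openin_Union)
    fix Y assume "Y \<in> {Pi\<^sub>E UNIV X | X. finite {i. X i \<noteq> UNIV} \<and> mps_coeff -` (Pi\<^sub>E UNIV X) \<inter> mps_vars m \<subseteq> V}"
    then show "openin (product_topology (\<lambda>_. discrete_topology UNIV) UNIV) Y"
      by (auto intro!: openin_PiE_gen[THEN iffD2])
  qed
  moreover have "V = mps_coeff -` W \<inter> mps_vars m"
  proof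
    show "V \<subseteq> mps_coeff -` W \<inter> mps_vars m"
    proof
      fix f assume f: "f \<in> V"
      then obtain K where K: "finite K" "\<And>g. g \<in> mps_vars m \<Longrightarrow> \<forall>k\<in>K. mps_coeff g k = mps_coeff f k \<Longrightarrow> g \<in> V"
        using R by blast
      define X where "X i = (if i \<in> K then {mps_coeff f i} else UNIV)" for i
      have "{i. X i \<noteq> UNIV} \<subseteq> K" by (auto simp: X_def)
      then have "finite {i. X i \<noteq> UNIV}" using K(1) finite_subset by blast
      moreover have "mps_coeff -` (Pi\<^sub>E UNIV X) \<inter> mps_vars m \<subseteq> V"
        using K(2) by (force simp: PiE_iff X_def split: if_splits)
      moreover have "mps_coeff f \<in> Pi\<^sub>E UNIV X" by (auto simp: X_def PiE_iff)
      ultimately have "mps_coeff f \<in> W" unfolding W_def by blast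
      then show "f \<in> mps_coeff -` W \<inter> mps_vars m" using f R by auto
    qed
  qed (auto simp: W_def)
  ultimately show "openin (mps_topology m) V"
    unfolding mps_topology_def openin_pullback_topology by blast
qed

lemma topspace_mps_topology: "topspace (mps_topology m) = mps_vars m"
  unfolding mps_topology_def topspace_pullback_topology by auto

section \<open>The Taylor map of commuting derivations\<close>

locale power_series_coords = connected_alg A \<kappa> \<U>
  for A :: "'a::comm_ring_1 set" and \<kappa> :: "'k::{alg_closed_field, field_char_0} \<Rightarrow> 'a" and \<U> +
  fixes m :: nat and \<delta> :: "nat \<Rightarrow> 'a \<Rightarrow> 'a" and z :: "nat \<Rightarrow> 'a"
  assumes linop_\<delta>: "i < m \<Longrightarrow> linop (\<delta> i)"
    and \<delta>_mult: "i < m \<Longrightarrow> x \<in> A \<Longrightarrow> y \<in> A \<Longrightarrow> \<delta> i (x * y) = \<delta> i x * y + x * \<delta> i y"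
    and \<delta>_commute: "i < m \<Longrightarrow> j < m \<Longrightarrow> x \<in> A \<Longrightarrow> \<delta> i (\<delta> j x) = \<delta> j (\<delta> i x)"
    and nil_z: "i < m \<Longrightarrow> nil (z i)"
    and \<delta>_z: "i < m \<Longrightarrow> j < m \<Longrightarrow> \<delta> i (z j) = (if i = j then 1 else 0)"
    and \<delta>_simple: "ideal I \<Longrightarrow> (\<And>x. x \<in> I \<Longrightarrow> ev x = 0) \<Longrightarrow>
      (\<And>i x. i < m \<Longrightarrow> x \<in> I \<Longrightarrow> \<delta> i x \<in> I) \<Longrightarrow> I = {0}"
begin

lemma \<delta>_closed [simp, intro]: "i < m \<Longrightarrow> x \<in> A \<Longrightarrow> \<delta> i x \<in> A"
  using linop_\<delta> linop_closed by blast

lemma z_closed [simp, intro]: "i < m \<Longrightarrow> z i \<in> A"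
  using nil_z nil_closed by blast

lemma \<delta>_1: "i < m \<Longrightarrow> \<delta> i 1 = 0"
  using \<delta>_mult[of i 1 1] by simp

text \<open>The mixed derivative in the first \<open>j\<close> directions, taken in a fixed order to
  allow recursion; commutation enters through \<open>funpow_\<delta>\<close>.\<close>

fun dpow :: "nat \<Rightarrow> (nat \<Rightarrow>\<^sub>0 nat) \<Rightarrow> 'a \<Rightarrow> 'a" where
  "dpow 0 k x = x"
| "dpow (Suc j) k x = (\<delta> j ^^ Poly_Mapping.lookup k j) (dpow j k x)"

lemma linop_funpow: "linop F \<Longrightarrow> linop (F ^^ l)"
proof (induction l)
  case (Suc l)
  then show ?case using linop_compose[of F "F ^^ l"] by (simp add: comp_def)
qed (simp add: linop_id id_def)

lemma linop_dpow: "j \<le> m \<Longrightarrow> linop (dpow j k)"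
proof (induction j)
  case (Suc j)
  then show ?case
    using linop_compose[OF linop_funpow[OF linop_\<delta>[of j]], of "dpow j k"] by (simp add: fun_eq_iff)
next
  case 0
  have "dpow 0 k = (\<lambda>x. x)" by (simp add: fun_eq_iff)
  then show ?case using linop_id by simp
qed

lemma dpow_closed [simp, intro]: "j \<le> m \<Longrightarrow> x \<in> A \<Longrightarrow> dpow j k x \<in> A"
  using linop_dpow linop_closed by blast

lemma funpow_\<delta>: "i < m \<Longrightarrow> j < m \<Longrightarrow> x \<in> A \<Longrightarrow> (\<delta> j ^^ l) (\<delta> i x) = \<delta> i ((\<delta> j ^^ l) x)"
proof (induction l)
  case (Suc l)
  then show ?case
    using \<delta>_commute[of j i "(\<delta> j ^^ l) x"] linop_funpow_closed[OF linop_\<delta>, of j x l] by simp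
qed simp

lemma dpow_\<delta>: "j \<le> m \<Longrightarrow> i < m \<Longrightarrow> x \<in> A \<Longrightarrow> dpow j k (\<delta> i x) = \<delta> i (dpow j k x)"
  by (induction j) (simp_all add: funpow_\<delta>)

lemma dpow_add_single: "j \<le> m \<Longrightarrow> i < m \<Longrightarrow> x \<in> A \<Longrightarrow>
    dpow j (k + Poly_Mapping.single i 1) x = (if i < j then \<delta> i (dpow j k x) else dpow j k x)"
proof (induction j)
  case (Suc j)
  consider "i < j" | "i = j" | "i > j" by linarith
  then show ?case
  proof cases
    case 1
    then show ?thesis using Suc by (simp add: lookup_add lookup_single funpow_\<delta>)
  next
    case 2
    then show ?thesis using Suc by (simp add: lookup_add lookup_single)
  next
    case 3
    then show ?thesis using Suc by (simp add: lookup_add lookup_single)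
  qed
qed simp

definition kfact :: "(nat \<Rightarrow>\<^sub>0 nat) \<Rightarrow> 'k" where
  "kfact k = (\<Prod>i<m. fact (Poly_Mapping.lookup k i))"

lemma kfact_nonzero [simp]: "kfact k \<noteq> 0"
  by (simp add: kfact_def)

lemma kfact_0: "kfact 0 = 1"
  by (simp add: kfact_def)

lemma kfact_add_single:
  assumes "i < m"
  shows "kfact (k + Poly_Mapping.single i 1) = of_nat (Poly_Mapping.lookup k i + 1) * kfact k"
proof -
  have *: "kfact l = fact (Poly_Mapping.lookup l i) * (\<Prod>j\<in>{..<m} - {i}. fact (Poly_Mapping.lookup l j))" for l
    unfolding kfact_def by (subst prod.remove[of _ i]) (use assms in auto)
  have "(\<Prod>j\<in>{..<m} - {i}. fact (Poly_Mapping.lookup (k + Poly_Mapping.single i 1) j))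
      = (\<Prod>j\<in>{..<m} - {i}. fact (Poly_Mapping.lookup k j) :: 'k)"
    by (rule prod.cong) (auto simp: lookup_add lookup_single)
  then show ?thesis unfolding *[of "k + _"] *[of k] by (simp add: lookup_add algebra_simps)
qed

text \<open>Residues of mixed derivatives over factorials. As \<open>dpow m k\<close> ignores
  exponents at indices from \<open>m\<close> on, such monomials are excluded explicitly.\<close>

definition taylor :: "'a \<Rightarrow> 'k mps" where
  "taylor x = Abs_mps (\<lambda>k. if Poly_Mapping.keys k \<subseteq> {..<m} then ev (dpow m k x) / kfact k else 0)"

lemma coeff_taylor:
  "mps_coeff (taylor x) k = (if Poly_Mapping.keys k \<subseteq> {..<m} then ev (dpow m k x) / kfact k else 0)"
  by (simp add: taylor_def Abs_mps_inverse)

lemma taylor_vars: "taylor x \<in> mps_vars m"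
  by (auto simp: mps_vars_def coeff_taylor)

lemma keys_single_nat: "i < m \<Longrightarrow> Poly_Mapping.keys (k + Poly_Mapping.single i (1 :: nat)) \<subseteq> {..<m}
    \<longleftrightarrow> Poly_Mapping.keys k \<subseteq> {..<m}"
  by (simp add: keys_add_nat)

lemma taylor_\<delta>:
  assumes i: "i < m" and x: "x \<in> A"
  shows "taylor (\<delta> i x) = mps_deriv i (taylor x)"
proof (rule mps_eqI)
  fix k
  have "of_nat (Poly_Mapping.lookup k i + 1) \<noteq> (0 :: 'k)" by (simp del: of_nat_add of_nat_Suc)
  then have "ev (\<delta> i (dpow m k x)) / kfact k = of_nat (Poly_Mapping.lookup k i + 1) *
      (ev (\<delta> i (dpow m k x)) / kfact (k + Poly_Mapping.single i 1))"
    unfolding kfact_add_single[OF i] by (simp add: field_simps del: of_nat_add of_nat_Suc)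
  then show "mps_coeff (taylor (\<delta> i x)) k = mps_coeff (mps_deriv i (taylor x)) k"
    unfolding mps_deriv.rep_eq coeff_taylor keys_single_nat[OF i]
      dpow_\<delta>[OF order_refl i x] dpow_add_single[OF order_refl i x] using i by simp
qed

lemma dpow_0: "dpow j 0 x = x"
  by (induction j) simp_all

lemma coeff_taylor_0: "mps_coeff (taylor x) 0 = ev x"
  by (simp add: coeff_taylor dpow_0 kfact_0)

lemma taylor_add: "x \<in> A \<Longrightarrow> y \<in> A \<Longrightarrow> taylor (x + y) = taylor x + taylor y"
  by (rule mps_eqI) (simp add: coeff_taylor plus_mps.rep_eq linop_add[OF linop_dpow] ev_add add_divide_distrib)

lemma taylor_scale: "x \<in> A \<Longrightarrow> taylor (\<kappa> c * x) = mps_scale c (taylor x)"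
  by (rule mps_eqI) (simp add: coeff_taylor mps_scale.rep_eq linop_scale[OF linop_dpow] ev_mult)

lemma taylor_0: "taylor 0 = 0"
  using taylor_add[of 0 0] by simp

lemma taylor_diff: "x \<in> A \<Longrightarrow> y \<in> A \<Longrightarrow> taylor (x - y) = taylor x - taylor y"
  using taylor_add[of "x - y" y] by simp

lemma exponent_induct [consumes 1, case_names 0 add]:
  fixes k :: "nat \<Rightarrow>\<^sub>0 nat"
  assumes "Poly_Mapping.keys k \<subseteq> {..<m}" "P 0"
    and "\<And>k i. Poly_Mapping.keys k \<subseteq> {..<m} \<Longrightarrow> i < m \<Longrightarrow> P k \<Longrightarrow> P (k + Poly_Mapping.single i 1)"
  shows "P k"
  using assms(1)
proof (induction "\<Sum>i<m. Poly_Mapping.lookup k i" arbitrary: k rule: less_induct)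
  case less
  show ?case
  proof (cases "k = 0")
    case False
    then obtain i where i: "i \<in> Poly_Mapping.keys k" by fastforce
    then have im: "i < m" using less.prems by blast
    have ki: "Poly_Mapping.lookup k i \<noteq> 0" using i by (simp add: in_keys_iff)
    define l where "l = k - Poly_Mapping.single i 1"
    have k: "k = l + Poly_Mapping.single i 1" unfolding l_def by (rule single_minus_add[OF ki, symmetric])
    have keys: "Poly_Mapping.keys l \<subseteq> {..<m}" using less.prems keys_single_nat[OF im] k by simp
    have "Poly_Mapping.lookup l j \<le> Poly_Mapping.lookup k j" for j by (simp add: k lookup_add)
    moreover have "Poly_Mapping.lookup l i < Poly_Mapping.lookup k i" by (simp add: k lookup_add)
    ultimately have "(\<Sum>j<m. Poly_Mapping.lookup l j) < (\<Sum>j<m. Poly_Mapping.lookup k j)"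
      using im by (intro sum_strict_mono_ex1) auto
    then show ?thesis using assms(3)[OF keys im less.hyps[OF _ keys]] k by simp
  qed (simp add: assms(2))
qed

text \<open>Induction on the exponent for all pairs at once: the coefficient at \<open>k\<close>
  plus a unit at \<open>i\<close> is read off from the derivative in direction \<open>i\<close>,
  where the product rule holds on both sides.\<close>

lemma taylor_mult:
  assumes x: "x \<in> A" and y: "y \<in> A"
  shows "taylor (x * y) = taylor x * taylor y"
proof (rule mps_eqI)
  fix k
  show "mps_coeff (taylor (x * y)) k = mps_coeff (taylor x * taylor y) k"
  proof (cases "Poly_Mapping.keys k \<subseteq> {..<m}")
    case True
    then have "\<forall>x\<in>A. \<forall>y\<in>A. mps_coeff (taylor (x * y)) k = mps_coeff (taylor x * taylor y) k"
    proof (induction k rule: exponent_induct)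
      case 0
      then show ?case by (simp add: mps_coeff_mult_0 coeff_taylor_0 ev_mult)
    next
      case (add k i)
      show ?case
      proof (intro ballI)
        fix x y assume xy: "x \<in> A" "y \<in> A"
        have "mps_coeff (mps_deriv i (taylor (x * y))) k = mps_coeff (taylor (\<delta> i x * y + x * \<delta> i y)) k"
          using xy add by (simp add: \<delta>_mult flip: taylor_\<delta>)
        also have "\<dots> = mps_coeff (taylor (\<delta> i x) * taylor y + taylor x * taylor (\<delta> i y)) k"
          using xy add by (simp add: taylor_add plus_mps.rep_eq)
        also have "\<dots> = mps_coeff (mps_deriv i (taylor x * taylor y)) k"
          using xy add by (simp add: mps_deriv_mult taylor_\<delta>)
        finally show "mps_coeff (taylor (x * y)) (k + Poly_Mapping.single i 1)
            = mps_coeff (taylor x * taylor y) (k + Poly_Mapping.single i 1)"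
          by (simp only: mps_coeff_add_single)
      qed
    qed
    then show ?thesis using x y by blast
  next
    case False
    then show ?thesis
      using mps_vars_coeff[OF taylor_vars] mps_vars_coeff[OF mps_vars_mult[OF taylor_vars taylor_vars]] by metis
  qed
qed

lemma taylor_1: "taylor 1 = 1"
proof (rule mps_eqI)
  fix k
  show "mps_coeff (taylor 1) k = mps_coeff 1 k"
  proof (cases "Poly_Mapping.keys k \<subseteq> {..<m}")
    case True
    then show ?thesis
    proof (induction k rule: exponent_induct)
      case 0
      then show ?case by (simp add: coeff_taylor_0 one_mps.rep_eq)
    next
      case (add k i)
      have "k + Poly_Mapping.single i 1 \<noteq> 0"
        by (metis add_eq_0_iff_both_eq_0 lookup_add lookup_single_eq lookup_zero one_neq_zero)
      moreover have "mps_coeff (taylor 1) (k + Poly_Mapping.single i 1) = 0"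
        unfolding mps_coeff_add_single taylor_\<delta>[OF add.hyps(2) one_closed, symmetric] \<delta>_1[OF add.hyps(2)] taylor_0
        by (simp add: zero_mps.rep_eq)
      ultimately show ?case by (simp add: one_mps.rep_eq)
    qed
  next
    case False
    then have "k \<noteq> 0" by auto
    then show ?thesis using False by (simp add: coeff_taylor one_mps.rep_eq)
  qed
qed

text \<open>The kernel is an ideal inside the kernel of \<open>ev\<close>, stable under all
  \<open>\<delta> i\<close>, so \<open>\<delta>_simple\<close> applies.\<close>

lemma taylor_inj: "inj_on taylor A"
proof (rule inj_onI)
  fix x y assume xy: "x \<in> A" "y \<in> A" "taylor x = taylor y"
  let ?I = "{x\<in>A. taylor x = 0}"
  have "?I = {0}"
  proof (rule \<delta>_simple)
    show "ideal ?I" unfolding ideal_def by (auto simp: taylor_add taylor_mult taylor_0)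
    show "ev x = 0" if "x \<in> ?I" for x using that coeff_taylor_0[of x] by (simp add: zero_mps.rep_eq)
    show "\<delta> i x \<in> ?I" if "i < m" "x \<in> ?I" for i x
      using that by (auto simp: taylor_\<delta> mps_eqI mps_deriv.rep_eq zero_mps.rep_eq)
  qed
  moreover have "x - y \<in> ?I" using xy by (simp add: taylor_diff)
  ultimately show "x = y" by simp
qed

section \<open>Monomials in the coordinates and surjectivity\<close>

fun zpow :: "nat \<Rightarrow> (nat \<Rightarrow>\<^sub>0 nat) \<Rightarrow> 'a" where
  "zpow 0 k = 1"
| "zpow (Suc j) k = zpow j k * z j ^ Poly_Mapping.lookup k j"

lemma zpow_closed [simp, intro]: "j \<le> m \<Longrightarrow> zpow j k \<in> A"
  by (induction j) auto

lemma \<delta>_z_power: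
  assumes "i < m" "j < m"
  shows "\<delta> i (z j ^ l) = (if i = j then of_nat l * z j ^ (l - 1) else 0)"
proof (induction l)
  case (Suc l)
  have "\<delta> i (z j ^ Suc l) = \<delta> i (z j) * z j ^ l + z j * \<delta> i (z j ^ l)"
    using \<delta>_mult[of i "z j" "z j ^ l"] assms by simp
  then show ?case unfolding Suc.IH using assms by (cases l) (simp_all add: \<delta>_z algebra_simps)
qed (simp add: \<delta>_1 assms)

lemma \<delta>_zpow_0: "j \<le> m \<Longrightarrow> i < m \<Longrightarrow> Poly_Mapping.lookup k i = 0 \<or> j \<le> i \<Longrightarrow> \<delta> i (zpow j k) = 0"
proof (induction j)
  case (Suc j)
  then have "\<delta> i (zpow j k) = 0" by auto
  moreover have "\<delta> i (z j ^ Poly_Mapping.lookup k j) = 0"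
    using Suc.prems by (auto simp: \<delta>_z_power)
  ultimately show ?case using Suc.prems by (simp add: \<delta>_mult)
qed (simp add: \<delta>_1)

lemma zpow_add_single_ge: "j \<le> i \<Longrightarrow> zpow j (k + Poly_Mapping.single i 1) = zpow j k"
  by (induction j) (simp_all add: lookup_add lookup_single)

lemma \<delta>_zpow: "j \<le> m \<Longrightarrow> i < j \<Longrightarrow>
    \<delta> i (zpow j (k + Poly_Mapping.single i 1)) = of_nat (Poly_Mapping.lookup k i + 1) * zpow j k"
proof (induction j)
  case (Suc j)
  let ?k = "k + Poly_Mapping.single i 1"
  have "\<delta> i (zpow (Suc j) ?k) = \<delta> i (zpow j ?k) * z j ^ Poly_Mapping.lookup ?k j
      + zpow j ?k * \<delta> i (z j ^ Poly_Mapping.lookup ?k j)"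
    using Suc.prems by (simp add: \<delta>_mult)
  also have "\<dots> = of_nat (Poly_Mapping.lookup k i + 1) * zpow (Suc j) k"
  proof (cases "i = j")
    case True
    have "\<delta> i (zpow j ?k) = 0" using Suc.prems True by (intro \<delta>_zpow_0) auto
    moreover have "zpow j ?k = zpow j k" using True by (intro zpow_add_single_ge) simp
    moreover have "Poly_Mapping.lookup ?k j = Poly_Mapping.lookup k j + 1" using True by (simp add: lookup_add)
    ultimately show ?thesis using True Suc.prems by (simp add: \<delta>_z_power mult_ac del: power_Suc)
  next
    case False
    then have "Poly_Mapping.lookup ?k j = Poly_Mapping.lookup k j" by (simp add: lookup_add lookup_single)
    moreover have "\<delta> i (zpow j ?k) = of_nat (Poly_Mapping.lookup k i + 1) * zpow j k"
      using Suc False by simp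
    ultimately show ?thesis using False Suc.prems by (simp add: \<delta>_z_power mult_ac)
  qed
  finally show ?case .
qed simp

lemma ev_z: "i < m \<Longrightarrow> ev (z i) = 0"
  using nil_z ev_eq_0_iff by simp

lemma ev_zpow: "j \<le> m \<Longrightarrow> ev (zpow j k) = (if \<forall>i<j. Poly_Mapping.lookup k i = 0 then 1 else 0)"
proof (induction j)
  case (Suc j)
  then show ?case
    by (cases "Poly_Mapping.lookup k j = 0") (auto simp: ev_mult ev_power ev_z less_Suc_eq)
qed simp

text \<open>Monomials and mixed derivatives are dual: one derivative and one factor are removed at a
  time. This computes the Taylor coefficients of a series in the \<open>z i\<close>.\<close>

lemma ev_dpow_zpow:
  assumes l: "Poly_Mapping.keys l \<subseteq> {..<m}" and k: "Poly_Mapping.keys k \<subseteq> {..<m}"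
  shows "ev (dpow m l (zpow m k)) = (if l = k then kfact k else 0)"
  using l k
proof (induction l arbitrary: k rule: exponent_induct)
  case 0
  have "(\<forall>i<m. Poly_Mapping.lookup k i = 0) \<longleftrightarrow> 0 = k"
  proof
    assume *: "\<forall>i<m. Poly_Mapping.lookup k i = 0"
    have "Poly_Mapping.lookup k i = 0" for i using * 0 by (cases "i < m") (auto simp: in_keys_iff)
    then show "0 = k" by (simp add: poly_mapping_eq_iff fun_eq_iff)
  qed auto
  then show ?case by (auto simp: dpow_0 ev_zpow kfact_0)
next
  case (add l i)
  have *: "dpow m (l + Poly_Mapping.single i 1) (zpow m k) = dpow m l (\<delta> i (zpow m k))"
    using add dpow_add_single[of m i "zpow m k" l] dpow_\<delta>[of m i "zpow m k" l] by simp
  show ?case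
  proof (cases "Poly_Mapping.lookup k i = 0")
    case True
    then have "l + Poly_Mapping.single i 1 \<noteq> k" by (auto simp: lookup_add)
    moreover have "\<delta> i (zpow m k) = 0" using True add by (intro \<delta>_zpow_0) auto
    ultimately show ?thesis unfolding * using linop_0[OF linop_dpow] by simp
  next
    case False
    define k' where "k' = k - Poly_Mapping.single i 1"
    have k: "k = k' + Poly_Mapping.single i 1" unfolding k'_def by (rule single_minus_add[OF False, symmetric])
    have keys: "Poly_Mapping.keys k' \<subseteq> {..<m}" using add.prems add.hyps k keys_single_nat by metis
    have "dpow m l (\<delta> i (zpow m k)) = dpow m l (\<kappa> (of_nat (Poly_Mapping.lookup k' i + 1)) * zpow m k')"
      unfolding k \<delta>_zpow[OF order_refl add.hyps(2)] \<kappa>_of_nat ..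
    also have "\<dots> = \<kappa> (of_nat (Poly_Mapping.lookup k' i + 1)) * dpow m l (zpow m k')"
      by (rule linop_scale[OF linop_dpow]) auto
    finally have "ev (dpow m l (\<delta> i (zpow m k)))
        = of_nat (Poly_Mapping.lookup k' i + 1) * (if l = k' then kfact k' else 0)"
      using add.IH[OF keys] by (simp only: ev_mult \<kappa>_closed dpow_closed zpow_closed order_refl ev_\<kappa>)
    moreover have "l + Poly_Mapping.single i 1 = k \<longleftrightarrow> l = k'" by (simp add: k)
    moreover have "kfact k = of_nat (Poly_Mapping.lookup k' i + 1) * kfact k'"
      unfolding k by (rule kfact_add_single[OF add.hyps(2)])
    ultimately show ?thesis unfolding * by (simp only: if_distrib mult_zero_right)
  qed
qed

definition mdeg :: "(nat \<Rightarrow>\<^sub>0 nat) \<Rightarrow> nat" where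
  "mdeg k = (\<Sum>i<m. Poly_Mapping.lookup k i)"

text \<open>Grouping exponents by total degree makes each homogeneous part a finite sum, so that
  sequences of partial sums suffice.\<close>

definition exps :: "nat \<Rightarrow> (nat \<Rightarrow>\<^sub>0 nat) set" where
  "exps r = {k. Poly_Mapping.keys k \<subseteq> {..<m} \<and> mdeg k = r}"

lemma finite_exps: "finite (exps r)"
proof -
  have "Poly_Mapping.lookup ` exps r \<subseteq> {f. \<forall>x. (x \<in> {..<m} \<longrightarrow> f x \<in> {..r}) \<and> (x \<notin> {..<m} \<longrightarrow> f x = 0)}"
  proof (rule image_subsetI, rule CollectI, intro allI conjI impI)
    fix k x assume k: "k \<in> exps r"
    show "Poly_Mapping.lookup k x \<in> {..r}" if "x \<in> {..<m}"
    proof -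
      have "Poly_Mapping.lookup k x \<le> mdeg k" unfolding mdeg_def by (rule member_le_sum) (use that in auto)
      then show ?thesis using k by (simp add: exps_def)
    qed
    show "Poly_Mapping.lookup k x = 0" if "x \<notin> {..<m}"
      using that k by (auto simp: exps_def in_keys_iff)
  qed
  then have "finite (Poly_Mapping.lookup ` exps r)"
    by (rule finite_subset) (intro finite_set_of_finite_funs; simp)
  then show ?thesis by (rule finite_imageD) (simp add: inj_on_def lookup_inject)
qed

text \<open>A monomial of large degree has a large exponent somewhere, and every \<open>z i\<close>
  is topologically nilpotent.\<close>

lemma zpow_in:
  assumes U: "U \<in> \<U>"
  shows "\<exists>r0. \<forall>k. mdeg k \<ge> r0 \<longrightarrow> zpow m k \<in> U"
proof -
  note U' = ideal_\<U>[OF U]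
  have "\<forall>i\<in>{..<m}. \<exists>s. z i ^ s \<in> U" using nilD[OF nil_z U] by blast
  then obtain s where s: "\<And>i. i < m \<Longrightarrow> z i ^ s i \<in> U" by (metis lessThan_iff)
  \<comment> \<open>The \<open>Suc\<close> also settles \<open>m = 0\<close>, where there is no
    exponent to choose.\<close>
  have "zpow m k \<in> U" if "mdeg k \<ge> Suc (\<Sum>i<m. s i)" for k
  proof -
    have "\<exists>i<m. s i \<le> Poly_Mapping.lookup k i"
    proof (rule ccontr)
      assume "\<not> ?thesis"
      then have "mdeg k \<le> (\<Sum>i<m. s i)" unfolding mdeg_def by (intro sum_mono) (auto simp: not_le)
      then show False using that by simp
    qed
    then obtain i where i: "i < m" "s i \<le> Poly_Mapping.lookup k i" by blast
    then have zi: "z i ^ Poly_Mapping.lookup k i \<in> U" using ideal_power_le[OF U' _ s] by blast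
    have "j \<le> m \<Longrightarrow> i < j \<Longrightarrow> zpow j k \<in> U" for j
    proof (induction j)
      case (Suc j)
      then show ?case
        using ideal_mult[OF U' zpow_closed zi] ideal_mult_right[OF U', of "z j ^ Poly_Mapping.lookup k j" "zpow j k"]
        by (cases "i = j") auto
    qed simp
    then show ?thesis using i(1) by blast
  qed
  then show ?thesis by blast
qed

text \<open>The preimage is the sum of the homogeneous parts of \<open>F\<close> at the
  \<open>z i\<close>. The last clause, which locates it by the monomials of \<open>F\<close>, will
  make the inverse of \<open>taylor\<close> continuous.\<close>

lemma taylor_surj:
  assumes F: "F \<in> mps_vars m"
  obtains y where "y \<in> A" "taylor y = F"
    "\<And>U. U \<in> \<U> \<Longrightarrow> (\<And>k. mps_coeff F k \<noteq> 0 \<Longrightarrow> zpow m k \<in> U) \<Longrightarrow> y \<in> U"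
proof -
  define t where "t r = (\<Sum>k\<in>exps r. \<kappa> (mps_coeff F k) * zpow m k)" for r
  have tA: "t r \<in> A" for r unfolding t_def by (intro sum_closed mult_closed) auto
  have tU: "t r \<in> U" if "U \<in> \<U>" "\<And>k. k \<in> exps r \<Longrightarrow> mps_coeff F k \<noteq> 0 \<Longrightarrow> zpow m k \<in> U" for r U
    unfolding t_def
  proof (rule ideal_sum[OF ideal_\<U>[OF that(1)]])
    fix k assume "k \<in> exps r"
    then show "\<kappa> (mps_coeff F k) * zpow m k \<in> U"
      using that(2)[of k] ideal_mult[OF ideal_\<U>[OF that(1)]] ideal_zero[OF ideal_\<U>[OF that(1)]]
      by (cases "mps_coeff F k = 0") auto
  qed
  have "\<exists>K. \<forall>r\<ge>K. t r \<in> U" if U: "U \<in> \<U>" for U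
  proof -
    obtain r0 where r0: "\<And>k. mdeg k \<ge> r0 \<Longrightarrow> zpow m k \<in> U" using zpow_in[OF U] by blast
    have "t r \<in> U" if "r \<ge> r0" for r
      using that by (intro tU[OF U] r0) (simp add: exps_def)
    then show ?thesis by blast
  qed
  then obtain y where y: "y \<in> A" "tends (\<lambda>r. \<Sum>k<r. t k) y"
    using series_converges[of t] tA by blast
  have sA: "(\<Sum>k<r. t k) \<in> A" for r using tA by (rule sum_closed)
  have "taylor y = F"
  proof (rule mps_eqI)
    fix l
    show "mps_coeff (taylor y) l = mps_coeff F l"
    proof (cases "Poly_Mapping.keys l \<subseteq> {..<m}")
      case True
      obtain U where U: "U \<in> \<U>" "\<And>a. a \<in> U \<Longrightarrow> ev a = 0" using ev_open by blast
      obtain V where V: "V \<in> \<U>" "\<And>x. x \<in> V \<Longrightarrow> dpow m l x \<in> U"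
        using linop_cont[OF linop_dpow[OF order_refl] U(1)] by blast
      obtain r0 where r0: "\<And>r. r \<ge> r0 \<Longrightarrow> y - (\<Sum>k<r. t k) \<in> V"
        using y(2) V(1) unfolding tends_def by blast
      \<comment> \<open>Long enough to include degree \<open>mdeg l\<close> and to make the error
        invisible to the coefficient at \<open>l\<close>.\<close>
      define r where "r = max r0 (Suc (mdeg l))"
      have "dpow m l (y - (\<Sum>k<r. t k)) \<in> U" by (rule V(2)[OF r0]) (simp add: r_def)
      then have "ev (dpow m l (y - (\<Sum>k<r. t k))) = 0" by (rule U(2))
      then have "ev (dpow m l y) = ev (dpow m l (\<Sum>k<r. t k))"
        using linop_diff[OF linop_dpow[OF order_refl] y(1) sA] ev_diff y(1) sA by simp
      also have "\<dots> = (\<Sum>j<r. ev (dpow m l (t j)))"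
        using linop_sum[OF linop_dpow[OF order_refl], of "{..<r}" t] ev_sum[of "{..<r}" "\<lambda>j. dpow m l (t j)"] tA
        by simp
      also have "\<dots> = (\<Sum>j<r. if j = mdeg l then mps_coeff F l * kfact l else 0)"
      proof (rule sum.cong[OF refl])
        fix j
        have "ev (dpow m l (t j)) = (\<Sum>k\<in>exps j. ev (dpow m l (\<kappa> (mps_coeff F k) * zpow m k)))"
          unfolding t_def
          using linop_sum[OF linop_dpow[OF order_refl], of "exps j" "\<lambda>k. \<kappa> (mps_coeff F k) * zpow m k"]
            ev_sum[of "exps j" "\<lambda>k. dpow m l (\<kappa> (mps_coeff F k) * zpow m k)"]
          by (simp add: mult_closed)
        also have "\<dots> = (\<Sum>k\<in>exps j. if k = l then mps_coeff F l * kfact l else 0)"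
        proof (rule sum.cong[OF refl])
          fix k assume "k \<in> exps j"
          then have "Poly_Mapping.keys k \<subseteq> {..<m}" by (simp add: exps_def)
          then show "ev (dpow m l (\<kappa> (mps_coeff F k) * zpow m k)) = (if k = l then mps_coeff F l * kfact l else 0)"
            using ev_dpow_zpow[OF True] by (simp add: linop_scale[OF linop_dpow] ev_mult)
        qed
        also have "\<dots> = (if j = mdeg l then mps_coeff F l * kfact l else 0)"
          using finite_exps True by (simp add: exps_def)
        finally show "ev (dpow m l (t j)) = (if j = mdeg l then mps_coeff F l * kfact l else 0)" .
      qed
      also have "\<dots> = mps_coeff F l * kfact l" by (simp add: r_def)
      finally show ?thesis using True by (simp add: coeff_taylor)
    next
      case False
      then show ?thesis using mps_vars_coeff[OF F] by (simp add: coeff_taylor)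
    qed
  qed
  moreover have "y \<in> U" if U: "U \<in> \<U>" and z: "\<And>k. mps_coeff F k \<noteq> 0 \<Longrightarrow> zpow m k \<in> U" for U
  proof -
    note U' = ideal_\<U>[OF U]
    obtain r where "y - (\<Sum>k<r. t k) \<in> U" using y(2) U unfolding tends_def by blast
    moreover have "(\<Sum>k<r. t k) \<in> U" using tU[OF U] z by (intro ideal_sum[OF U']) auto
    ultimately have "(y - (\<Sum>k<r. t k)) + (\<Sum>k<r. t k) \<in> U" by (rule ideal_add[OF U'])
    then show ?thesis by simp
  qed
  ultimately show thesis using that y(1) by blast
qed

lemma taylor_bij: "bij_betw taylor A (mps_vars m)"
  unfolding bij_betw_def
proof
  show "taylor ` A = mps_vars m"
  proof
    show "mps_vars m \<subseteq> taylor ` A" using taylor_surj by (metis image_eqI subsetI)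
  qed (use taylor_vars in auto)
qed (rule taylor_inj)

text \<open>Each coefficient is \<open>ev\<close> after a continuous operator, and \<open>ev\<close>
  vanishes on an open ideal. Conversely, series with equal coefficients below degree
  \<open>r0\<close> have preimages that differ by an element of \<open>U\<close>.\<close>

lemma taylor_homeomorphic:
  assumes top: "\<And>W. openin X W \<longleftrightarrow> W \<subseteq> A \<and> (\<forall>x\<in>W. \<exists>U\<in>\<U>. \<forall>u\<in>U. x + u \<in> W)"
    and space: "topspace X = A"
  shows "homeomorphic_map X (mps_topology m) taylor"
  unfolding homeomorphic_map_def quotient_map_def topspace_mps_topology space
proof (intro conjI allI impI)
  show "taylor ` A = mps_vars m" using taylor_bij by (simp add: bij_betw_def)
  show "inj_on taylor A" by (rule taylor_inj)
  fix V :: "'k mps set" assume V: "V \<subseteq> mps_vars m"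
  let ?W = "{x \<in> A. taylor x \<in> V}"
  show "openin X ?W = openin (mps_topology m) V"
  proof
    assume W: "openin X ?W"
    show "openin (mps_topology m) V"
      unfolding openin_mps_topology
    proof (intro conjI ballI V)
      fix f assume f: "f \<in> V"
      then obtain x where x: "x \<in> A" "taylor x = f" using taylor_surj V by (metis subsetD)
      then obtain U where U: "U \<in> \<U>" "\<And>u. u \<in> U \<Longrightarrow> x + u \<in> ?W" using W f unfolding top by blast
      obtain r0 where r0: "\<And>k. mdeg k \<ge> r0 \<Longrightarrow> zpow m k \<in> U" using zpow_in[OF U(1)] by blast
      show "\<exists>K. finite K \<and> (\<forall>g\<in>mps_vars m. (\<forall>k\<in>K. mps_coeff g k = mps_coeff f k) \<longrightarrow> g \<in> V)"
      proof (intro exI[of _ "\<Union>r<r0. exps r"] conjI ballI impI)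
        show "finite (\<Union>r<r0. exps r)" using finite_exps by blast
        fix g assume g: "g \<in> mps_vars m" "\<forall>k\<in>\<Union>r<r0. exps r. mps_coeff g k = mps_coeff f k"
        have fv: "f \<in> mps_vars m" using f V by blast
        obtain y where y: "y \<in> A" "taylor y = g - f"
          "\<And>U. U \<in> \<U> \<Longrightarrow> (\<And>k. mps_coeff (g - f) k \<noteq> 0 \<Longrightarrow> zpow m k \<in> U) \<Longrightarrow> y \<in> U"
          using taylor_surj[OF mps_vars_diff[OF g(1) fv]] by metis
        have "y \<in> U"
        proof (rule y(3)[OF U(1)])
          fix k assume k: "mps_coeff (g - f) k \<noteq> 0"
          then have "Poly_Mapping.keys k \<subseteq> {..<m}" using mps_vars_coeff[OF mps_vars_diff[OF g(1) fv]] by blast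
          then have "mdeg k \<ge> r0" using k g(2) by (force simp: exps_def minus_mps.rep_eq)
          then show "zpow m k \<in> U" by (rule r0)
        qed
        then have "x + y \<in> ?W" by (rule U(2))
        then show "g \<in> V" using x y by (simp add: taylor_add)
      qed
    qed
  next
    assume W: "openin (mps_topology m) V"
    show "openin X ?W"
      unfolding top
    proof (intro conjI ballI)
      fix x assume x: "x \<in> ?W"
      then obtain K where K: "finite K"
        "\<And>g. g \<in> mps_vars m \<Longrightarrow> (\<forall>k\<in>K. mps_coeff g k = mps_coeff (taylor x) k) \<Longrightarrow> g \<in> V"
        using W unfolding openin_mps_topology by blast
      have "\<exists>U\<in>\<U>. \<forall>u\<in>U. \<forall>k\<in>K. ev (dpow m k u) = 0"
        using K(1)
      proof (induction K rule: finite_induct)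
        case (insert k K)
        then obtain U where U: "U \<in> \<U>" "\<forall>u\<in>U. \<forall>k\<in>K. ev (dpow m k u) = 0" by blast
        obtain U0 where U0: "U0 \<in> \<U>" "\<And>a. a \<in> U0 \<Longrightarrow> ev a = 0" using ev_open by blast
        obtain V where V: "V \<in> \<U>" "\<And>x. x \<in> V \<Longrightarrow> dpow m k x \<in> U0"
          using linop_cont[OF linop_dpow[OF order_refl] U0(1)] by blast
        show ?case by (rule bexI[of _ "U \<inter> V"]) (use U U0 V Int_\<U> in auto)
      qed (use A_\<U> in blast)
      then obtain U where U: "U \<in> \<U>" "\<And>u k. u \<in> U \<Longrightarrow> k \<in> K \<Longrightarrow> ev (dpow m k u) = 0" by blast
      have "x + u \<in> ?W" if u: "u \<in> U" for u
      proof -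
        have uA: "u \<in> A" using u ideal_\<U>[OF U(1)] ideal_subset by blast
        have "mps_coeff (taylor (x + u)) k = mps_coeff (taylor x) k" if "k \<in> K" for k
          using U(2)[OF u that] x uA by (simp add: taylor_add plus_mps.rep_eq coeff_taylor)
        then show ?thesis using K(2)[OF taylor_vars] x uA by blast
      qed
      then show "\<exists>U\<in>\<U>. \<forall>u\<in>U. x + u \<in> ?W" using U(1) by blast
    qed auto
  qed
qed

end

section \<open>Gauge transformations to normal form\<close>

locale bracket_alg = connected_alg A \<kappa> \<U>
  for A :: "'a::comm_ring_1 set" and \<kappa> :: "'k::{alg_closed_field, field_char_0} \<Rightarrow> 'a" and \<U> +
  fixes n :: nat
begin

sublocale slots A n
  by unfold_locales (rule torsion_free)

text \<open>Stability is tested in slot 0 only, which by skewness covers every slot.\<close>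

definition simple_bracket :: "((nat \<Rightarrow> 'a) \<Rightarrow> 'a) \<Rightarrow> bool" where
  "simple_bracket B \<longleftrightarrow> filippov A n B \<and>
     (\<forall>g k. args g \<longrightarrow> k < n \<longrightarrow> linop (\<lambda>x. B (g(k := x)))) \<and>
     (\<exists>g. args g \<and> B g \<noteq> 0) \<and>
     (\<forall>I. ideal I \<longrightarrow> (\<forall>g. args g \<longrightarrow> g 0 \<in> I \<longrightarrow> B g \<in> I) \<longrightarrow> I = {0} \<or> I = A)"

lemma
  assumes "simple_bracket B"
  shows simple_filippov: "filippov A n B"
    and simple_linop: "\<And>g k. args g \<Longrightarrow> k < n \<Longrightarrow> linop (\<lambda>x. B (g(k := x)))"
    and simple_nonzero: "\<exists>g. args g \<and> B g \<noteq> 0"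
    and simple_ideal: "\<And>I. ideal I \<Longrightarrow> (\<And>g. args g \<Longrightarrow> g 0 \<in> I \<Longrightarrow> B g \<in> I) \<Longrightarrow> I = {0} \<or> I = A"
  using assms unfolding simple_bracket_def by blast+

text \<open>\<open>\<psi>\<close> stands for the inverse of \<open>\<phi>\<close>; as an argument it
  needs no choice operator.\<close>

definition gauge :: "'a \<Rightarrow> 'a \<Rightarrow> ((nat \<Rightarrow> 'a) \<Rightarrow> 'a) \<Rightarrow> (nat \<Rightarrow> 'a) \<Rightarrow> 'a" where
  "gauge \<phi> \<psi> B g = \<psi> * B (\<lambda>i. \<phi> * g i)"

lemma args_mult: "\<phi> \<in> A \<Longrightarrow> args g \<Longrightarrow> args (\<lambda>i. \<phi> * g i)"
  by (simp add: args_def)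

lemma mult_upd: "(\<lambda>i. \<phi> * (g(k := x)) i) = (\<lambda>i. \<phi> * g i)(k := \<phi> * x)"
  by auto

lemma gauge_upd: "gauge \<phi> \<psi> B (g(k := x)) = \<psi> * B ((\<lambda>i. \<phi> * g i)(k := \<phi> * x))"
  unfolding gauge_def mult_upd ..

text \<open>Each axiom is that of \<open>B\<close> at rescaled arguments, with inner factors
  \<open>\<phi> * \<psi>\<close> cancelling. Simplicity carries over because rescaling by
  \<open>\<psi>\<close> recovers \<open>B\<close>.\<close>

lemma gauge_simple:
  assumes B: "simple_bracket B" and \<phi>: "\<phi> \<in> A" and \<psi>: "\<psi> \<in> A" and \<phi>\<psi>: "\<phi> * \<psi> = 1"
  shows "simple_bracket (gauge \<phi> \<psi> B)"
proof -
  interpret filippov A n B by (rule simple_filippov[OF B])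
  have \<psi>\<phi>: "\<psi> * \<phi> = 1" using \<phi>\<psi> by (simp add: mult.commute)
  have cancel: "\<phi> * (\<psi> * x) = x" "\<psi> * (\<phi> * x) = x" for x
    using \<phi>\<psi> \<psi>\<phi> by (simp_all flip: mult.assoc)
  have skew_g: "skew (gauge \<phi> \<psi> B)"
    unfolding skew_def
  proof (intro conjI allI impI)
    show "gauge \<phi> \<psi> B g = gauge \<phi> \<psi> B h" if "\<forall>i<n. g i = h i" for g h
      unfolding gauge_def using skew_cong[OF skew_B, of "\<lambda>i. \<phi> * g i" "\<lambda>i. \<phi> * h i"] that by simp
    show "gauge \<phi> \<psi> B g \<in> A" if "args g" for g
      unfolding gauge_def using \<psi> args_mult[OF \<phi> that] by blast
    show "gauge \<phi> \<psi> B (g \<circ> p) = of_int (sign p) * gauge \<phi> \<psi> B g" if "args g" "p permutes {..<n}" for g p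
      using skew_perm[OF skew_B args_mult[OF \<phi> that(1)] that(2)] unfolding gauge_def comp_def
      by (simp add: mult.left_commute)
  qed
  have fil: "filippov A n (gauge \<phi> \<psi> B)"
  proof unfold_locales
    show "2 < n" by (rule n_gt_2)
    show "skew (gauge \<phi> \<psi> B)" by (rule skew_g)
    show "gauge \<phi> \<psi> B (g(k := x + y)) = gauge \<phi> \<psi> B (g(k := x)) + gauge \<phi> \<psi> B (g(k := y))"
      if "args g" "k < n" "x \<in> A" "y \<in> A" for g k x y
      unfolding gauge_upd distrib_left[of \<phi>]
      using B_add[OF args_mult[OF \<phi> that(1)] that(2), of "\<phi> * x" "\<phi> * y"] that \<phi> by (simp add: distrib_left)
    show "gauge \<phi> \<psi> B (g(k := x * y)) = gauge \<phi> \<psi> B (g(k := x)) * y + x * gauge \<phi> \<psi> B (g(k := y))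
        - gauge \<phi> \<psi> B (g(k := 1)) * x * y"
      if "args g" "k < n" "x \<in> A" "y \<in> A" for g k x y
    proof -
      note a = args_mult[OF \<phi> that(1)]
      let ?b = "\<lambda>x. B ((\<lambda>i. \<phi> * g i)(k := x))"
      \<comment> \<open>The product is split as \<open>\<phi> * x\<close> times \<open>y\<close>;
        expanding \<open>?b (\<phi> * y)\<close> in the same way makes the terms with
        \<open>?b \<phi>\<close> cancel.\<close>
      have 1: "?b ((\<phi> * x) * y) = ?b (\<phi> * x) * y + (\<phi> * x) * ?b y - ?b 1 * (\<phi> * x) * y"
        by (rule B_leibniz[OF a that(2)]) (use that \<phi> in auto)
      have 2: "?b (\<phi> * y) = ?b \<phi> * y + \<phi> * ?b y - ?b 1 * \<phi> * y"
        by (rule B_leibniz[OF a that(2)]) (use that \<phi> in auto)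
      have "\<psi> * ?b (\<phi> * x) * y + x * (\<psi> * ?b (\<phi> * y)) - \<psi> * ?b \<phi> * x * y
          = \<psi> * (?b (\<phi> * x) * y + (\<phi> * x) * ?b y - ?b 1 * (\<phi> * x) * y)"
        unfolding 2 by (simp add: algebra_simps)
      then show ?thesis unfolding gauge_upd mult.assoc[of \<phi> x y, symmetric] 1 by simp
    qed
    show "gauge \<phi> \<psi> B (g(k := gauge \<phi> \<psi> B h))
        = (\<Sum>j<n. gauge \<phi> \<psi> B (h(j := gauge \<phi> \<psi> B (g(k := h j)))))"
      if "args g" "args h" "k < n" for g h k
      unfolding gauge_upd
      unfolding gauge_def cancel
      using B_jacobi[OF args_mult[OF \<phi> that(1)] args_mult[OF \<phi> that(2)] that(3)]
      by (simp add: sum_distrib_left)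
  qed
  have lin: "linop (\<lambda>x. gauge \<phi> \<psi> B (g(k := x)))" if "args g" "k < n" for g k
    unfolding gauge_upd
    using linop_compose[OF linop_mult[OF \<psi>]
        linop_compose[OF simple_linop[OF B args_mult[OF \<phi> that(1)] that(2)] linop_mult[OF \<phi>]]] .
  have nz: "\<exists>g. args g \<and> gauge \<phi> \<psi> B g \<noteq> 0"
  proof -
    obtain g where g: "args g" "B g \<noteq> 0" using simple_nonzero[OF B] by blast
    have "B g = \<phi> * gauge \<phi> \<psi> B (\<lambda>i. \<psi> * g i)" by (simp add: gauge_def cancel)
    then have "gauge \<phi> \<psi> B (\<lambda>i. \<psi> * g i) \<noteq> 0" using g(2) by auto
    then show ?thesis using args_mult[OF \<psi> g(1)] by blast
  qed
  have simp: "I = {0} \<or> I = A"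
    if I: "ideal I" "\<And>g. args g \<Longrightarrow> g 0 \<in> I \<Longrightarrow> gauge \<phi> \<psi> B g \<in> I" for I
  proof (rule simple_ideal[OF B I(1)])
    fix g assume g: "args g" "g 0 \<in> I"
    have "gauge \<phi> \<psi> B (\<lambda>i. \<psi> * g i) \<in> I"
      by (rule I(2)[OF args_mult[OF \<psi> g(1)] ideal_mult[OF I(1) \<psi> g(2)]])
    then have "\<phi> * gauge \<phi> \<psi> B (\<lambda>i. \<psi> * g i) \<in> I" by (rule ideal_mult[OF I(1) \<phi>])
    then show "B g \<in> I" by (simp add: gauge_def cancel)
  qed
  show ?thesis unfolding simple_bracket_def using fil lin nz simp by blast
qed

lemma unit_inverse: "\<phi> \<in> A \<Longrightarrow> ev \<phi> = 1 \<Longrightarrow> \<exists>\<psi>\<in>A. \<phi> * \<psi> = 1"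
  using ev_unit by simp

text \<open>
  By simplicity some \<open>D = (\<lambda>x. B (g(0 := x)))\<close> maps a nonunit \<open>y\<close> to a unit.  The gauge factor
  is a unit solution of \<open>D \<phi> = \<phi>\<close>; it exists because \<open>(D - 1) / (D y - D 1 * y)\<close> has commutator
  \<open>1\<close> with multiplication by \<open>y\<close>.
\<close>
lemma frame_exists:
  assumes B: "simple_bracket B"
  obtains \<phi> \<psi> e where "\<phi> \<in> A" "\<psi> \<in> A" "\<phi> * \<psi> = 1" "nambu_frame A n (gauge \<phi> \<psi> B) e"
    "\<And>i. 0 < i \<Longrightarrow> i < n \<Longrightarrow> nil (e i)"
proof -
  interpret filippov A n B by (rule simple_filippov[OF B])
  have n0: "0 < n" "1 < n" using n_gt_2 by auto
  let ?M = "{x\<in>A. ev x = 0}"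
  \<comment> \<open>Otherwise the maximal ideal is stable, hence 0. Then \<open>A\<close> consists
    of scalars, and a bracket of scalars is a multiple of one with 1 in two slots.\<close>
  have "\<exists>g. args g \<and> ev (g 0) = 0 \<and> ev (B g) \<noteq> 0"
  proof (rule ccontr)
    assume "\<not> ?thesis"
    then have "B g \<in> ?M" if "args g" "g 0 \<in> ?M" for g using that by auto
    then have "?M = {0} \<or> ?M = A" using simple_ideal[OF B ideal_ev] by blast
    moreover have "?M \<noteq> A" using one_closed ev_1 by (metis (mono_tags, lifting) mem_Collect_eq zero_neq_one)
    ultimately have M: "?M = {0}" by blast
    have const: "x = \<kappa> (ev x)" if "x \<in> A" for x
    proof -
      have "x - \<kappa> (ev x) \<in> ?M" using that by (simp add: ev_diff)
      then show ?thesis using M by simp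
    qed
    have "B g = 0" if g: "args g" for g
    proof -
      have c: "B (h(k := h k)) = h k * B (h(k := 1))" if h: "args h" and k: "k < n" for h k
        using linop_scale[OF simple_linop[OF B h k] one_closed, of "ev (h k)"] const[OF argsD[OF h k]] by simp
      have "B g = g 0 * B (g(0 := 1))" using c[OF g n0(1)] by simp
      also have "B (g(0 := 1)) = (g(0 := 1)) 1 * B (g(0 := 1, 1 := 1))"
        using c[of "g(0 := 1)" 1] g n0 by (simp add: fun_upd_idem)
      also have "B (g(0 := 1, 1 := 1)) = 0"
        by (rule skew_dup[OF skew_B _ n0]) (use g in auto)
      finally show ?thesis by simp
    qed
    then show False using simple_nonzero[OF B] by blast
  qed
  then obtain g where g: "args g" "ev (g 0) = 0" "ev (B g) \<noteq> 0" by blast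
  define D where "D x = B (g(0 := x))" for x
  have D: "linop D" unfolding D_def by (rule simple_linop[OF B g(1) n0(1)])
  define y where "y = g 0"
  have yA: "y \<in> A" unfolding y_def using g(1) n0(1) by blast
  have Dy: "D y = B g" by (simp add: D_def y_def)
  have D1: "D 1 \<in> A" using linop_closed[OF D one_closed] .
  have "ev (D y - D 1 * y) \<noteq> 0"
    using g(2,3) Dy linop_closed[OF D yA] D1 yA by (simp add: ev_diff ev_mult y_def)
  then obtain v where v: "v \<in> A" "(D y - D 1 * y) * v = 1"
    using ev_unit[of "D y - D 1 * y"] linop_closed[OF D yA] D1 yA by blast
  define D' where "D' x = v * (D x - x)" for x
  have D': "linop D'"
    unfolding D'_def by (rule linop_compose[OF linop_mult[OF v(1)] linop_minus[OF D linop_id]])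
  have D'y: "D' (y * h) = h + y * D' h" if "h \<in> A" for h
  proof -
    have 1: "D (y * h) = D y * h + y * D h - D 1 * y * h"
      unfolding D_def by (rule B_leibniz[OF g(1) n0(1) yA that])
    have "D' (y * h) = ((D y - D 1 * y) * v) * h + y * D' h"
      unfolding D'_def 1 by (simp add: algebra_simps)
    then show ?thesis using v(2) by simp
  qed
  have nil_y: "nil y" using g(2) yA ev_eq_0_iff unfolding y_def by blast
  obtain \<phi> where \<phi>: "\<phi> \<in> A" "D' \<phi> = 0" "ev \<phi> = ev 1"
    using kernel_element[OF D' nil_y D'y one_closed] by metis
  obtain \<psi> where \<psi>: "\<psi> \<in> A" "\<phi> * \<psi> = 1" using unit_inverse \<phi> by auto
  have "(D y - D 1 * y) * D' \<phi> = ((D y - D 1 * y) * v) * (D \<phi> - \<phi>)" by (simp add: D'_def mult.assoc)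
  then have D\<phi>: "D \<phi> = \<phi>" using \<phi>(2) v(2) by simp
  have cancel: "\<phi> * (\<psi> * x) = x" for x using \<psi>(2) by (simp flip: mult.assoc)
  let ?B = "gauge \<phi> \<psi> B"
  interpret B': filippov A n ?B by (rule simple_filippov[OF gauge_simple[OF B \<phi>(1) \<psi>]])
  define f where "f i = (if i = 0 then 1 else \<psi> * g i)" for i
  \<comment> \<open>From \<open>e 0\<close> to \<open>e n\<close> the constant terms are removed
    slot by slot; each removal changes the bracket by a multiple of one with 1 in slots 0 and
    \<open>j\<close>.\<close>
  define e where "e j i = (if i = 0 then 1 else if i < j then \<psi> * g i - \<kappa> (ev (\<psi> * g i)) else \<psi> * g i)" for j i
  have args_e: "args (e j)" for j
    unfolding args_def e_def using argsD[OF g(1)] \<psi>(1) by auto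
  have "?B (e j) = 1" if "j \<le> n" for j
    using that
  proof (induction j)
    case 0
    have "(\<lambda>i. \<phi> * e 0 i) = g(0 := \<phi>)" by (auto simp: e_def cancel)
    then have "?B (e 0) = \<psi> * D \<phi>" by (simp add: gauge_def D_def)
    then show ?case using D\<phi> \<psi>(2) by (simp add: mult.commute)
  next
    case (Suc j)
    show ?case
    proof (cases "j = 0")
      case True
      then have "e (Suc j) = e j" by (auto simp: e_def)
      then show ?thesis using Suc by simp
    next
      case False
      have j: "j < n" using Suc by simp
      have p: "\<psi> * g j \<in> A" using argsD[OF g(1) j] \<psi>(1) by blast
      let ?c = "\<kappa> (ev (\<psi> * g j))"
      have "e (Suc j) = (e j)(j := \<psi> * g j - ?c)" using False by (auto simp: e_def fun_eq_iff)
      then have "?B (e (Suc j)) = ?B ((e j)(j := \<psi> * g j)) - ?B ((e j)(j := ?c * 1))"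
        using B'.B_diff[OF args_e j p \<kappa>_closed] by simp
      also have "(e j)(j := \<psi> * g j) = e j" using False by (auto simp: e_def fun_eq_iff)
      also have "?B ((e j)(j := ?c * 1)) = ?c * ?B ((e j)(j := 1))"
        by (rule linop_scale[OF simple_linop[OF gauge_simple[OF B \<phi>(1) \<psi>] args_e j] one_closed])
      also have "?B ((e j)(j := 1)) = 0"
      proof (rule skew_dup[OF B'.skew_B _ n0(1) j])
        show "args ((e j)(j := 1))" using args_e by blast
        show "0 \<noteq> j" using False by simp
        then show "((e j)(j := 1)) 0 = ((e j)(j := 1)) j" by (simp add: e_def)
      qed
      finally show ?thesis using Suc by simp
    qed
  qed
  then have Be: "?B (e n) = 1" by simp
  have "nambu_frame A n ?B (e n)"
    by unfold_locales (use args_e Be in \<open>auto simp: e_def\<close>)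
  moreover have "nil (e n i)" if "0 < i" "i < n" for i
    using nil_ev[of "\<psi> * g i"] argsD[OF g(1) that(2)] \<psi>(1) that by (simp add: e_def)
  ultimately show thesis using that \<phi>(1) \<psi> by blast
qed

text \<open>Every term of the determinant contains some operator applied to
  \<open>g 0\<close>.\<close>

lemma det_op_first_in_ideal:
  assumes I: "ideal I" and g: "args g" and n: "0 < n"
    and F: "\<And>i x. i < n \<Longrightarrow> x \<in> A \<Longrightarrow> F i x \<in> A" "\<And>i. i < n \<Longrightarrow> F i (g 0) \<in> I"
  shows "det_op n F g \<in> I"
proof -
  have "det_op n F (g(0 := g 0)) \<in> I"
    unfolding det_op_upd[OF n]
  proof (rule ideal_sum[OF I])
    fix s assume "s \<in> {s. s permutes {..<n}}"
    then have s: "s i < n" if "i < n" for i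
      using permutes_in_image[of s "{..<n}" i] that by auto
    show "F (s 0) (g 0) * (of_int (sign s) * (\<Prod>i\<in>{..<n} - {0}. F (s i) (g i))) \<in> I"
      using s argsD[OF g] n by (intro ideal_mult_right[OF I _ F(2)] mult_closed prod_closed F(1)) auto
  qed
  then show ?thesis by simp
qed

definition nambu_form :: "((nat \<Rightarrow> 'a) \<Rightarrow> 'a) \<Rightarrow> bool" where
  "nambu_form B \<longleftrightarrow> (\<exists>\<delta> z. power_series_coords A \<kappa> \<U> n \<delta> z \<and> (\<forall>g. args g \<longrightarrow> B g = det_op n \<delta> g))"

definition dzhumadildaev_form :: "((nat \<Rightarrow> 'a) \<Rightarrow> 'a) \<Rightarrow> bool" where
  "dzhumadildaev_form B \<longleftrightarrow> (\<exists>\<delta> z. power_series_coords A \<kappa> \<U> (n - 1) \<delta> z \<and>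
     (\<forall>g. args g \<longrightarrow> B g = det_op n (\<lambda>j x. if j = 0 then x else \<delta> (j - 1) x) g))"

end

section \<open>The Euler derivation and the two normal forms\<close>

locale simple_frame = bracket_alg A \<kappa> \<U> n + nambu_frame A n B e
  for A :: "'a::comm_ring_1 set" and \<kappa> :: "'k::{alg_closed_field, field_char_0} \<Rightarrow> 'a" and \<U> n B e +
  assumes simple: "simple_bracket B"
    and nil_e: "0 < i \<Longrightarrow> i < n \<Longrightarrow> nil (e i)"
begin

lemma linop_d: "i < n \<Longrightarrow> linop (d i)"
  using simple_linop[OF simple args_e] unfolding d_def by blast

definition E :: "'a \<Rightarrow> 'a" where
  "E f = (\<Sum>i<n. e i * d i f) - f"

lemma linop_sum_family:
  "(\<And>i. i \<in> S \<Longrightarrow> linop (F i)) \<Longrightarrow> linop (\<lambda>x. \<Sum>i\<in>S. F i x)"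
proof (induction S rule: infinite_finite_induct)
  case (insert i S)
  then show ?case using linop_plus[of "F i" "\<lambda>x. \<Sum>i\<in>S. F i x"] by simp
qed (use linop_mult[of 0] in auto)

lemma linop_E: "linop E"
  unfolding E_def
  by (intro linop_minus linop_sum_family linop_compose[OF linop_mult linop_d] linop_id) auto

lemma E_closed [simp, intro]: "f \<in> A \<Longrightarrow> E f \<in> A"
  using linop_closed[OF linop_E] .

lemma euler_sum: "(\<Sum>i<n. e i * d i f) = f + E f"
  by (simp add: E_def)

text \<open>Only the summand \<open>i = 0\<close> violates the product rule, by
  \<open>- x * y\<close>; subtracting the identity repairs exactly this.\<close>

lemma E_mult:
  assumes x: "x \<in> A" and y: "y \<in> A"
  shows "E (x * y) = E x * y + x * E y"
proof -
  have "(\<Sum>i<n. e i * d i (x * y))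
      = (\<Sum>i<n. (e i * d i x) * y + x * (e i * d i y) - (if i = 0 then x * y else 0))"
  proof (rule sum.cong[OF refl])
    fix k assume "k \<in> {..<n}"
    then have "d k (x * y) = d k x * y + x * d k y - (if k = 0 then 1 else 0) * x * y"
      using d_mult[OF _ x y, of k] d_1[of k] by simp
    then show "e k * d k (x * y) = (e k * d k x) * y + x * (e k * d k y) - (if k = 0 then x * y else 0)"
      using e_0 by (cases "k = 0") (simp_all add: algebra_simps)
  qed
  also have "\<dots> = (\<Sum>i<n. e i * d i x) * y + x * (\<Sum>i<n. e i * d i y) - x * y"
    by (simp add: sum.distrib sum_subtractf sum_distrib_left sum_distrib_right)
  finally show ?thesis unfolding euler_sum by (simp add: algebra_simps)
qed

lemma E_e: "j < n \<Longrightarrow> E (e j) = 0"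
  by (simp add: E_def d_e if_distrib cong: if_cong)

lemma E_1: "E 1 = 0"
  using E_e[of 0] e_0 by simp

text \<open>The term \<open>k = i\<close> contributes \<open>d i f\<close> from
  \<open>d i (e i) = 1\<close>, the term \<open>k = 0\<close> contributes \<open>- d i f\<close>
  from the commutator with \<open>d 0\<close>; the two cancel.\<close>

lemma d_E:
  assumes i: "0 < i" "i < n" and f: "f \<in> A"
  shows "d i (E f) = E (d i f)"
proof -
  have cl: "\<And>k. k \<in> {..<n} \<Longrightarrow> e k * d k f \<in> A" using f by simp
  have "d i (E f) = d i (\<Sum>k<n. e k * d k f) - d i f"
    unfolding E_def by (rule d_diff[OF i(2) sum_closed[OF cl] f])
  also have "d i (\<Sum>k<n. e k * d k f) = (\<Sum>k<n. d i (e k * d k f))"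
    by (rule d_sum[OF i(2) cl])
  also have "(\<Sum>k<n. d i (e k * d k f)) = (\<Sum>k<n. (if k = i then d i f else 0)
      + (e k * d k (d i f) - (if k = 0 then d i f else 0)))"
  proof (rule sum.cong[OF refl])
    fix k assume "k \<in> {..<n}"
    then have k: "k < n" by simp
    have "d i (e k * d k f) = d i (e k) * d k f + e k * d i (d k f)"
      using k f by (intro d_deriv[OF i]) auto
    then show "d i (e k * d k f) = (if k = i then d i f else 0)
        + (e k * d k (d i f) - (if k = 0 then d i f else 0))"
      using d_commutator[OF i(2) k f] i k e_0 by (auto simp: d_e)
  qed
  also have "\<dots> = (\<Sum>k<n. e k * d k (d i f))"
    using i by (simp add: sum.distrib sum_subtractf)
  finally show ?thesis by (simp add: E_def)
qed

lemma d_commute: "0 < i \<Longrightarrow> i < n \<Longrightarrow> 0 < j \<Longrightarrow> j < n \<Longrightarrow> f \<in> A \<Longrightarrow> d i (d j f) = d j (d i f)"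
  using d_commutator[of i j f] by simp

text \<open>\<open>d 0\<close> is exchanged for the full Euler sum. This adds multiples of the other
  operators, so the determinant is unchanged, and all operators now commute.\<close>

definition rows :: "nat \<Rightarrow> 'a \<Rightarrow> 'a" where
  "rows j f = (if j = 0 then f + E f else d j f)"

lemma rows_closed: "j < n \<Longrightarrow> f \<in> A \<Longrightarrow> rows j f \<in> A"
  by (simp add: rows_def)

lemma B_eq_rows:
  assumes g: "args g"
  shows "B g = det_op n rows g"
proof -
  have "B g = D g"
  proof (rule B_eq_D[OF ideal_ev _ _ _ g])
    show "1 \<notin> {x \<in> A. ev x = 0}" by simp
    show "\<exists>b\<in>A. a * b = 1" if "a \<in> A" "a \<notin> {x \<in> A. ev x = 0}" for a using that ev_unit by simp
    show "I = {0} \<or> I = A" if "ideal I" "\<And>g. args g \<Longrightarrow> g 0 \<in> I \<Longrightarrow> B g \<in> I" for I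
      using simple_ideal[OF simple that] .
  qed
  also have "D g = det_op n rows g"
  proof (rule skew_jet_unique[OF skew_D jet_D _ _ _ g])
    show "skew (det_op n rows)" by (rule det_op_skew) (rule rows_closed)
    show "jet (det_op n rows) p" if "p < n" for p
    proof (rule det_op_jet[OF _ that])
      fix i f assume i: "i < n" and f: "f \<in> A"
      show "rows i f = (\<Sum>k<n. d k f * rows i (e k))"
      proof (cases "i = 0")
        case True
        have "(\<Sum>k<n. d k f * rows i (e k)) = (\<Sum>k<n. e k * d k f)"
          by (rule sum.cong[OF refl]) (use True E_e in \<open>simp add: rows_def mult.commute\<close>)
        then show ?thesis using True by (simp add: rows_def euler_sum)
      next
        case False
        then show ?thesis using sum_d_delta[OF i, of "\<lambda>k. d k f"] by (simp add: rows_def)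
      qed
    qed
    \<comment> \<open>Column 0 holds the \<open>e i\<close>, the other columns are those of the
      identity matrix, and \<open>e 0 = 1\<close>.\<close>
    let ?m = "Matrix.mat n n (\<lambda>(i, j). rows j (e i))"
    have "Determinant.det ?m = prod_list (diag_mat ?m)"
      by (rule det_lower_triangular[of n]) (auto simp: rows_def d_e)
    also have "diag_mat ?m = replicate n 1"
      unfolding diag_mat_def by (intro nth_equalityI) (auto simp: rows_def d_e e_0 E_1)
    finally show "D e = det_op n rows e" by (simp add: det_op_def D_e)
  qed simp
  finally show ?thesis .
qed

lemma B_in_ideal:
  assumes I: "ideal I" and g: "args g" "g 0 \<in> I"
    and st: "\<And>x. x \<in> I \<Longrightarrow> E x \<in> I" "\<And>i x. 0 < i \<Longrightarrow> i < n \<Longrightarrow> x \<in> I \<Longrightarrow> d i x \<in> I"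
  shows "B g \<in> I"
  unfolding B_eq_rows[OF g(1)]
  by (rule det_op_first_in_ideal[OF I g(1) _ rows_closed]) (use g(2) st ideal_add[OF I] in \<open>auto simp: rows_def\<close>)

text \<open>
  The range of \<open>E\<close> lies in the ideal of all \<open>x\<close> whose iterated derivatives vanish under \<open>ev\<close>.
\<close>
lemma E_eq_0:
  assumes "\<And>f. f \<in> A \<Longrightarrow> ev (E f) = 0" and f: "f \<in> A"
  shows "E f = 0"
proof -
  \<comment> \<open>Lists of indices encode iterated derivatives, so that the product rule can be
    used by induction on the list.\<close>
  let ?L = "{is. set is \<subseteq> {0<..<n}}"
  have fold_lin: "linop (fold d is)" if "is \<in> ?L" for "is"
    using that
  proof (induction "is")
    case (Cons i "is")
    then show ?case using linop_compose[of "fold d is" "d i"] linop_d[of i] by (simp add: comp_def)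
  qed (simp add: linop_id id_def)
  have fold_E: "fold d is (E x) = E (fold d is x)" if "is \<in> ?L" "x \<in> A" for "is" x
    using that
  proof (induction "is" arbitrary: x)
    case (Cons i "is")
    then show ?case by (simp add: d_E)
  qed simp
  define I where "I = {x\<in>A. \<forall>is. is \<in> ?L \<longrightarrow> ev (fold d is x) = 0}"
  have I_D: "ev (fold d is x) = 0" if "x \<in> I" "is \<in> ?L" for x "is" using that by (simp add: I_def)
  have I_A: "x \<in> A" if "x \<in> I" for x using that by (simp add: I_def)
  have I_I: "x \<in> I" if "x \<in> A" "\<And>is. is \<in> ?L \<Longrightarrow> ev (fold d is x) = 0" for x
    using that by (simp add: I_def)
  have d_I: "d i x \<in> I" if "0 < i" "i < n" "x \<in> I" for i x
  proof (rule I_I)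
    show "d i x \<in> A" using I_A[OF that(3)] by simp
    fix ks assume "ks \<in> ?L"
    then have "i # ks \<in> ?L" using that by simp
    from I_D[OF that(3) this] show "ev (fold d ks (d i x)) = 0" by simp
  qed
  have mult: "ev (fold d is (a * x)) = 0" if "a \<in> A" "x \<in> I" "is \<in> ?L" for a x "is"
    using that
  proof (induction "is" arbitrary: a x)
    case Nil
    have "ev x = 0" using I_D[OF Nil(2), of "[]"] by simp
    then show ?case using Nil(1) I_A[OF Nil(2)] by (simp add: ev_mult)
  next
    case (Cons i "is")
    then have i: "0 < i" "i < n" and L: "is \<in> ?L" by auto
    note x = I_A[OF Cons.prems(2)]
    have "fold d (i # is) (a * x) = fold d is (d i a * x) + fold d is (a * d i x)"
      using Cons.prems(1) x i by (simp add: d_deriv linop_add[OF fold_lin[OF L]])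
    moreover have "ev (fold d is (d i a * x)) = 0" "ev (fold d is (a * d i x)) = 0"
      using Cons.IH[OF _ Cons.prems(2) L] Cons.IH[OF Cons.prems(1) d_I[OF i Cons.prems(2)] L] Cons.prems(1)
      by simp_all
    ultimately show ?case
      using linop_closed[OF fold_lin[OF L]] Cons.prems(1) x by (simp add: ev_add)
  qed
  have I: "ideal I"
    unfolding ideal_def
  proof (intro conjI ballI)
    show "I \<subseteq> A" using I_A by blast
    show "0 \<in> I" by (rule I_I) (simp_all add: linop_0[OF fold_lin])
    show "x + y \<in> I" if "x \<in> I" "y \<in> I" for x y
    proof (rule I_I)
      fix "is" assume L: "is \<in> ?L"
      show "ev (fold d is (x + y)) = 0"
        using linop_add[OF fold_lin[OF L] I_A[OF that(1)] I_A[OF that(2)]] I_D[OF that(1) L] I_D[OF that(2) L]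
          linop_closed[OF fold_lin[OF L] I_A[OF that(1)]] linop_closed[OF fold_lin[OF L] I_A[OF that(2)]]
        by (simp add: ev_add)
    qed (use that I_A in simp)
    show "a * x \<in> I" if "a \<in> A" "x \<in> I" for a x
      by (rule I_I) (use that I_A mult in auto)
  qed
  \<comment> \<open>An iterated derivative of \<open>E x\<close> is \<open>E\<close> of an iterated
    derivative, whose residue is 0 by assumption.\<close>
  have E_I: "E x \<in> I" if x: "x \<in> A" for x
    by (rule I_I) (use x fold_E assms(1) linop_closed[OF fold_lin] in auto)
  have "I = {0} \<or> I = A"
    by (rule simple_ideal[OF simple I], rule B_in_ideal[OF I]) (use d_I E_I I_A in auto)
  moreover have "1 \<notin> I" using I_D[of 1 "[]"] by auto
  ultimately have "I = {0}" by blast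
  then show ?thesis using E_I[OF f] by blast
qed

text \<open>With \<open>E = 0\<close> the first operator is the identity, so stability under the
  derivations \<open>d i\<close> with \<open>i > 0\<close> already makes an ideal stable under
  \<open>B\<close>.\<close>

lemma dzhumadildaev_case:
  assumes "\<And>f. f \<in> A \<Longrightarrow> ev (E f) = 0"
  shows "dzhumadildaev_form B"
proof -
  note E0 = E_eq_0[OF assms]
  have "power_series_coords A \<kappa> \<U> (n - 1) (\<lambda>i. d (Suc i)) (\<lambda>i. e (Suc i))"
  proof unfold_locales
    show "I = {0}" if I: "ideal I" "\<And>x. x \<in> I \<Longrightarrow> ev x = 0"
      "\<And>i x. i < n - 1 \<Longrightarrow> x \<in> I \<Longrightarrow> d (Suc i) x \<in> I" for I
    proof -
      have "d i x \<in> I" if "0 < i" "i < n" "x \<in> I" for i x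
        using I(3)[of "i - 1" x] that by simp
      then have "I = {0} \<or> I = A"
        using E0 ideal_subset[OF I(1)] ideal_zero[OF I(1)]
        by (intro simple_ideal[OF simple I(1)] B_in_ideal[OF I(1)]) auto
      moreover have "1 \<notin> I" using I(2)[of 1] by auto
      ultimately show ?thesis by blast
    qed
  qed (use linop_d d_deriv d_commute nil_e d_e in auto)
  moreover have "B g = det_op n (\<lambda>j x. if j = 0 then x else d (Suc (j - 1)) x) g" if "args g" for g
    unfolding B_eq_rows[OF that]
    by (rule det_op_cong) (use argsD[OF that] E0 in \<open>auto simp: rows_def\<close>)
  ultimately show ?thesis unfolding dzhumadildaev_form_def by blast
qed

text \<open>First \<open>(1 + E) \<phi> = 0\<close> is solved along \<open>y\<close>, where
  \<open>E y\<close> is a unit; then \<open>kernel_element\<close> with \<open>x = e j\<close>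
  annihilates one \<open>d j\<close> after another. Its last clause keeps the earlier equations,
  since \<open>1 + E\<close> and the \<open>d i\<close> with \<open>0 < i < j\<close> commute with
  \<open>d j\<close> and with multiplication by \<open>e j\<close>.\<close>

lemma nambu_gauge_factor:
  assumes f: "f \<in> A" and Ef: "ev (E f) \<noteq> 0"
  obtains \<phi> where "\<phi> \<in> A" "ev \<phi> = 1" "E \<phi> = - \<phi>" "\<And>i. 0 < i \<Longrightarrow> i < n \<Longrightarrow> d i \<phi> = 0"
proof -
  let ?D = "\<lambda>x. x + E x"
  have D: "linop ?D" by (rule linop_plus[OF linop_id linop_E])
  define y where "y = f - \<kappa> (ev f)"
  have yA: "y \<in> A" using f by (simp add: y_def)
  have "E (\<kappa> c) = 0" for c using linop_scale[OF linop_E one_closed, of c] E_1 by simp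
  then have Ey: "E y = E f" unfolding y_def using linop_diff[OF linop_E f \<kappa>_closed] by simp
  obtain v where v: "v \<in> A" "E y * v = 1" using ev_unit[OF E_closed[OF yA]] Ef Ey by metis
  let ?D' = "\<lambda>x. v * ?D x"
  have D': "linop ?D'" by (rule linop_compose[OF linop_mult[OF v(1)] D])
  have "?D' (y * h) = h + y * ?D' h" if "h \<in> A" for h
  proof -
    have "?D' (y * h) = (E y * v) * h + y * ?D' h" using E_mult[OF yA that] by (simp add: algebra_simps)
    then show ?thesis using v(2) by simp
  qed
  then obtain \<phi>0 where \<phi>0: "\<phi>0 \<in> A" "?D' \<phi>0 = 0" "ev \<phi>0 = ev 1"
    using kernel_element[OF D' _ _ one_closed, of y] nil_ev[OF f] unfolding y_def by metis
  have "E y * (v * ?D \<phi>0) = ?D \<phi>0" using v(2) by (simp flip: mult.assoc)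
  then have D\<phi>0: "?D \<phi>0 = 0" using \<phi>0(2) by simp
  have "\<exists>\<phi>\<in>A. ev \<phi> = 1 \<and> ?D \<phi> = 0 \<and> (\<forall>i. 0 < i \<longrightarrow> i < j \<longrightarrow> d i \<phi> = 0)" if "j \<le> n" for j
    using that
  proof (induction j)
    case 0
    then show ?case using \<phi>0 D\<phi>0 by auto
  next
    case (Suc j)
    then obtain \<phi> where \<phi>: "\<phi> \<in> A" "ev \<phi> = 1" "?D \<phi> = 0" "\<And>i. 0 < i \<Longrightarrow> i < j \<Longrightarrow> d i \<phi> = 0" by auto
    show ?case
    proof (cases "j = 0")
      case True
      then show ?thesis using \<phi> by auto
    next
      case False
      then have j: "0 < j" "j < n" using Suc by auto
      have dj: "d j (e j * h) = h + e j * d j h" if "h \<in> A" for h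
        using d_deriv[OF j e_closed[OF j(2)] that] d_e[OF j(2) j(2)] by simp
      obtain \<omega> where \<omega>: "\<omega> \<in> A" "d j \<omega> = 0" "ev \<omega> = ev \<phi>"
        "\<And>H. linop H \<Longrightarrow> (\<And>h. h \<in> A \<Longrightarrow> H (e j * h) = e j * H h) \<Longrightarrow>
          (\<And>h. h \<in> A \<Longrightarrow> H (d j h) = d j (H h)) \<Longrightarrow> H \<phi> = 0 \<Longrightarrow> H \<omega> = 0"
        using kernel_element[OF linop_d[OF j(2)] nil_e[OF j] dj \<phi>(1)] by metis
      have "?D \<omega> = 0"
      proof (rule \<omega>(4)[OF D _ _ \<phi>(3)])
        show "?D (e j * h) = e j * ?D h" if "h \<in> A" for h
          using E_mult[OF e_closed[OF j(2)] that] E_e[OF j(2)] by (simp add: distrib_left)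
        show "?D (d j h) = d j (?D h)" if "h \<in> A" for h
          using d_E[OF j that] d_add[OF j(2) that E_closed[OF that]] by simp
      qed
      moreover have "d i \<omega> = 0" if i: "0 < i" "i < j" for i
      proof (rule \<omega>(4)[OF linop_d _ _ \<phi>(4)[OF i]])
        show "i < n" using i j by simp
        show "d i (e j * h) = e j * d i h" if "h \<in> A" for h
          using d_deriv[of i "e j" h] that i j d_e[of j i] by simp
        show "d i (d j h) = d j (d i h)" if "h \<in> A" for h
          using d_commute[of i j h] that i j by simp
      qed
      moreover have "d i \<omega> = 0" if "i = j" for i using \<omega>(2) that by simp
      ultimately show ?thesis using \<omega>(1,3) \<phi>(2) less_antisym by (metis less_Suc_eq)
    qed
  qed
  then obtain \<phi> where "\<phi> \<in> A" "ev \<phi> = 1" "?D \<phi> = 0" "\<And>i. 0 < i \<Longrightarrow> i < n \<Longrightarrow> d i \<phi> = 0" by blast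
  then show thesis using that by (metis add_eq_0_iff)
qed

text \<open>Because of \<open>E \<phi> = - \<phi>\<close>, the operator \<open>1 + E\<close> sends
  \<open>\<phi> * f\<close> to \<open>\<phi> * E f\<close>. Each of the n operators releases one
  factor \<open>\<phi>\<close>; \<open>\<psi>\<close> cancels one, and the rest is put on operator
  0.\<close>

lemma gauge_eq_det_op:
  assumes \<phi>: "\<phi> \<in> A" "E \<phi> = - \<phi>" "\<And>i. 0 < i \<Longrightarrow> i < n \<Longrightarrow> d i \<phi> = 0"
    and \<psi>: "\<psi> \<in> A" "\<phi> * \<psi> = 1" and g: "args g"
  shows "gauge \<phi> \<psi> B g = det_op n (\<lambda>j f. if j = 0 then \<phi> ^ (n - 1) * E f else d j f) g"
proof -
  let ?r = "\<lambda>j f. if j = 0 then E f else d j f"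
  have rows: "rows j (\<phi> * f) = \<phi> * ?r j f" if "f \<in> A" "j < n" for f j
    using that E_mult[OF \<phi>(1) that(1)] \<phi>(2) d_deriv[of j \<phi> f] \<phi>(1,3)
    by (simp add: rows_def algebra_simps)
  have "n = Suc (n - 1)" using n_gt_2 by simp
  then have "\<psi> * \<phi> ^ n = (\<phi> * \<psi>) * \<phi> ^ (n - 1)" by (metis mult.commute mult.assoc power_Suc)
  then have pow: "\<psi> * \<phi> ^ n = \<phi> ^ (n - 1)" using \<psi>(2) by simp
  have "gauge \<phi> \<psi> B g = (\<Sum>s | s permutes {..<n}. \<psi> * (of_int (sign s) * (\<Prod>i<n. rows (s i) (\<phi> * g i))))"
    unfolding gauge_def B_eq_rows[OF args_mult[OF \<phi>(1) g]] det_op_sum sum_distrib_left ..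
  also have "\<dots> = det_op n (\<lambda>j f. if j = 0 then \<phi> ^ (n - 1) * E f else d j f) g"
    unfolding det_op_sum
  proof (rule sum.cong[OF refl])
    fix s assume "s \<in> {s. s permutes {..<n}}"
    then have s: "s permutes {..<n}" by simp
    have sn: "s i < n" if "i < n" for i using permutes_in_image[OF s, of i] that by auto
    have "(\<Prod>i<n. rows (s i) (\<phi> * g i)) = (\<Prod>i<n. \<phi> * ?r (s i) (g i))"
      by (rule prod.cong[OF refl]) (use rows argsD[OF g] sn in auto)
    also have "\<dots> = \<phi> ^ n * (\<Prod>i<n. ?r (s i) (g i))" by (simp only: prod.distrib) simp
    finally have 1: "\<psi> * (of_int (sign s) * (\<Prod>i<n. rows (s i) (\<phi> * g i)))
        = (\<psi> * \<phi> ^ n) * (of_int (sign s) * (\<Prod>i<n. ?r (s i) (g i)))"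
      by (simp add: mult_ac)
    have inv: "s i = 0 \<longleftrightarrow> i = inv_into UNIV s 0" for i
      using permutes_inv_eq[OF s, of 0 i] by auto
    \<comment> \<open>A permutation takes the value 0 exactly once, so the factor appears once in
      each term.\<close>
    have pr: "(\<Prod>i<n. if s i = 0 then \<phi> ^ (n - 1) else 1) = \<phi> ^ (n - 1)"
      unfolding inv using permutes_in_image[OF permutes_inv[OF s], of 0] by simp
    have "(\<Prod>i<n. if s i = 0 then \<phi> ^ (n - 1) * E (g i) else d (s i) (g i))
        = (\<Prod>i<n. (if s i = 0 then \<phi> ^ (n - 1) else 1) * ?r (s i) (g i))"
      by (rule prod.cong) auto
    also have "\<dots> = \<phi> ^ (n - 1) * (\<Prod>i<n. ?r (s i) (g i))" unfolding prod.distrib pr ..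
    finally show "\<psi> * (of_int (sign s) * (\<Prod>i<n. rows (s i) (\<phi> * g i))) = of_int (sign s) *
        (\<Prod>i<n. if s i = 0 then \<phi> ^ (n - 1) * E (g i) else d (s i) (g i))"
      unfolding 1 pow by (simp add: mult_ac)
  qed
  finally show ?thesis .
qed

text \<open>
  In the new coordinate \<open>y\<close> the first row \<open>\<phi> ^ (n - 1) * E\<close> becomes a partial derivative, since
  \<open>E \<psi> = \<psi>\<close> gives \<open>E (\<psi> ^ (n - 1)) = (n - 1) \<psi> ^ (n - 1)\<close>.
\<close>
lemma nambu_case:
  assumes f: "f \<in> A" and Ef: "ev (E f) \<noteq> 0"
  shows "\<exists>\<phi>\<in>A. \<exists>\<psi>\<in>A. \<phi> * \<psi> = 1 \<and> nambu_form (gauge \<phi> \<psi> B)"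
proof -
  obtain \<phi> where \<phi>: "\<phi> \<in> A" "ev \<phi> = 1" "E \<phi> = - \<phi>" "\<And>i. 0 < i \<Longrightarrow> i < n \<Longrightarrow> d i \<phi> = 0"
    using nambu_gauge_factor[OF f Ef] by blast
  obtain \<psi> where \<psi>: "\<psi> \<in> A" "\<phi> * \<psi> = 1" using unit_inverse[OF \<phi>(1,2)] by blast
  have cancel: "x = 0" if "\<phi> * x = 0" for x
    using that \<psi>(2) by (metis mult.left_commute mult.right_neutral mult_zero_right)
  have "E \<phi> * \<psi> + \<phi> * E \<psi> = 0" using E_mult[OF \<phi>(1) \<psi>(1)] \<psi>(2) E_1 by simp
  then have "\<phi> * (E \<psi> - \<psi>) = 0" by (simp add: \<phi>(3) algebra_simps)
  then have E\<psi>: "E \<psi> = \<psi>" using cancel[of "E \<psi> - \<psi>"] by simp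
  have d\<psi>: "d i \<psi> = 0" if i: "0 < i" "i < n" for i
  proof -
    have "d i \<phi> * \<psi> + \<phi> * d i \<psi> = 0" using d_deriv[OF i \<phi>(1) \<psi>(1)] \<psi>(2) d_1[OF i(2)] i by simp
    then show ?thesis using cancel \<phi>(4)[OF i] by simp
  qed
  have E_pow: "E (\<psi> ^ k) = of_nat k * \<psi> ^ k" for k
  proof (induction k)
    case (Suc k)
    then show ?case using E_mult[OF \<psi>(1) power_closed[OF \<psi>(1)], of k] E\<psi> by (simp add: algebra_simps)
  qed (simp add: E_1)
  have d_pow: "d i (x ^ k) = 0" if i: "0 < i" "i < n" and x: "x \<in> A" "d i x = 0" for i x k
  proof (induction k)
    case (Suc k)
    then show ?case using d_deriv[OF i x(1) power_closed[OF x(1)], of k] x(2) by simp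
  qed (use d_1[OF i(2)] i in simp)
  define y0 where "y0 = \<kappa> (1 / of_nat (n - 1)) * \<psi> ^ (n - 1)"
  have y0A: "y0 \<in> A" using \<psi>(1) by (simp add: y0_def)
  have const: "H (\<kappa> c) = 0" if "linop H" "H 1 = 0" for H c
    using linop_scale[OF that(1) one_closed, of c] that(2) by simp
  define y where "y = y0 - \<kappa> (ev y0)"
  have yA: "y \<in> A" and nil_y: "nil y" using y0A nil_ev unfolding y_def by auto
  have n1: "of_nat (n - 1) \<noteq> (0 :: 'k)" unfolding of_nat_eq_0_iff using n_gt_2 by arith
  have "E y = E y0" unfolding y_def using linop_diff[OF linop_E y0A \<kappa>_closed] const[OF linop_E E_1] by simp
  also have "\<dots> = \<kappa> (1 / of_nat (n - 1)) * (\<kappa> (of_nat (n - 1)) * \<psi> ^ (n - 1))"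
    unfolding y0_def by (simp only: linop_scale[OF linop_E power_closed[OF \<psi>(1)]] E_pow \<kappa>_of_nat)
  also have "\<dots> = \<psi> ^ (n - 1)" using n1 by (simp flip: mult.assoc \<kappa>_mult)
  finally have "\<phi> ^ (n - 1) * E y = (\<phi> * \<psi>) ^ (n - 1)" by (simp add: power_mult_distrib)
  then have Ey: "\<phi> ^ (n - 1) * E y = 1" using \<psi>(2) by simp
  have dy: "d i y = 0" if i: "0 < i" "i < n" for i
  proof -
    have "d i y = d i y0" unfolding y_def
      using linop_diff[OF linop_d[OF i(2)] y0A \<kappa>_closed] const[OF linop_d[OF i(2)]] d_1[OF i(2)] i by simp
    then show ?thesis
      unfolding y0_def linop_scale[OF linop_d[OF i(2)] power_closed[OF \<psi>(1)]]
      using d_pow[OF i \<psi>(1) d\<psi>[OF i]] by simp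
  qed
  let ?\<delta> = "\<lambda>j f. if j = 0 then \<phi> ^ (n - 1) * E f else d j f"
  let ?z = "\<lambda>j. if j = 0 then y else e j"
  have form: "gauge \<phi> \<psi> B g = det_op n ?\<delta> g" if "args g" for g
    by (rule gauge_eq_det_op[OF \<phi>(1,3,4) \<psi> that])
  have d_E': "d i (\<phi> ^ (n - 1) * E x) = \<phi> ^ (n - 1) * E (d i x)" if i: "0 < i" "i < n" and x: "x \<in> A" for i x
    using d_deriv[OF i power_closed[OF \<phi>(1)] E_closed[OF x], of "n - 1"] d_pow[OF i \<phi>(1) \<phi>(4)[OF i]] d_E[OF i x]
    by simp
  have \<phi>n: "\<phi> ^ (n - 1) \<in> A" using \<phi>(1) by simp
  have "power_series_coords A \<kappa> \<U> n ?\<delta> ?z"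
  proof unfold_locales
    show "linop (?\<delta> i)" if "i < n" for i
      using that linop_d linop_compose[OF linop_mult[OF \<phi>n] linop_E] by (cases "i = 0") auto
    show "?\<delta> i (x * y) = ?\<delta> i x * y + x * ?\<delta> i y" if "i < n" "x \<in> A" "y \<in> A" for i x y
      using that E_mult[of x y] d_deriv[of i x y] by (simp add: algebra_simps)
    show "?\<delta> i (?\<delta> j x) = ?\<delta> j (?\<delta> i x)" if "i < n" "j < n" "x \<in> A" for i j x
      using that d_E'[of i x] d_E'[of j x] d_commute[of i j x] by auto
    show "nil (?z i)" if "i < n" for i using that nil_y nil_e by simp
    show "?\<delta> i (?z j) = (if i = j then 1 else 0)" if "i < n" "j < n" for i j
      using that Ey dy E_e d_e by auto
    show "I = {0}" if I: "ideal I" "\<And>x. x \<in> I \<Longrightarrow> ev x = 0" "\<And>i x. i < n \<Longrightarrow> x \<in> I \<Longrightarrow> ?\<delta> i x \<in> I" for I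
    proof -
      have "I = {0} \<or> I = A"
      proof (rule simple_ideal[OF gauge_simple[OF simple \<phi>(1) \<psi>] I(1)])
        fix g assume g: "args g" "g 0 \<in> I"
        show "gauge \<phi> \<psi> B g \<in> I"
          unfolding form[OF g(1)]
        proof (rule det_op_first_in_ideal[OF I(1) g(1)])
          show "?\<delta> i x \<in> A" if "i < n" "x \<in> A" for i x using that \<phi>n by simp
          show "?\<delta> i (g 0) \<in> I" if "i < n" for i by (rule I(3)[OF that g(2)])
        qed simp
      qed
      moreover have "1 \<notin> I" using I(2)[of 1] by auto
      ultimately show ?thesis by blast
    qed
  qed
  then show ?thesis unfolding nambu_form_def using form \<phi>(1) \<psi> by blast
qed

end

context bracket_alg
begin

text \<open>Gauge transformations compose, so the factor that normalizes the frame and the one from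
  \<open>nambu_case\<close> merge into one.\<close>

theorem normal_form:
  assumes B: "simple_bracket B"
  shows "\<exists>\<phi>\<in>A. \<exists>\<psi>\<in>A. \<phi> * \<psi> = 1 \<and> (nambu_form (gauge \<phi> \<psi> B) \<or> dzhumadildaev_form (gauge \<phi> \<psi> B))"
proof -
  obtain \<phi> \<psi> e where 1: "\<phi> \<in> A" "\<psi> \<in> A" "\<phi> * \<psi> = 1" "nambu_frame A n (gauge \<phi> \<psi> B) e"
    "\<And>i. 0 < i \<Longrightarrow> i < n \<Longrightarrow> nil (e i)"
    using frame_exists[OF B] by blast
  interpret F: nambu_frame A n "gauge \<phi> \<psi> B" e by (rule 1(4))
  interpret simple_frame A \<kappa> \<U> n "gauge \<phi> \<psi> B" e
    by unfold_locales (use gauge_simple[OF B 1(1-3)] 1(5) in auto)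
  show ?thesis
  proof (cases "\<exists>f\<in>A. ev (E f) \<noteq> 0")
    case True
    then obtain \<phi>' \<psi>' where 2: "\<phi>' \<in> A" "\<psi>' \<in> A" "\<phi>' * \<psi>' = 1"
      "nambu_form (gauge \<phi>' \<psi>' (gauge \<phi> \<psi> B))"
      using nambu_case by blast
    have "gauge \<phi>' \<psi>' (gauge \<phi> \<psi> B) = gauge (\<phi> * \<phi>') (\<psi> * \<psi>') B"
      by (simp add: gauge_def fun_eq_iff mult_ac)
    moreover have "(\<phi> * \<phi>') * (\<psi> * \<psi>') = (\<phi> * \<psi>) * (\<phi>' * \<psi>')" by (simp add: mult_ac)
    ultimately show ?thesis using 1 2 by (metis mult_1 mult_closed)
  next
    case False
    then show ?thesis using dzhumadildaev_case 1 by blast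
  qed
qed

end

section \<open>Open ideals of linearly compact algebras\<close>

locale lc_algebra =
  fixes N :: "('k::field_char_0, 'a::comm_ring_1) np_struct"
    and I :: "'a set" and V :: "'a \<Rightarrow> 'a set" and h :: "'a \<Rightarrow> 'a \<Rightarrow> 'a"
  assumes alg: "commutative_algebra N"
    and top: "topspace (np_topology N) = np_space N"
    and fd: "\<And>i. i \<in> I \<Longrightarrow> \<exists>B. finite B \<and> V i = module.span (np_scale N) B"
    and hom: "homeomorphic_map (np_topology N) (product_topology (\<lambda>i. discrete_topology (V i)) I) h"
    and h_add: "\<And>x y i. x \<in> np_space N \<Longrightarrow> y \<in> np_space N \<Longrightarrow> i \<in> I \<Longrightarrow> h (x + y) i = h x i + h y i"
    and h_scale: "\<And>c x i. x \<in> np_space N \<Longrightarrow> i \<in> I \<Longrightarrow> h (np_scale N c x) i = np_scale N c (h x i)"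
    and mult_cont: "continuous_map (prod_topology (np_topology N) (np_topology N)) (np_topology N) (\<lambda>(x, y). x * y)"
begin

abbreviation "A \<equiv> np_space N"
abbreviation "sc \<equiv> np_scale N"
abbreviation "X \<equiv> np_topology N"

sublocale vs: vector_space sc
  using alg by (simp add: commutative_algebra_def)

lemma subspace_A: "vs.subspace A"
  using alg by (simp add: commutative_algebra_def)

sublocale carrier_ring A
proof
  show "1 \<in> A" "\<And>x y. x \<in> A \<Longrightarrow> y \<in> A \<Longrightarrow> x * y \<in> A" using alg by (auto simp: commutative_algebra_def)
  show "\<And>x y. x \<in> A \<Longrightarrow> y \<in> A \<Longrightarrow> x + y \<in> A" "\<And>x. x \<in> A \<Longrightarrow> - x \<in> A"
    using vs.subspace_add[OF subspace_A] vs.subspace_neg[OF subspace_A] by blast+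
qed

lemma scale_closed [simp, intro]: "x \<in> A \<Longrightarrow> sc c x \<in> A"
  using vs.subspace_scale[OF subspace_A] by blast

lemma scale_mult: "x \<in> A \<Longrightarrow> y \<in> A \<Longrightarrow> sc c (x * y) = sc c x * y"
  using alg by (auto simp: commutative_algebra_def)

definition \<kappa> :: "'k \<Rightarrow> 'a" where
  "\<kappa> c = sc c 1"

lemma scale_\<kappa>: "x \<in> A \<Longrightarrow> sc c x = \<kappa> c * x"
  using scale_mult[of 1 x c] by (simp add: \<kappa>_def)

lemma h_PiE: "x \<in> A \<Longrightarrow> h x \<in> Pi\<^sub>E I V"
  using homeomorphic_imp_surjective_map[OF hom] top by auto

lemma h_V: "x \<in> A \<Longrightarrow> i \<in> I \<Longrightarrow> h x i \<in> V i"
  using h_PiE by blast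

lemma h_inj:
  assumes "x \<in> A" "y \<in> A" "\<And>i. i \<in> I \<Longrightarrow> h x i = h y i"
  shows "x = y"
proof -
  have "h x = h y" using assms(3) h_PiE[OF assms(1)] h_PiE[OF assms(2)] by (intro PiE_ext) auto
  then show ?thesis using homeomorphic_imp_injective_map[OF hom] assms(1,2) top by (auto dest: inj_onD)
qed

lemma h_surj: "y \<in> Pi\<^sub>E I V \<Longrightarrow> \<exists>x\<in>A. h x = y"
  using homeomorphic_imp_surjective_map[OF hom] top by (metis (no_types, lifting) image_iff topspace_product_topology topspace_discrete_topology PiE_cong)

lemma h_0: "i \<in> I \<Longrightarrow> h 0 i = 0"
  using h_add[of 0 0 i] by simp

lemma h_diff: "x \<in> A \<Longrightarrow> y \<in> A \<Longrightarrow> i \<in> I \<Longrightarrow> h (x - y) i = h x i - h y i"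
  using h_add[of "x - y" y i] by (simp add: algebra_simps)

text \<open>The kernel of the projection to the coordinates in \<open>J\<close>. For finite
  \<open>J\<close> these subspaces form a neighbourhood base of 0, but they need not be
  ideals.\<close>

definition K :: "'a set \<Rightarrow> 'a set" where
  "K J = {x\<in>A. \<forall>i\<in>J. h x i = 0}"

lemma K_A: "x \<in> K J \<Longrightarrow> x \<in> A"
  and K_D: "x \<in> K J \<Longrightarrow> i \<in> J \<Longrightarrow> h x i = 0"
  by (auto simp: K_def)

lemma K_subspace: "J \<subseteq> I \<Longrightarrow> vs.subspace (K J)"
  unfolding K_def by (rule vs.subspaceI) (auto simp: h_0 h_add h_scale subset_iff)

lemma K_add: "J \<subseteq> I \<Longrightarrow> x \<in> K J \<Longrightarrow> y \<in> K J \<Longrightarrow> x + y \<in> K J"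
  and K_0: "J \<subseteq> I \<Longrightarrow> 0 \<in> K J"
  and K_scale: "J \<subseteq> I \<Longrightarrow> x \<in> K J \<Longrightarrow> sc c x \<in> K J"
  using K_subspace vs.subspace_add vs.subspace_0 vs.subspace_scale by blast+

lemma K_mono: "J \<subseteq> J' \<Longrightarrow> K J' \<subseteq> K J"
  by (auto simp: K_def)

lemma openin_K_iff:
  "openin X W \<longleftrightarrow> W \<subseteq> A \<and> (\<forall>x\<in>W. \<exists>J. finite J \<and> J \<subseteq> I \<and> (\<forall>u\<in>K J. x + u \<in> W))"
proof (cases "W \<subseteq> A")
  case True
  let ?P = "product_topology (\<lambda>i. discrete_topology (V i)) I"
  have eq: "openin X W \<longleftrightarrow> openin ?P (h ` W)"
    using homeomorphic_map_openness[OF hom, of W] True top by simp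
  show ?thesis
  proof
    assume "openin X W"
    then have op: "openin ?P (h ` W)" using eq by simp
    have "\<exists>J. finite J \<and> J \<subseteq> I \<and> (\<forall>u\<in>K J. x + u \<in> W)" if x: "x \<in> W" for x
    proof -
      obtain U where U: "finite {i \<in> I. U i \<noteq> V i}" "\<And>i. i \<in> I \<Longrightarrow> U i \<subseteq> V i"
        "h x \<in> Pi\<^sub>E I U" "Pi\<^sub>E I U \<subseteq> h ` W"
        using op x unfolding openin_product_topology_alt by (auto 4 4)
      have "x + u \<in> W" if u: "u \<in> K {i \<in> I. U i \<noteq> V i}" for u
      proof -
        have xA: "x \<in> A" "u \<in> A" using x True K_A[OF u] by auto
        have "h (x + u) i \<in> U i" if i: "i \<in> I" for i
        proof (cases "U i = V i")
          case False
          then have "h (x + u) i = h x i" using h_add[OF xA i] K_D[OF u, of i] i by simp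
          then show ?thesis using U(3) i by (metis PiE_mem)
        qed (use h_V[OF _ i, of "x + u"] xA in auto)
        then have "h (x + u) \<in> Pi\<^sub>E I U" using h_PiE[of "x + u"] xA by (auto simp: PiE_iff)
        then obtain w where w: "w \<in> W" "h (x + u) = h w" using U(4) by blast
        have wA: "w \<in> A" using True w(1) by blast
        have "x + u = w" by (rule h_inj[OF add_closed[OF xA] wA]) (simp only: w(2))
        then show ?thesis using w(1) by simp
      qed
      then show ?thesis using U(1) by blast
    qed
    then show "W \<subseteq> A \<and> (\<forall>x\<in>W. \<exists>J. finite J \<and> J \<subseteq> I \<and> (\<forall>u\<in>K J. x + u \<in> W))" using True by blast
  next
    assume R: "W \<subseteq> A \<and> (\<forall>x\<in>W. \<exists>J. finite J \<and> J \<subseteq> I \<and> (\<forall>u\<in>K J. x + u \<in> W))"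
    have "\<exists>U. finite {i \<in> I. U i \<noteq> topspace (discrete_topology (V i))} \<and>
        (\<forall>i\<in>I. openin (discrete_topology (V i)) (U i)) \<and> y \<in> Pi\<^sub>E I U \<and> Pi\<^sub>E I U \<subseteq> h ` W"
      if y: "y \<in> h ` W" for y
    proof -
      obtain x where x: "x \<in> W" "y = h x" using y by blast
      obtain J where "finite J \<and> J \<subseteq> I \<and> (\<forall>u\<in>K J. x + u \<in> W)"
        using bspec[OF conjunct2[OF R] x(1)] ..
      then have J: "finite J" "J \<subseteq> I" "\<And>u. u \<in> K J \<Longrightarrow> x + u \<in> W" by simp_all
      have xA: "x \<in> A" using x True by blast
      define U where "U i = (if i \<in> J then {h x i} else V i)" for i
      have "{i \<in> I. U i \<noteq> topspace (discrete_topology (V i))} \<subseteq> J" by (auto simp: U_def)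
      then have "finite {i \<in> I. U i \<noteq> topspace (discrete_topology (V i))}" using J(1) finite_subset by blast
      moreover have "\<forall>i\<in>I. openin (discrete_topology (V i)) (U i)" using h_V[OF xA] by (auto simp: U_def)
      moreover have "y \<in> Pi\<^sub>E I U" using h_PiE[OF xA] by (auto simp: U_def x(2) PiE_iff)
      moreover have "Pi\<^sub>E I U \<subseteq> h ` W"
      proof
        fix y' assume y': "y' \<in> Pi\<^sub>E I U"
        then have "y' \<in> Pi\<^sub>E I V" using h_V[OF xA] by (auto simp: U_def PiE_iff split: if_splits)
        then obtain x' where x': "x' \<in> A" "h x' = y'" using h_surj by blast
        have "x' - x \<in> K J"
          using x' xA y' J(2) by (auto simp: K_def h_diff U_def PiE_iff subset_iff split: if_splits)
        from J(3)[OF this] have "x' \<in> W" by simp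
        then show "y' \<in> h ` W" using x'(2) by blast
      qed
      ultimately show ?thesis by blast
    qed
    then show "openin X W" unfolding eq openin_product_topology_alt by blast
  qed
next
  case False
  then show ?thesis using openin_subset[of X W] top by blast
qed

lemma openin_K_nbhd:
  assumes "openin X W" "x \<in> W"
  obtains J where "finite J" "J \<subseteq> I" "\<And>u. u \<in> K J \<Longrightarrow> x + u \<in> W"
proof -
  have "\<exists>J. finite J \<and> J \<subseteq> I \<and> (\<forall>u\<in>K J. x + u \<in> W)"
    using bspec[OF conjunct2[OF assms(1)[unfolded openin_K_iff]] assms(2)] .
  then obtain J where "finite J \<and> J \<subseteq> I \<and> (\<forall>u\<in>K J. x + u \<in> W)" ..
  then show thesis using that[of J] by simp
qed

lemma openin_K:
  assumes J: "J \<subseteq> I" "finite J"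
  shows "openin X (K J)"
  unfolding openin_K_iff
proof (intro conjI ballI)
  show "\<exists>J'. finite J' \<and> J' \<subseteq> I \<and> (\<forall>u\<in>K J'. x + u \<in> K J)" if "x \<in> K J" for x
    using J K_add[OF J(1) that] by (intro exI[of _ J]) simp
qed (use K_A in blast)

lemma cont_K:
  assumes F: "continuous_map X X F" "F 0 = 0" and J: "finite J" "J \<subseteq> I"
  shows "\<exists>J'. finite J' \<and> J' \<subseteq> I \<and> (\<forall>x\<in>K J'. F x \<in> K J)"
proof -
  have op: "openin X {x \<in> topspace X. F x \<in> K J}"
    using openin_continuous_map_preimage[OF F(1) openin_K[OF J(2,1)]] .
  have "0 \<in> {x \<in> topspace X. F x \<in> K J}" using F(2) K_0[OF J(2)] top by simp
  from openin_K_nbhd[OF op this] obtain J' where "finite J'" "J' \<subseteq> I"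
    "\<And>u. u \<in> K J' \<Longrightarrow> 0 + u \<in> {x \<in> topspace X. F x \<in> K J}" by metis
  then show ?thesis by (intro exI[of _ J']) simp
qed

lemma mult_K:
  assumes b: "b \<in> A" and J: "finite J" "J \<subseteq> I"
  shows "\<exists>J'. finite J' \<and> J' \<subseteq> I \<and> (\<forall>x\<in>K J'. \<forall>u\<in>K J'. x * (b + u) \<in> K J)"
proof -
  have "openin (prod_topology X X) {p \<in> topspace (prod_topology X X). (case p of (x, y) \<Rightarrow> x * y) \<in> K J}"
    using openin_continuous_map_preimage[OF mult_cont openin_K[OF J(2,1)]] .
  moreover have "(0, b) \<in> {p \<in> topspace (prod_topology X X). (case p of (x, y) \<Rightarrow> x * y) \<in> K J}"
    using b K_0[OF J(2)] top by simp
  ultimately obtain W W' where W: "openin X W" "openin X W'" "0 \<in> W" "b \<in> W'"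
    "W \<times> W' \<subseteq> {p \<in> topspace (prod_topology X X). (case p of (x, y) \<Rightarrow> x * y) \<in> K J}"
    unfolding openin_prod_topology_alt by meson
  obtain J1 where J1: "finite J1" "J1 \<subseteq> I" "\<And>u. u \<in> K J1 \<Longrightarrow> 0 + u \<in> W"
    using openin_K_nbhd[OF W(1,3)] by metis
  obtain J2 where J2: "finite J2" "J2 \<subseteq> I" "\<And>u. u \<in> K J2 \<Longrightarrow> b + u \<in> W'"
    using openin_K_nbhd[OF W(2,4)] by metis
  have "x * (b + u) \<in> K J" if "x \<in> K (J1 \<union> J2)" "u \<in> K (J1 \<union> J2)" for x u
  proof -
    have "x \<in> K J1" "u \<in> K J2" using that K_mono[of J1 "J1 \<union> J2"] K_mono[of J2 "J1 \<union> J2"] by auto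
    then have "(x, b + u) \<in> W \<times> W'" using J1(3)[of x] J2(3)[of u] by simp
    from subsetD[OF W(5) this] show ?thesis by simp
  qed
  moreover have "finite (J1 \<union> J2)" "J1 \<union> J2 \<subseteq> I" using J1(1,2) J2(1,2) by simp_all
  ultimately show ?thesis by (intro exI[of _ "J1 \<union> J2"] conjI ballI)
qed

text \<open>One coordinate at a time: lifts of a basis of the image of \<open>K J\<close> in
  \<open>V i\<close> are added to the complement.\<close>

lemma K_codim:
  assumes "finite J" "J \<subseteq> I"
  shows "\<exists>B. finite B \<and> B \<subseteq> A \<and> (\<forall>x\<in>A. \<exists>b\<in>vs.span B. x - b \<in> K J)"
  using assms
proof (induction J rule: finite_induct)
  case empty
  then show ?case by (intro exI[of _ "{}"]) (auto simp: K_def)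
next
  case (insert i J)
  then have i: "i \<in> I" and J: "J \<subseteq> I" by auto
  obtain B where B: "finite B" "B \<subseteq> A" "\<And>x. x \<in> A \<Longrightarrow> \<exists>b\<in>vs.span B. x - b \<in> K J" using insert by auto
  let ?f = "\<lambda>x. h x i"
  obtain C where C: "C \<subseteq> ?f ` K J" "vs.independent C" "?f ` K J \<subseteq> vs.span C"
    using vs.basis_exists[of "?f ` K J"] by metis
  obtain Bi where Bi: "finite Bi" "V i = vs.span Bi" using fd[OF i] by blast
  have "C \<subseteq> vs.span Bi" using C(1) h_V[OF K_A i] Bi(2) by blast
  then have "finite C" using vs.independent_span_bound[OF Bi(1) C(2)] by blast
  have "\<forall>c\<in>C. \<exists>x. x \<in> K J \<and> ?f x = c" using C(1) by blast
  then obtain g where g: "\<And>c. c \<in> C \<Longrightarrow> g c \<in> K J" "\<And>c. c \<in> C \<Longrightarrow> ?f (g c) = c" by metis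
  have lift: "\<exists>y\<in>vs.span (g ` C). y \<in> K J \<and> ?f y = v" if "v \<in> vs.span C" for v
    using that
  proof (induction rule: vs.span_induct_alt)
    case base
    then show ?case using vs.span_zero K_0[OF J] h_0[OF i] by blast
  next
    case (step c x v)
    then obtain y where y: "y \<in> vs.span (g ` C)" "y \<in> K J" "?f y = v" by blast
    have gx: "g x \<in> K J" "?f (g x) = x" using g step by auto
    have "sc c (g x) + y \<in> vs.span (g ` C)"
      using step(1) by (intro vs.span_add[OF vs.span_scale[OF vs.span_base] y(1)]) simp
    moreover have "sc c (g x) + y \<in> K J" by (intro K_add[OF J] K_scale[OF J] gx(1) y(2))
    moreover have "?f (sc c (g x) + y) = sc c x + v"
      using h_add[OF scale_closed[OF K_A[OF gx(1)]] K_A[OF y(2)] i] h_scale[OF K_A[OF gx(1)] i] gx(2) y(3) by simp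
    ultimately show ?case by blast
  qed
  show ?case
  proof (intro exI[of _ "B \<union> g ` C"] conjI ballI)
    show "finite (B \<union> g ` C)" using B(1) \<open>finite C\<close> by simp
    show "B \<union> g ` C \<subseteq> A" using B(2) g(1) K_A by blast
    fix x assume x: "x \<in> A"
    obtain b where b: "b \<in> vs.span B" "x - b \<in> K J" using B(3)[OF x] by blast
    have "?f (x - b) \<in> vs.span C" using C(3) b(2) by blast
    then obtain y where y: "y \<in> vs.span (g ` C)" "y \<in> K J" "?f y = ?f (x - b)" using lift by blast
    have "(x - b) - y \<in> K J" using vs.subspace_diff[OF K_subspace[OF J] b(2) y(2)] .
    moreover have "?f ((x - b) - y) = 0" using h_diff[OF K_A[OF b(2)] K_A[OF y(2)] i] y(3) by simp
    ultimately have "x - (b + y) \<in> K (insert i J)" by (simp add: K_def diff_diff_eq)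
    moreover have "b + y \<in> vs.span (B \<union> g ` C)"
      using b(1) y(1) vs.span_mono[of B "B \<union> g ` C"] vs.span_mono[of "g ` C" "B \<union> g ` C"]
      by (intro vs.span_add) auto
    ultimately show "\<exists>b\<in>vs.span (B \<union> g ` C). x - b \<in> K (insert i J)" by blast
  qed
qed

definition \<U> :: "'a set set" where
  "\<U> = {U. ideal U \<and> (\<exists>J. finite J \<and> J \<subseteq> I \<and> K J \<subseteq> U)}"

text \<open>The largest ideal inside \<open>K J\<close> is open: continuity of the product at
  \<open>(0, 0)\<close> handles factors from some \<open>K J0\<close>, and modulo
  \<open>K J0\<close> finitely many factors \<open>b\<close> remain, each handled by continuity at
  \<open>(0, b)\<close>.\<close>

lemma ideal_in_K:
  assumes J: "finite J" "J \<subseteq> I"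
  shows "\<exists>U\<in>\<U>. U \<subseteq> K J"
proof -
  let ?U = "{a\<in>A. \<forall>b\<in>A. a * b \<in> K J}"
  have "ideal ?U"
    unfolding ideal_def
  proof (intro conjI ballI)
    show "x + y \<in> ?U" if "x \<in> ?U" "y \<in> ?U" for x y
      using that K_add[OF J(2)] by (auto simp: distrib_right)
    show "a * x \<in> ?U" if "a \<in> A" "x \<in> ?U" for a x
    proof (intro CollectI conjI ballI)
      fix b assume "b \<in> A"
      then have "x * (a * b) \<in> K J" using that by blast
      then show "a * x * b \<in> K J" by (simp add: mult_ac)
    qed (use that in auto)
  qed (use K_0[OF J(2)] in auto)
  moreover have "\<exists>J'. finite J' \<and> J' \<subseteq> I \<and> K J' \<subseteq> ?U"
  proof -
    obtain J0 where J0: "finite J0" "J0 \<subseteq> I" "\<And>x u. x \<in> K J0 \<Longrightarrow> u \<in> K J0 \<Longrightarrow> x * u \<in> K J"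
      using mult_K[OF zero_closed J] by (metis add_0)
    obtain B where B: "finite B" "B \<subseteq> A" "\<And>x. x \<in> A \<Longrightarrow> \<exists>b\<in>vs.span B. x - b \<in> K J0"
      using K_codim[OF J0(1,2)] by blast
    have "\<forall>b\<in>B. \<exists>J'. finite J' \<and> J' \<subseteq> I \<and> (\<forall>x\<in>K J'. x * b \<in> K J)"
    proof
      fix b assume "b \<in> B"
      then have "b \<in> A" using B(2) by blast
      then obtain J' where J': "finite J'" "J' \<subseteq> I" "\<forall>x\<in>K J'. \<forall>u\<in>K J'. x * (b + u) \<in> K J"
        using mult_K[OF _ J] by metis
      have "x * b \<in> K J" if "x \<in> K J'" for x
        using bspec[OF bspec[OF J'(3) that] K_0[OF J'(2)]] by simp
      then show "\<exists>J'. finite J' \<and> J' \<subseteq> I \<and> (\<forall>x\<in>K J'. x * b \<in> K J)"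
        using J'(1,2) by (intro exI[of _ J'] conjI ballI)
    qed
    then obtain Jb where Jb: "\<And>b. b \<in> B \<Longrightarrow> finite (Jb b)" "\<And>b. b \<in> B \<Longrightarrow> Jb b \<subseteq> I"
      "\<And>b x. b \<in> B \<Longrightarrow> x \<in> K (Jb b) \<Longrightarrow> x * b \<in> K J" by metis
    let ?J = "J0 \<union> (\<Union>b\<in>B. Jb b)"
    have "x \<in> ?U" if x: "x \<in> K ?J" for x
    proof -
      have xA: "x \<in> A" using K_A[OF x] .
      have x0: "x \<in> K J0" "\<And>b. b \<in> B \<Longrightarrow> x \<in> K (Jb b)"
        using x K_mono[of J0 ?J] K_mono[of "Jb _" ?J] by blast+
      have span: "y \<in> A \<and> x * y \<in> K J" if "y \<in> vs.span B" for y
        using that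
      proof (induction rule: vs.span_induct_alt)
        case base
        then show ?case using K_0[OF J(2)] by simp
      next
        case (step c b y)
        have bA: "b \<in> A" using step B by blast
        have "x * (sc c b + y) = sc c (x * b) + x * y"
          using scale_mult[OF bA xA, of c] by (simp add: distrib_left mult.commute)
        then show ?case using step bA Jb(3)[OF step(1) x0(2)[OF step(1)]] K_add[OF J(2)] K_scale[OF J(2)] by auto
      qed
      have "x * y \<in> K J" if y: "y \<in> A" for y
      proof -
        obtain b where b: "b \<in> vs.span B" "y - b \<in> K J0" using B(3)[OF y] by blast
        have "x * b + x * (y - b) \<in> K J"
          using span[OF b(1)] J0(3)[OF x0(1) b(2)] K_add[OF J(2)] by blast
        then show ?thesis by (simp add: algebra_simps)
      qed
      then show ?thesis using xA by blast
    qed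
    moreover have "finite ?J" using J0(1) B(1) Jb(1) by simp
    moreover have "?J \<subseteq> I" using J0(2) Jb(2) by blast
    ultimately show ?thesis by blast
  qed
  moreover have "?U \<subseteq> K J"
  proof
    fix x assume "x \<in> ?U"
    then have "x * 1 \<in> K J" by blast
    then show "x \<in> K J" by simp
  qed
  ultimately show ?thesis unfolding \<U>_def by blast
qed

lemma openin_\<U>_iff: "openin X W \<longleftrightarrow> W \<subseteq> A \<and> (\<forall>x\<in>W. \<exists>U\<in>\<U>. \<forall>u\<in>U. x + u \<in> W)"
proof
  assume W: "openin X W"
  show "W \<subseteq> A \<and> (\<forall>x\<in>W. \<exists>U\<in>\<U>. \<forall>u\<in>U. x + u \<in> W)"
  proof (intro conjI ballI)
    show "W \<subseteq> A" using openin_subset[OF W] top by simp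
    fix x assume "x \<in> W"
    then obtain J where J: "finite J" "J \<subseteq> I" "\<And>u. u \<in> K J \<Longrightarrow> x + u \<in> W"
      using openin_K_nbhd[OF W] by metis
    obtain U where "U \<in> \<U>" "U \<subseteq> K J" using ideal_in_K[OF J(1,2)] by (elim bexE)
    then show "\<exists>U\<in>\<U>. \<forall>u\<in>U. x + u \<in> W" using J(3) by (intro bexI[of _ U]) (auto dest: subsetD)
  qed
next
  assume W: "W \<subseteq> A \<and> (\<forall>x\<in>W. \<exists>U\<in>\<U>. \<forall>u\<in>U. x + u \<in> W)"
  show "openin X W"
    unfolding openin_K_iff
  proof (intro conjI ballI)
    show "W \<subseteq> A" using W by (rule conjunct1)
    fix x assume x: "x \<in> W"
    obtain U where U: "U \<in> \<U>" "\<forall>u\<in>U. x + u \<in> W" using bspec[OF conjunct2[OF W] x] by (elim bexE)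
    obtain J where "finite J" "J \<subseteq> I" "K J \<subseteq> U" using U(1) by (auto simp: \<U>_def)
    then show "\<exists>J. finite J \<and> J \<subseteq> I \<and> (\<forall>u\<in>K J. x + u \<in> W)"
      using U(2) by (intro exI[of _ J]) (auto dest: subsetD)
  qed
qed

lemma Int_\<U>: "U \<in> \<U> \<Longrightarrow> U' \<in> \<U> \<Longrightarrow> U \<inter> U' \<in> \<U>"
proof -
  assume U: "U \<in> \<U>" "U' \<in> \<U>"
  then obtain J J' where J: "finite J" "J \<subseteq> I" "K J \<subseteq> U" "finite J'" "J' \<subseteq> I" "K J' \<subseteq> U'"
    unfolding \<U>_def by blast
  have "K (J \<union> J') \<subseteq> U \<inter> U'" using J(3,6) K_mono[of J "J \<union> J'"] K_mono[of J' "J \<union> J'"] by blast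
  moreover have "ideal (U \<inter> U')" using U unfolding \<U>_def ideal_def by blast
  ultimately show ?thesis unfolding \<U>_def using J by blast
qed

lemma A_\<U>: "A \<in> \<U>"
  unfolding \<U>_def ideal_def using K_A by blast

lemma Inter_\<U>: "finite S \<Longrightarrow> (\<And>i. i \<in> S \<Longrightarrow> F i \<in> \<U>) \<Longrightarrow> U \<in> \<U> \<Longrightarrow> U \<inter> (\<Inter>i\<in>S. F i) \<in> \<U>"
proof (induction S rule: finite_induct)
  case (insert i S)
  have "F i \<inter> (U \<inter> (\<Inter>i\<in>S. F i)) \<in> \<U>" by (intro Int_\<U> insert.prems insert.IH) auto
  moreover have "F i \<inter> (U \<inter> (\<Inter>i\<in>S. F i)) = U \<inter> (\<Inter>i\<in>insert i S. F i)" by auto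
  ultimately show ?case by simp
qed simp

lemma dependent_mod:
  fixes v :: "nat \<Rightarrow> 'a"
  assumes U: "U \<in> \<U>" and v: "\<And>j. v j \<in> A"
  shows "\<exists>m c. (\<exists>j\<le>m. c j \<noteq> 0) \<and> (\<Sum>j\<le>m. \<kappa> (c j) * v j) \<in> U"
proof -
  obtain J where J: "finite J" "J \<subseteq> I" "K J \<subseteq> U" using U unfolding \<U>_def by blast
  obtain B where B: "finite B" "B \<subseteq> A" "\<And>x. x \<in> A \<Longrightarrow> \<exists>b\<in>vs.span B. x - b \<in> K J"
    using K_codim[OF J(1,2)] by blast
  obtain b where b: "\<And>j. b j \<in> vs.span B" "\<And>j. v j - b j \<in> K J" using B(3)[OF v] by metis
  \<comment> \<open>The m + 1 vectors \<open>b 0, ..., b m\<close> lie in the span of m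
    elements.\<close>
  define m where "m = card B"
  have "\<exists>c. (\<exists>j\<le>m. c j \<noteq> 0) \<and> (\<Sum>j\<le>m. sc (c j) (b j)) = 0"
  \<comment> \<open>Linear dependence is a property of sets, so coinciding vectors are treated
    separately.\<close>
  proof (cases "inj_on b {..m}")
    case True
    have "card (b ` {..m}) = Suc m" using card_image[OF True] by simp
    then have "vs.dependent (b ` {..m})"
      using vs.independent_span_bound[OF B(1), of "b ` {..m}"] b(1) unfolding m_def by auto
    then obtain u where u: "\<exists>x\<in>b ` {..m}. u x \<noteq> 0" "(\<Sum>x\<in>b ` {..m}. sc (u x) x) = 0"
      using vs.dependent_finite[of "b ` {..m}"] by auto
    then have "(\<Sum>j\<le>m. sc (u (b j)) (b j)) = 0" by (simp add: sum.reindex[OF True] comp_def)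
    then show ?thesis using u(1) by (intro exI[of _ "\<lambda>j. u (b j)"]) auto
  next
    case False
    then obtain i j where ij: "i \<le> m" "j \<le> m" "i \<noteq> j" "b i = b j" by (auto simp: inj_on_def)
    let ?c = "\<lambda>l. if l = i then 1 else if l = j then - 1 else (0 :: 'k)"
    have "(\<Sum>l\<le>m. sc (?c l) (b l)) = (\<Sum>l\<in>{i, j}. sc (?c l) (b l))"
      by (rule sum.mono_neutral_right) (use ij in auto)
    also have "\<dots> = 0" using ij by simp
    finally have "(\<Sum>l\<le>m. sc (?c l) (b l)) = 0" .
    moreover have "?c i \<noteq> 0" by simp
    ultimately show ?thesis using ij(1) by (intro exI[of _ ?c]) blast
  qed
  then obtain c where c: "\<exists>j\<le>m. c j \<noteq> 0" "(\<Sum>j\<le>m. sc (c j) (b j)) = 0" by blast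
  have "(\<Sum>j\<le>m. \<kappa> (c j) * v j) = (\<Sum>j\<le>m. sc (c j) (v j - b j))"
    using c(2) v by (simp add: scale_\<kappa>[symmetric] vs.scale_right_diff_distrib sum_subtractf)
  also have "\<dots> \<in> K J" by (intro vs.subspace_sum[OF K_subspace[OF J(2)]] K_scale[OF J(2)] b(2))
  finally show ?thesis using c(1) J(3) by blast
qed

sublocale complete_alg A \<kappa> \<U>
proof
  show "\<kappa> c \<in> A" for c by (simp add: \<kappa>_def)
  show "\<kappa> 1 = 1" by (simp add: \<kappa>_def)
  show "\<kappa> (a + b) = \<kappa> a + \<kappa> b" for a b by (simp add: \<kappa>_def vs.scale_left_distrib)
  show "\<kappa> (a * b) = \<kappa> a * \<kappa> b" for a b
    using scale_\<kappa>[of "\<kappa> b" a] by (simp add: \<kappa>_def)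
  show "U \<in> \<U> \<Longrightarrow> ideal U" for U by (simp add: \<U>_def)
  show "U \<in> \<U> \<Longrightarrow> U' \<in> \<U> \<Longrightarrow> U \<inter> U' \<in> \<U>" for U U' by (rule Int_\<U>)
  show "A \<in> \<U>" by (rule A_\<U>)
  show "x = 0" if x: "x \<in> A" "\<And>U. U \<in> \<U> \<Longrightarrow> x \<in> U" for x
  proof (rule h_inj[OF x(1) zero_closed])
    fix i assume i: "i \<in> I"
    then obtain U where "U \<in> \<U>" "U \<subseteq> K {i}" using ideal_in_K[of "{i}"] by auto
    then show "h x i = h 0 i" using x(2) K_D[of x "{i}" i] h_0[OF i] by auto
  qed
  show "\<exists>x\<in>A. \<forall>U\<in>\<U>. x - z U \<in> U"
    if z: "\<And>U. U \<in> \<U> \<Longrightarrow> z U \<in> A" "\<And>U W. U \<in> \<U> \<Longrightarrow> W \<in> \<U> \<Longrightarrow> W \<subseteq> U \<Longrightarrow> z W - z U \<in> U" for z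
  proof -
    have "\<forall>i\<in>I. \<exists>U\<in>\<U>. U \<subseteq> K {i}" using ideal_in_K by simp
    then obtain Ui where Ui: "\<And>i. i \<in> I \<Longrightarrow> Ui i \<in> \<U>" "\<And>i. i \<in> I \<Longrightarrow> Ui i \<subseteq> K {i}" by metis
    \<comment> \<open>Coordinate \<open>i\<close> of the limit is read off at an ideal so small that
      this coordinate no longer changes.\<close>
    define y where "y = (\<lambda>i\<in>I. h (z (Ui i)) i)"
    have "y \<in> Pi\<^sub>E I V" unfolding y_def using h_V z(1) Ui(1) by auto
    then obtain x where x: "x \<in> A" "h x = y" using h_surj by blast
    have "x - z U \<in> U" if U: "U \<in> \<U>" for U
    proof -
      obtain J where J: "finite J" "J \<subseteq> I" "K J \<subseteq> U" "ideal U" using U unfolding \<U>_def by blast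
      \<comment> \<open>A refinement of \<open>U\<close> at which \<open>z\<close> agrees with the
        limit in all coordinates from \<open>J\<close>.\<close>
      define W where "W = U \<inter> (\<Inter>i\<in>J. Ui i)"
      have W: "W \<in> \<U>" unfolding W_def using J(1,2) Ui(1) U by (intro Inter_\<U>) auto
      have "x - z W \<in> K J"
        unfolding K_def
      proof (intro CollectI conjI ballI)
        show "x - z W \<in> A" using x(1) z(1)[OF W] by simp
        fix i assume i: "i \<in> J"
        then have iI: "i \<in> I" using J(2) by blast
        have "W \<subseteq> Ui i" using i by (auto simp: W_def)
        then have "z W - z (Ui i) \<in> K {i}" using z(2)[OF Ui(1)[OF iI] W] Ui(2)[OF iI] by blast
        then have "h (z W) i = h (z (Ui i)) i"
          using K_D[of _ "{i}" i] h_diff[OF z(1)[OF W] z(1)[OF Ui(1)[OF iI]] iI] by simp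
        then show "h (x - z W) i = 0"
          using h_diff[OF x(1) z(1)[OF W] iI] x(2) iI by (simp add: y_def)
      qed
      moreover have "z W - z U \<in> U" by (rule z(2)[OF U W]) (auto simp: W_def)
      ultimately have "(x - z W) + (z W - z U) \<in> U" using J(3,4) ideal_add by blast
      then show ?thesis by simp
    qed
    then show ?thesis using x(1) by blast
  qed
  show "\<exists>(m::nat) c. (\<exists>j\<le>m. c j \<noteq> 0) \<and> (\<Sum>j\<le>m. \<kappa> (c j) * v j) \<in> U"
    if "U \<in> \<U>" "\<And>j. v j \<in> A" for U v
    using dependent_mod that by blast
qed

lemma cont_\<U>:
  assumes F: "continuous_map X X F" "F 0 = 0" and U: "U \<in> \<U>"
  shows "\<exists>W\<in>\<U>. \<forall>x\<in>W. F x \<in> U"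
proof -
  obtain J where J: "finite J" "J \<subseteq> I" "K J \<subseteq> U" using U by (auto simp: \<U>_def)
  obtain J' where J': "finite J'" "J' \<subseteq> I" "\<forall>x\<in>K J'. F x \<in> K J"
    using cont_K[OF F J(1,2)] by (elim exE conjE)
  obtain W where "W \<in> \<U>" "W \<subseteq> K J'" using ideal_in_K[OF J'(1,2)] by (elim bexE)
  then show ?thesis using J'(3) J(3) by blast
qed

end

section \<open>Classification\<close>

context power_series_coords
begin

lemma taylor_sum: "(\<And>i. i \<in> S \<Longrightarrow> f i \<in> A) \<Longrightarrow> taylor (sum f S) = (\<Sum>i\<in>S. taylor (f i))"
  by (induction S rule: infinite_finite_induct) (simp_all add: taylor_0 taylor_add sum_closed)

lemma taylor_prod: "(\<And>i. i \<in> S \<Longrightarrow> f i \<in> A) \<Longrightarrow> taylor (prod f S) = (\<Prod>i\<in>S. taylor (f i))"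
  by (induction S rule: infinite_finite_induct) (simp_all add: taylor_1 taylor_mult prod_closed)

lemma taylor_sign: "taylor (of_int (sign p)) = of_int (sign p)"
  using taylor_diff[of 0 1] by (auto simp: sign_def taylor_0 taylor_1)

lemma taylor_det_op:
  assumes F: "\<And>i x. i < n \<Longrightarrow> x \<in> A \<Longrightarrow> F i x \<in> A" "\<And>i x. i < n \<Longrightarrow> x \<in> A \<Longrightarrow> taylor (F i x) = F' i (taylor x)"
    and g: "\<And>i. i < n \<Longrightarrow> g i \<in> A"
  shows "taylor (det_op n F g) = det_op n F' (\<lambda>i. taylor (g i))"
proof -
  have s: "s i < n" if "s permutes {..<n}" "i < n" for s i
    using permutes_in_image[OF that(1), of i] that(2) by auto
  have cl: "(\<Prod>i<n. F (s i) (g i)) \<in> A" if "s permutes {..<n}" for s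
    by (rule prod_closed) (use F(1) g s[OF that] in auto)
  have "taylor (det_op n F g) = (\<Sum>s | s permutes {..<n}. taylor (of_int (sign s) * (\<Prod>i<n. F (s i) (g i))))"
    unfolding det_op_sum by (rule taylor_sum) (use cl in auto)
  also have "\<dots> = (\<Sum>s | s permutes {..<n}. of_int (sign s) * (\<Prod>i<n. F' (s i) (taylor (g i))))"
  proof (rule sum.cong[OF refl])
    fix p assume "p \<in> {s. s permutes {..<n}}"
    then have p: "p permutes {..<n}" by simp
    have "taylor (\<Prod>i<n. F (p i) (g i)) = (\<Prod>i<n. taylor (F (p i) (g i)))"
      by (rule taylor_prod) (use F(1) g s[OF p] in auto)
    also have "\<dots> = (\<Prod>i<n. F' (p i) (taylor (g i)))"
      by (rule prod.cong[OF refl]) (use F(2) g s[OF p] in auto)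
    finally show "taylor (of_int (sign p) * (\<Prod>i<n. F (p i) (g i))) = of_int (sign p) * (\<Prod>i<n. F' (p i) (taylor (g i)))"
      by (simp only: taylor_mult[OF of_int_sign_closed cl[OF p]] taylor_sign)
  qed
  finally show ?thesis by (simp add: det_op_sum)
qed

text \<open>The hypothesis identifies the gauge of \<open>N\<close> by \<open>\<phi>\<close> with
  \<open>S\<close>; solved for the bracket of \<open>N\<close>, it gives the gauge of
  \<open>S\<close> by \<open>taylor \<psi>\<close>, whose inverse is
  \<open>taylor \<phi>\<close>.\<close>

lemma taylor_gauge_equivalent:
  fixes N :: "('k, 'a) np_struct" and S :: "('k, 'k mps) np_struct"
  assumes N: "np_space N = A" "\<And>c x. x \<in> A \<Longrightarrow> np_scale N c x = \<kappa> c * x"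
    and top: "\<And>W. openin (np_topology N) W \<longleftrightarrow> W \<subseteq> A \<and> (\<forall>x\<in>W. \<exists>U\<in>\<U>. \<forall>u\<in>U. x + u \<in> W)"
      "topspace (np_topology N) = A"
    and S: "np_space S = mps_vars m" "np_scale S = mps_scale" "np_topology S = mps_topology m"
    and units: "\<phi> \<in> A" "\<psi> \<in> A" "\<phi> * \<psi> = 1"
    and bracket: "\<And>g. (\<And>i. i < n \<Longrightarrow> g i \<in> A) \<Longrightarrow> taylor (\<psi> * np_bracket N (map (\<lambda>i. \<phi> * g i) [0..<n]))
      = np_bracket S (map (\<lambda>i. taylor (g i)) [0..<n])"
    and closed: "\<And>xs. xs \<in> np_args n N \<Longrightarrow> np_bracket N xs \<in> A"
  shows "gauge_equivalent n N S"
proof -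
  have T: "taylor \<psi> * taylor \<phi> = 1"
    using taylor_mult[OF units(2,1)] units(3) by (simp add: taylor_1 mult.commute)
  have the: "(THE x. taylor \<psi> * x = 1) = taylor \<phi>"
  proof (rule the_equality)
    show "taylor \<psi> * taylor \<phi> = 1" by (rule T)
    fix x assume "taylor \<psi> * x = 1"
    then have "(taylor \<psi> * taylor \<phi>) * x = taylor \<phi>" by (simp add: mult.commute[of _ "taylor \<phi>"] mult.assoc)
    then show "x = taylor \<phi>" using T by simp
  qed
  have "taylor \<psi> \<in> np_units S"
    unfolding np_units_def S using T taylor_vars by blast
  moreover have "np_isomorphic n N (np_gauge (taylor \<psi>) S)"
    unfolding np_isomorphic_def np_gauge_def
  proof (intro exI[of _ taylor] conjI ballI allI)
    show "bij_betw taylor (np_space N) (np_space (S\<lparr>np_bracket := \<lambda>fs. (THE x. taylor \<psi> * x = 1) * np_bracket S (map ((*) (taylor \<psi>)) fs)\<rparr>))"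
      using taylor_bij by (simp add: N S)
    show "homeomorphic_map (np_topology N) (np_topology (S\<lparr>np_bracket := \<lambda>fs. (THE x. taylor \<psi> * x = 1) * np_bracket S (map ((*) (taylor \<psi>)) fs)\<rparr>)) taylor"
      using taylor_homeomorphic[OF top] by (simp add: S)
    show "taylor (np_scale N c x) = np_scale (S\<lparr>np_bracket := \<lambda>fs. (THE x. taylor \<psi> * x = 1) * np_bracket S (map ((*) (taylor \<psi>)) fs)\<rparr>) c (taylor x)"
      if "x \<in> np_space N" for c x
      using that taylor_scale by (simp add: N S)
    fix xs assume xs: "xs \<in> np_args n N"
    then have len: "length xs = n" and xA: "xs ! i \<in> A" if "i < n" for i
      using that nth_mem[of i xs] by (auto simp: np_args_def N)
    then have len: "length xs = n" using xs by (simp add: np_args_def)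
    let ?g = "\<lambda>i. \<psi> * xs ! i"
    have "map (\<lambda>i. \<phi> * ?g i) [0..<n] = xs"
      using len units(3) by (intro nth_equalityI) (simp_all flip: mult.assoc)
    then have *: "taylor (\<psi> * np_bracket N xs) = np_bracket S (map (\<lambda>i. taylor (?g i)) [0..<n])"
      using bracket[of ?g] xA units(2) by simp
    have "map (\<lambda>i. taylor (?g i)) [0..<n] = map ((*) (taylor \<psi>)) (map taylor xs)"
      using len xA units(2) by (intro nth_equalityI) (simp_all add: taylor_mult)
    moreover have "taylor (\<psi> * np_bracket N xs) = taylor \<psi> * taylor (np_bracket N xs)"
      by (rule taylor_mult[OF units(2) closed[OF xs]])
    ultimately have "taylor \<phi> * (taylor \<psi> * taylor (np_bracket N xs))
        = taylor \<phi> * np_bracket S (map ((*) (taylor \<psi>)) (map taylor xs))"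
      using * by simp
    moreover have "taylor \<phi> * (taylor \<psi> * y) = y" for y
    proof -
      have "taylor \<phi> * (taylor \<psi> * y) = (taylor \<psi> * taylor \<phi>) * y" by (simp only: mult_ac)
      then show ?thesis unfolding T by simp
    qed
    ultimately show "taylor (np_bracket N xs) = np_bracket
        (S\<lparr>np_bracket := \<lambda>fs. (THE x. taylor \<psi> * x = 1) * np_bracket S (map ((*) (taylor \<psi>)) fs)\<rparr>) (map taylor xs)"
      by (simp add: the)
  qed (simp_all add: N S taylor_1 taylor_add taylor_mult)
  ultimately show ?thesis unfolding gauge_equivalent_def by blast
qed

end

text \<open>The Leibniz rule for \<open>p = p * p\<close> yields
  \<open>B (g(0 := p)) = p * B (g(0 := 1))\<close>; then multiplication by \<open>p\<close> passes
  through slot 0, so the ideal generated by \<open>p\<close> is stable.\<close>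

lemma (in filippov) idempotent_trivial:
  assumes simple: "\<And>I. ideal I \<Longrightarrow> (\<And>g. args g \<Longrightarrow> g 0 \<in> I \<Longrightarrow> B g \<in> I) \<Longrightarrow> I = {0} \<or> I = A"
    and p: "p \<in> A" "p * p = p"
  shows "p = 0 \<or> p = 1"
proof -
  let ?I = "(\<lambda>x. p * x) ` A"
  have I: "ideal ?I"
    unfolding ideal_def
  proof (intro conjI ballI)
    show "0 \<in> ?I" using image_eqI[of 0 "\<lambda>x. p * x" 0 A] by simp
    show "x + y \<in> ?I" if "x \<in> ?I" "y \<in> ?I" for x y
      using that by (auto simp flip: distrib_left)
    show "a * x \<in> ?I" if a: "a \<in> A" and x: "x \<in> ?I" for a x
    proof -
      obtain y where "y \<in> A" "x = p * y" using x by blast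
      then have "a * x = p * (a * y)" "a * y \<in> A" using a by (simp_all add: mult.left_commute)
      then show ?thesis by blast
    qed
  qed (use p in auto)
  have "?I = {0} \<or> ?I = A"
  proof (rule simple[OF I])
    fix g assume g: "args g" "g 0 \<in> ?I"
    then obtain x where x: "x \<in> A" "g 0 = p * x" by blast
    have n0: "0 < n" using n_gt_2 by simp
    let ?b = "\<lambda>x. B (g(0 := x))"
    have 1: "?b p = ?b p * p + p * ?b p - ?b 1 * p * p"
      using B_leibniz[OF g(1) n0 p(1) p(1)] p(2) by simp
    have "p * ?b p = p * (?b p * p + p * ?b p - ?b 1 * p * p)" using 1 by simp
    also have "\<dots> = (p * p) * ?b p + (p * p) * ?b p - (p * p) * (p * ?b 1)" by (simp add: algebra_simps)
    also have "\<dots> = p * ?b p + p * ?b p - (p * p) * ?b 1" unfolding p(2) mult.assoc[symmetric] by simp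
    finally have 2: "p * ?b p = p * ?b 1" unfolding p(2) by (simp add: algebra_simps)
    have "?b p = p * ?b p + p * ?b p - (p * p) * ?b 1" using 1 by (simp add: algebra_simps)
    then have 3: "?b p = p * ?b 1" unfolding p(2) 2 by simp
    have "?b (p * x) = ?b p * x + p * ?b x - ?b 1 * p * x" by (rule B_leibniz[OF g(1) n0 p(1) x(1)])
    also have "\<dots> = p * ?b x" unfolding 3 by (simp add: algebra_simps)
    finally have "B (g(0 := g 0)) = p * ?b x" unfolding x(2) .
    moreover have "?b x \<in> A" using g(1) x(1) by blast
    ultimately show "B g \<in> ?I" by simp
  qed
  then show ?thesis
  proof
    assume "?I = {0}"
    then have "p * 1 = 0" using one_closed by blast
    then show ?thesis by simp
  next
    assume "?I = A"
    then obtain x where "1 = p * x" using one_closed by blast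
    then have "p = p * (p * x)" by simp
    also have "\<dots> = p * x" by (simp only: mult.assoc[symmetric] p(2))
    finally show ?thesis using \<open>1 = p * x\<close> by simp
  qed
qed

section \<open>From list brackets to brackets on functions\<close>

definition np_fun :: "nat \<Rightarrow> ('k, 'a) np_struct \<Rightarrow> (nat \<Rightarrow> 'a) \<Rightarrow> 'a" where
  "np_fun n N g = np_bracket N (map g [0..<n])"

lemma map_upd_upt: "k < n \<Longrightarrow> (map g [0..<n])[k := x] = map (g(k := x)) [0..<n]"
  by (rule nth_equalityI) (auto simp: nth_list_update)

lemma map_upd_last: "0 < n \<Longrightarrow> map (g(n - 1 := x)) [0..<n] = map g [0..<n - 1] @ [x]"
  by (rule nth_equalityI) (auto simp: nth_append)

context lc_algebra
begin

lemma args_iff: "slots.args A n g \<longleftrightarrow> map g [0..<n] \<in> np_args n N"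
proof -
  interpret slots A n by unfold_locales (rule torsion_free)
  show ?thesis by (auto simp: args_def np_args_def)
qed

text \<open>The Leibniz and Filippov axioms speak of the last slot; a transposition carries them to
  any slot, with the same sign on every term.\<close>

lemma filippov_np_fun:
  assumes n: "2 < n" and gnp: "gen_nambu_poisson_algebra n N"
  shows "filippov A n (np_fun n N)"
proof -
  interpret slots A n by unfold_locales (rule torsion_free)
  let ?B = "np_fun n N"
  have lie: "n_lie_algebra n N" using gnp by (simp add: gen_nambu_poisson_algebra_def)
  note lie' = lie[unfolded n_lie_algebra_def]
  have n0: "0 < n" "n - 1 < n" using n by auto
  have skew_B: "skew ?B"
    unfolding skew_def
  proof (intro conjI allI impI)
    show "?B g = ?B h" if "\<forall>i<n. g i = h i" for g h
      unfolding np_fun_def using that by (intro arg_cong[of _ _ "np_bracket N"] map_cong) auto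
    show "?B g \<in> A" if "args g" for g
      unfolding np_fun_def using lie' that unfolding args_iff by blast
    fix g p assume g: "args g" and p: "p permutes {..<n}"
    have "p i < n" if "i < n" for i using permutes_in_image[OF p, of i] that by auto
    then have "map (g \<circ> p) [0..<n] = permute_list p (map g [0..<n])"
      unfolding permute_list_def by (intro nth_equalityI) auto
    then show "?B (g \<circ> p) = of_int (sign p) * ?B g"
      using lie' g p unfolding args_iff np_fun_def by simp
  qed
  have add: "?B (g(k := x + y)) = ?B (g(k := x)) + ?B (g(k := y))"
    if "args g" "k < n" "x \<in> A" "y \<in> A" for g k x y
    using lie' that unfolding args_iff np_fun_def map_upd_upt[OF that(2), symmetric] by blast
  have zero: "?B (g(k := 0)) = 0" if "args g" "k < n" for g k
    using add[OF that, of 0 0] by simp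
  have neg: "?B (g(k := - x)) = - ?B (g(k := x))" if "args g" "k < n" "x \<in> A" for g k x
    using add[OF that(1,2), of x "- x"] zero[OF that(1,2)] that(3)
    by (simp add: eq_neg_iff_add_eq_0 add.commute)
  have to_last: "?B (g(k := x)) = - ?B ((g(k := g (n - 1)))(n - 1 := x))"
    if "args g" "k < n" "x \<in> A" "k \<noteq> n - 1" for g k x
  proof -
    have "(g(k := x))(k := (g(k := x)) (n - 1), n - 1 := (g(k := x)) k) = (g(k := g (n - 1)))(n - 1 := x)"
      using that(4) by (auto simp: fun_eq_iff)
    then show ?thesis
      using skew_swap[OF skew_B args_upd[OF that(1,3)] that(2) n0(2) that(4), of k] by simp
  qed
  have as: "map g [0..<n - 1] \<in> np_args (n - 1) N" if "args g" for g
    using argsD[OF that] by (auto simp: np_args_def)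
  have leib_last: "?B (g(n - 1 := x * y)) = ?B (g(n - 1 := x)) * y + x * ?B (g(n - 1 := y)) - ?B (g(n - 1 := 1)) * x * y"
    if "args g" "x \<in> A" "y \<in> A" for g x y
    using gnp as[OF that(1)] that(2,3)
    unfolding gen_nambu_poisson_algebra_def np_fun_def map_upd_last[OF n0(1)] by blast
  have jac_last: "?B (g(n - 1 := ?B h)) = (\<Sum>j<n. ?B (h(j := ?B (g(n - 1 := h j)))))"
    if "args g" "args h" for g h
  proof -
    have "np_bracket N (map g [0..<n - 1] @ [np_bracket N (map h [0..<n])]) =
        (\<Sum>j<n. np_bracket N ((map h [0..<n])[j := np_bracket N (map g [0..<n - 1] @ [map h [0..<n] ! j])]))"
      using lie' as[OF that(1)] that(2) unfolding args_iff by blast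
    also have "\<dots> = (\<Sum>j<n. ?B (h(j := ?B (g(n - 1 := h j)))))"
    proof (rule sum.cong[OF refl])
      fix j assume "j \<in> {..<n}"
      then have j: "j < n" and nth: "map h [0..<n] ! j = h j" by simp_all
      show "np_bracket N ((map h [0..<n])[j := np_bracket N (map g [0..<n - 1] @ [map h [0..<n] ! j])])
          = ?B (h(j := ?B (g(n - 1 := h j))))"
        by (simp only: np_fun_def map_upd_last[OF n0(1)] map_upd_upt[OF j] nth)
    qed
    finally show ?thesis by (simp only: np_fun_def map_upd_last[OF n0(1)])
  qed
  have B_cl: "?B g \<in> A" if "args g" for g using skew_closed[OF skew_B that] .
  show ?thesis
  proof unfold_locales
    fix g k x y assume g: "args g" and k: "k < n" and x: "x \<in> A" and y: "y \<in> A"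
    show "?B (g(k := x * y)) = ?B (g(k := x)) * y + x * ?B (g(k := y)) - ?B (g(k := 1)) * x * y"
    proof (cases "k = n - 1")
      case False
      have g': "args (g(k := g (n - 1)))" using g argsD[OF g n0(2)] by simp
      show ?thesis
        unfolding to_last[OF g k mult_closed[OF x y] False] to_last[OF g k x False]
          to_last[OF g k y False] to_last[OF g k one_closed False] leib_last[OF g' x y]
        by (simp add: algebra_simps)
    qed (use leib_last[OF g x y] in simp)
  next
    fix g h k assume g: "args g" and h: "args h" and k: "k < n"
    show "?B (g(k := ?B h)) = (\<Sum>j<n. ?B (h(j := ?B (g(k := h j)))))"
    proof (cases "k = n - 1")
      case False
      have g': "args (g(k := g (n - 1)))" using g argsD[OF g n0(2)] by simp
      have "?B (h(j := ?B (g(k := h j)))) = - ?B (h(j := ?B ((g(k := g (n - 1)))(n - 1 := h j))))"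
        if "j < n" for j
      proof -
        have hj: "h j \<in> A" using argsD[OF h that] .
        show ?thesis
          unfolding to_last[OF g k hj False]
          by (rule neg[OF h that]) (intro B_cl args_upd g' hj)
      qed
      then show ?thesis
        unfolding to_last[OF g k B_cl[OF h] False] jac_last[OF g' h] by (simp add: sum_negf)
    qed (use jac_last[OF g h] in simp)
  qed (use n skew_B add in auto)
qed

text \<open>Scalars act through \<open>\<kappa>\<close>, so ideals are subspaces and the simplicity
  of \<open>N\<close> applies to them.\<close>

lemma ideal_of_np_simple:
  assumes n: "2 < n" and simple: "np_simple n N" and Z: "ideal Z"
    and st: "\<And>g. slots.args A n g \<Longrightarrow> g 0 \<in> Z \<Longrightarrow> np_fun n N g \<in> Z"
  shows "Z = {0} \<or> Z = A"
proof -
  have "vs.subspace Z"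
    by (rule vs.subspaceI)
      (use ideal_zero[OF Z] ideal_add[OF Z] ideal_mult[OF Z] scale_\<kappa> ideal_subset[OF Z] in auto)
  moreover have "np_bracket N (x # as) \<in> Z" if "x \<in> Z" "as \<in> np_args (n - 1) N" for x as
  proof -
    have "map (\<lambda>i. (x # as) ! i) [0..<n] = x # as"
      using that(2) n by (intro nth_equalityI) (auto simp: np_args_def)
    moreover have "x # as \<in> np_args n N"
      using that n ideal_subset[OF Z that(1)] by (auto simp: np_args_def)
    ultimately show ?thesis using st[of "\<lambda>i. (x # as) ! i"] that(1) unfolding args_iff np_fun_def by simp
  qed
  ultimately show ?thesis
    using simple ideal_subset[OF Z] ideal_mult[OF Z] unfolding np_simple_def by blast
qed

lemma np_fun_continuous:
  assumes cont: "continuous_map (product_topology (\<lambda>_. X) {..<n}) X (\<lambda>f. np_bracket N (map f [0..<n]))"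
    and g: "slots.args A n g" and k: "k < n"
  shows "continuous_map X X (\<lambda>x. np_fun n N (g(k := x)))"
proof -
  interpret slots A n by unfold_locales (rule torsion_free)
  let ?r = "\<lambda>x. restrict (g(k := x)) {..<n}"
  have "continuous_map X (product_topology (\<lambda>_. X) {..<n}) ?r"
    unfolding continuous_map_componentwise
  proof (intro conjI ballI)
    fix i assume i: "i \<in> {..<n}"
    show "continuous_map X X (\<lambda>x. ?r x i)"
      using i argsD[OF g, of i] top by (cases "i = k") simp_all
  qed auto
  from continuous_map_compose[OF this cont]
  have "continuous_map X X (\<lambda>x. np_bracket N (map (?r x) [0..<n]))" by (simp add: comp_def)
  moreover have "map (?r x) [0..<n] = map (g(k := x)) [0..<n]" for x by (intro map_cong) auto
  ultimately show ?thesis by (simp only: np_fun_def)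
qed

end

theorem theorem0p2:
  fixes N :: "('k::{alg_closed_field, field_char_0}, 'a::comm_ring_1) np_struct" and n :: nat
  assumes "n > 2"
    and "gen_nambu_poisson_algebra n N"
    and "np_linearly_compact n N"
    and "np_simple n N"
  shows "gauge_equivalent n N (nambu_algebra n) \<or> gauge_equivalent n N (dzhumadildaev_algebra n)"
proof -
  have "linearly_compact (np_scale N) (np_topology N)" "topspace (np_topology N) = np_space N"
    using assms(3) by (simp_all add: np_linearly_compact_def)
  then obtain I :: "'a set" and V h where lc': "(\<forall>i\<in>I. \<exists>B. finite B \<and> V i = module.span (np_scale N) B) \<and>
      homeomorphic_map (np_topology N) (product_topology (\<lambda>i. discrete_topology (V i)) I) h \<and>
      (\<forall>x\<in>topspace (np_topology N). \<forall>y\<in>topspace (np_topology N). \<forall>i\<in>I. h (x + y) i = h x i + h y i) \<and>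
      (\<forall>c. \<forall>x\<in>topspace (np_topology N). \<forall>i\<in>I. h (np_scale N c x) i = np_scale N c (h x i))"
    unfolding linearly_compact_def by (elim exE) (rule that; assumption)
  have lc: "\<And>i. i \<in> I \<Longrightarrow> \<exists>B. finite B \<and> V i = module.span (np_scale N) B"
    "homeomorphic_map (np_topology N) (product_topology (\<lambda>i. discrete_topology (V i)) I) h"
    "\<And>x y i. x \<in> np_space N \<Longrightarrow> y \<in> np_space N \<Longrightarrow> i \<in> I \<Longrightarrow> h (x + y) i = h x i + h y i"
    "\<And>c x i. x \<in> np_space N \<Longrightarrow> i \<in> I \<Longrightarrow> h (np_scale N c x) i = np_scale N c (h x i)"
    using lc' \<open>topspace (np_topology N) = np_space N\<close> by simp_all
  interpret lc_algebra N I V h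
  proof
    show "commutative_algebra N" using assms(2) by (simp add: gen_nambu_poisson_algebra_def)
    show "continuous_map (prod_topology (np_topology N) (np_topology N)) (np_topology N) (\<lambda>(x, y). x * y)"
      "topspace (np_topology N) = np_space N"
      using assms(3) by (simp_all add: np_linearly_compact_def)
  qed (fact lc)+
  let ?B = "np_fun n N"
  interpret F: filippov A n ?B by (rule filippov_np_fun[OF assms(1,2)])
  note ideal_simple = ideal_of_np_simple[OF assms(1,4)]
  \<comment> \<open>Simplicity excludes nontrivial idempotents, which makes the algebra
    local.\<close>
  interpret bracket_alg A \<kappa> \<U> n
    by unfold_locales (rule F.idempotent_trivial[OF ideal_simple])
  have lin: "linop (\<lambda>x. ?B (g(k := x)))" if g: "F.args g" and k: "k < n" for g k
    unfolding linop_def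
  proof (intro conjI ballI allI)
    show "?B (g(k := \<kappa> c * x)) = \<kappa> c * ?B (g(k := x))" if x: "x \<in> A" for c x
    proof -
      have "map g [0..<n] \<in> np_args n N" using g by (simp only: args_iff)
      then have "np_bracket N ((map g [0..<n])[k := sc c x]) = sc c (np_bracket N ((map g [0..<n])[k := x]))"
        using assms(2) k x unfolding gen_nambu_poisson_algebra_def n_lie_algebra_def by blast
      then have "?B (g(k := sc c x)) = sc c (?B (g(k := x)))" by (simp only: np_fun_def map_upd_upt[OF k])
      then show ?thesis
        using scale_\<kappa>[OF x] scale_\<kappa>[OF F.B_closed[OF F.args_upd[OF g x]]] by simp
    qed
    show "\<exists>W\<in>\<U>. \<forall>x\<in>W. ?B (g(k := x)) \<in> U" if "U \<in> \<U>" for U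
    proof (rule cont_\<U>[OF np_fun_continuous[OF _ g k] F.B_zero[OF g k] that])
      show "continuous_map (product_topology (\<lambda>_. X) {..<n}) X (\<lambda>f. np_bracket N (map f [0..<n]))"
        using assms(3) by (simp add: np_linearly_compact_def)
    qed
  qed (use g k F.B_add in auto)
  have nonzero: "\<exists>g. F.args g \<and> ?B g \<noteq> 0"
  proof -
    obtain xs where xs: "xs \<in> np_args n N" "np_bracket N xs \<noteq> 0" using assms(4) by (auto simp: np_simple_def)
    then have "map (\<lambda>i. xs ! i) [0..<n] = xs" by (intro nth_equalityI) (auto simp: np_args_def)
    then show ?thesis using xs unfolding args_iff np_fun_def by metis
  qed
  have "simple_bracket ?B"
    unfolding simple_bracket_def using F.filippov_axioms lin nonzero ideal_simple by blast
  then obtain \<phi> \<psi> where units: "\<phi> \<in> A" "\<psi> \<in> A" "\<phi> * \<psi> = 1"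
    and form: "nambu_form (gauge \<phi> \<psi> ?B) \<or> dzhumadildaev_form (gauge \<phi> \<psi> ?B)"
    using normal_form by blast
  have closed: "np_bracket N xs \<in> A" if "xs \<in> np_args n N" for xs
    using assms(2) that by (simp add: gen_nambu_poisson_algebra_def n_lie_algebra_def)
  from form show ?thesis
  proof
    assume "nambu_form (gauge \<phi> \<psi> ?B)"
    then obtain \<delta> z where \<delta>: "power_series_coords A \<kappa> \<U> n \<delta> z"
      "\<And>g. F.args g \<Longrightarrow> gauge \<phi> \<psi> ?B g = det_op n \<delta> g" unfolding nambu_form_def by blast
    interpret C: power_series_coords A \<kappa> \<U> n \<delta> z by (rule \<delta>(1))
    have "gauge_equivalent n N (nambu_algebra n)"
    proof (rule C.taylor_gauge_equivalent[OF _ scale_\<kappa> openin_\<U>_iff top _ _ _ units _ closed])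
      fix g :: "nat \<Rightarrow> 'a" assume g: "\<And>i. i < n \<Longrightarrow> g i \<in> A"
      have "C.taylor (\<psi> * np_bracket N (map (\<lambda>i. \<phi> * g i) [0..<n])) = C.taylor (det_op n \<delta> g)"
        using \<delta>(2)[of g] g by (simp add: F.args_def gauge_def np_fun_def)
      also have "\<dots> = det_op n mps_deriv (\<lambda>i. C.taylor (g i))"
        by (rule C.taylor_det_op) (simp_all add: C.taylor_\<delta> g)
      also have "\<dots> = np_bracket (nambu_algebra n) (map (\<lambda>i. C.taylor (g i)) [0..<n])"
        unfolding det_op_def nambu_algebra_def np_struct.simps
        by (intro arg_cong[of _ _ Determinant.det] eq_matI) auto
      finally show "C.taylor (\<psi> * np_bracket N (map (\<lambda>i. \<phi> * g i) [0..<n]))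
          = np_bracket (nambu_algebra n) (map (\<lambda>i. C.taylor (g i)) [0..<n])" .
    qed (simp_all add: nambu_algebra_def)
    then show ?thesis ..
  next
    assume "dzhumadildaev_form (gauge \<phi> \<psi> ?B)"
    then obtain \<delta> z where \<delta>: "power_series_coords A \<kappa> \<U> (n - 1) \<delta> z"
      "\<And>g. F.args g \<Longrightarrow> gauge \<phi> \<psi> ?B g = det_op n (\<lambda>j x. if j = 0 then x else \<delta> (j - 1) x) g"
      unfolding dzhumadildaev_form_def by blast
    interpret C: power_series_coords A \<kappa> \<U> "n - 1" \<delta> z by (rule \<delta>(1))
    have "gauge_equivalent n N (dzhumadildaev_algebra n)"
    proof (rule C.taylor_gauge_equivalent[OF _ scale_\<kappa> openin_\<U>_iff top _ _ _ units _ closed])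
      fix g :: "nat \<Rightarrow> 'a" assume g: "\<And>i. i < n \<Longrightarrow> g i \<in> A"
      let ?F = "\<lambda>j f. if j = 0 then f else mps_deriv (j - 1) f"
      have "C.taylor (\<psi> * np_bracket N (map (\<lambda>i. \<phi> * g i) [0..<n]))
          = C.taylor (det_op n (\<lambda>j x. if j = 0 then x else \<delta> (j - 1) x) g)"
        using \<delta>(2)[of g] g by (simp add: F.args_def gauge_def np_fun_def)
      also have "\<dots> = det_op n ?F (\<lambda>i. C.taylor (g i))"
      proof (rule C.taylor_det_op)
        fix i x assume "i < n" and x: "x \<in> A"
        then have i: "i - 1 < n - 1" if "i \<noteq> 0" using that by linarith
        show "(if i = 0 then x else \<delta> (i - 1) x) \<in> A" using C.\<delta>_closed[OF i x] x by (cases "i = 0") auto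
        show "C.taylor (if i = 0 then x else \<delta> (i - 1) x) = ?F i (C.taylor x)"
          using C.taylor_\<delta>[OF i x] by (cases "i = 0") auto
      qed (rule g)
      \<comment> \<open>The matrix of the Dzhumadildaev bracket has the arguments as
        columns.\<close>
      also have "\<dots> = Determinant.det (transpose_mat (Matrix.mat n n (\<lambda>(i, j). ?F j (C.taylor (g i)))))"
        unfolding det_op_def by (rule det_transpose[OF mat_carrier, symmetric])
      also have "\<dots> = np_bracket (dzhumadildaev_algebra n) (map (\<lambda>i. C.taylor (g i)) [0..<n])"
        unfolding dzhumadildaev_algebra_def np_struct.simps
        by (intro arg_cong[of _ _ Determinant.det] eq_matI) auto
      finally show "C.taylor (\<psi> * np_bracket N (map (\<lambda>i. \<phi> * g i) [0..<n]))
          = np_bracket (dzhumadildaev_algebra n) (map (\<lambda>i. C.taylor (g i)) [0..<n])" .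
    qed (simp_all add: dzhumadildaev_algebra_def)
    then show ?thesis ..
  qed
qed

end
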